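(* Let $\alpha\in(1,2)$ and let $(Z_t)_{t\ge0}$ be a one-dimensional symmetric $\alpha$-stable Lévy process. Let $\nu$ be the invariant measure of the stable Ornstein–Uhlenbeck process $\mathrm dX_t=-X_t\,\mathrm dt+\mathrm dZ_t$. Let $(\gamma_n)_{n\in\mathbb N}$ be a decreasing sequence of positive numbers with $\lim_{n\to\infty}\gamma_n=0$, $\sum_{n=1}^\infty\gamma_n=\infty$, put $t_0=0$, $t_n=\sum_{i=1}^n\gamma_i$, and suppose that, with $\theta=\frac{2-\alpha}{\alpha}$, $$\omega:=\limsup_{k\to\infty}\frac{\gamma_k^\theta-\gamma_{k+1}^\theta}{\gamma_{k+1}^{1+\theta}}<\rho\wedge1,\qquad \rho:=d^{2\alpha-4}2^{-d}e^{-2^dd^{4-2\alpha}}\big|_{d=1}=\tfrac12e^{-2}.$$ For $x\in\mathbb R$ let $\tilde Y^x_{0}=x$ and, for $n\ge0$, $$\tilde Y^x_{t_{n+1}}=\tilde Y^x_{t_n}-\gamma_{n+1}\tilde Y^x_{t_n}+\frac{\gamma_{n+1}^{1/\alpha}}{\beta}\tilde Z_{n+1},$$ where $\beta=\left(\frac{\alpha}{2d_\alpha}\right)^{1/\alpha}$ and $(\tilde Z_n)_{n\ge1}$ are i.i.d. real random variables with density $p(z)=\frac{\alpha}{2|z|^{\alpha+1}}1_{(1,\infty)}(|z|)$. Then for every $x\in\mathbb R$, $$0<\liminf_{n\to\infty}\frac{W_1(\nu,\mathcal L(\tilde Y_{t_n}^x))}{\gamma_n^{\frac2\alpha-1}}\le\limsup_{n\to\infty}\frac{W_1(\nu,\mathcal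 L(\tilde Y_{t_n}^x))}{\gamma_n^{\frac2\alpha-1}}<\infty .$$
   Context: The process $(Z_t)$ is normalized to have Lévy measure $\frac{d_\alpha}{|z|^{1+\alpha}}\,\mathrm dz$ with $d_\alpha=\alpha2^{\alpha-1}\pi^{-1/2}\Gamma(\frac{1+\alpha}{2})/\Gamma(1-\frac\alpha2)$, i.e. $\mathbb E e^{i\lambda Z_t}=e^{-t|\lambda|^\alpha}$. $\mathcal L(\xi)$ is the law of $\xi$; $a\wedge b=\min\{a,b\}$. $W_1$ is the Wasserstein-1 distance on probability measures on $\mathbb R$, $W_1(\nu_1,\nu_2)=\sup_{h\in\mathrm{Lip}(1)}\left(\int h\,\mathrm d\nu_1-\int h\,\mathrm d\nu_2\right)$, with $\mathrm{Lip}(1)$ the functions with Lipschitz constant at most $1$. *)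

theory Defs
  imports "HOL-Probability.Probability"
begin

definition cadlag :: "(real \<Rightarrow> real) \<Rightarrow> bool" where
  "cadlag f \<longleftrightarrow>
     (\<forall>t\<ge>0. (f \<longlongrightarrow> f t) (at_right t)) \<and>
     (\<forall>t>0. \<exists>l. (f \<longlongrightarrow> l) (at_left t))"

(* Time is [0,\<infinity>); values of Z at negative times are irrelevant. Stochastic continuity
   is not listed separately: it follows from the other clauses. *)
definition levy_process :: "'a measure \<Rightarrow> (real \<Rightarrow> 'a \<Rightarrow> real) \<Rightarrow> bool" where
  "levy_process M Z \<longleftrightarrow>
     prob_space M \<and>
     (\<forall>t\<ge>0. Z t \<in> borel_measurable M) \<and>
     (AE \<omega> in M. Z 0 \<omega> = 0) \<and>
     (\<forall>(n::nat) (s::nat \<Rightarrow> real). 0 \<le> s 0 \<and> (\<forall>i<n. s i \<le> s (Suc i)) \<longrightarrow>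
        prob_space.indep_vars M (\<lambda>_. borel) (\<lambda>i \<omega>. Z (s (Suc i)) \<omega> - Z (s i) \<omega>) {..<n}) \<and>
     (\<forall>s\<ge>0. \<forall>t\<ge>0. distr M borel (\<lambda>\<omega>. Z (s + t) \<omega> - Z s \<omega>) = distr M borel (Z t)) \<and>
     (AE \<omega> in M. cadlag (\<lambda>t. Z t \<omega>))"

(* Normalized so that the Levy measure is stable_const \<alpha> / |z| ^ (1 + \<alpha>) dz. *)
definition symmetric_stable_process ::
    "real \<Rightarrow> 'a measure \<Rightarrow> (real \<Rightarrow> 'a \<Rightarrow> real) \<Rightarrow> bool" where
  "symmetric_stable_process \<alpha> M Z \<longleftrightarrow>
     levy_process M Z \<and>
     (\<forall>t\<ge>0. \<forall>u. char (distr M borel (Z t)) u = complex_of_real (exp (- t * \<bar>u\<bar> powr \<alpha>)))"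

definition stable_const :: "real \<Rightarrow> real" where
  "stable_const \<alpha> =
     \<alpha> * 2 powr (\<alpha> - 1) * pi powr (- 1 / 2) * Gamma ((1 + \<alpha>) / 2) / Gamma (1 - \<alpha> / 2)"

(* X solves dX = - X dt + dZ with X_0 = x. The noise is additive, so the equation is pathwise.
   The cadlag clause makes s \<mapsto> X s \<omega> integrable on bounded intervals. *)
definition OU_solution ::
    "'a measure \<Rightarrow> (real \<Rightarrow> 'a \<Rightarrow> real) \<Rightarrow> real \<Rightarrow> (real \<Rightarrow> 'a \<Rightarrow> real) \<Rightarrow> bool" where
  "OU_solution M Z x X \<longleftrightarrow>
     (\<forall>t\<ge>0. X t \<in> borel_measurable M) \<and>
     (AE \<omega> in M. cadlag (\<lambda>t. X t \<omega>) \<and>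
        (\<forall>t\<ge>0. X t \<omega> = x - (LBINT s:{0..t}. X s \<omega>) + Z t \<omega>))"

(* P t x is the law at time t of the Markov process started at x. *)
definition invariant_measure :: "(real \<Rightarrow> real \<Rightarrow> real measure) \<Rightarrow> real measure \<Rightarrow> bool" where
  "invariant_measure P \<nu> \<longleftrightarrow>
     prob_space \<nu> \<and> sets \<nu> = sets borel \<and>
     (\<forall>t\<ge>0. \<forall>A\<in>sets borel. (\<integral>\<^sup>+ x. emeasure (P t x) A \<partial>\<nu>) = emeasure \<nu> A)"

(* Meaningful for laws with finite first moment, for which every Lipschitz h is integrable. *)
definition W1 :: "real measure \<Rightarrow> real measure \<Rightarrow> ereal" where
  "W1 \<nu>1 \<nu>2 =
     (SUP h\<in>{h :: real \<Rightarrow> real. 1-lipschitz_on UNIV h}.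
        ereal ((\<integral>x. h x \<partial>\<nu>1) - (\<integral>x. h x \<partial>\<nu>2)))"

(* The step sizes are indexed from 1; \<gamma> 0 is never used. *)
definition step_time :: "(nat \<Rightarrow> real) \<Rightarrow> nat \<Rightarrow> real" where
  "step_time \<gamma> n = (\<Sum>i=1..n. \<gamma> i)"

definition pareto_density :: "real \<Rightarrow> real \<Rightarrow> real" where
  "pareto_density \<alpha> z = \<alpha> / (2 * \<bar>z\<bar> powr (\<alpha> + 1)) * indicator {1<..} \<bar>z\<bar>"

definition pareto_scale :: "real \<Rightarrow> real" where
  "pareto_scale \<alpha> = (\<alpha> / (2 * stable_const \<alpha>)) powr (1 / \<alpha>)"

end

theory Submission
  imports Defs
begin

text \<open>
  Solving the equation pathwise and approximating the stochastic integral by Riemann sums gives the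
  characteristic function \<open>exp (- \<bar>u\<bar> powr \<alpha> / \<alpha>)\<close> of \<open>\<nu>\<close>. The symbol of the Pareto law is
  \<open>1 - L * w powr \<alpha> + c * w\<^sup>2 + \<dots>\<close>, where the scale \<open>\<beta>\<close> is chosen so that the term of order \<open>\<alpha>\<close>
  agrees with that of the stable noise; the first discrepancy, the quadratic term, is of size
  \<open>\<gamma> powr (2 / \<alpha>)\<close> in one step.

  Upper bound: one step started from \<open>\<nu>\<close> differs from \<open>\<nu>\<close> by at most a constant times
  \<open>\<gamma> powr (2 / \<alpha>)\<close> in Wasserstein distance. Indeed, Levy inversion writes the difference of the
  distribution functions as the sine transform of the difference of the characteristic functions divided
  by \<open>u\<close>, which decays quadratically after two integrations by parts. A step contracts the distance
  by \<open>1 - \<gamma>\<close>, and the hypothesis on \<open>\<omega>\<close> makes \<open>\<gamma> powr \<theta>\<close> a supersolution of the resulting recursion.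

  Lower bound: test with \<open>- cos\<close>. The excess \<open>E cos (u Y\<^sub>n) - exp (- u powr \<alpha> / \<alpha>)\<close> is at least
  \<open>c * \<gamma>\<^sub>n powr \<theta> * u\<^sup>2 - D\<^sub>n * u\<close> on \<open>[0, 1]\<close>, by induction on \<open>n\<close>, with \<open>D\<^sub>n\<close> of smaller order
  than \<open>\<gamma>\<^sub>n powr \<theta>\<close>.
\<close>


section \<open>The normalizing constant of the stable law\<close>

text \<open>Closeness of characteristic functions alone does not control a Wasserstein distance; the
  difference must also be smooth and decay. Hence the two noises are compared only in a step started
  from \<open>\<nu>\<close>: its characteristic function supplies a damping factor
  \<open>exp (- (b * u powr a))\<close> with \<open>b\<close> bounded below for steps of size at
  most 1/2, whereas the scheme starts at a point and has no such regularity. The critical place is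
  then the origin, where the second derivative of the kernel grows like
  \<open>u powr (2 * a - 3)\<close>; this is integrable because \<open>a > 1\<close>. In the lower
  bound a step of size g shrinks a quadratic term by \<open>(1 - g) ^ 3\<close>, a relative loss of
  about 3 g, and adds \<open>c * g powr (1 + \<theta>)\<close>, so the coefficient
  \<open>c / 3\<close> sustains itself. The linear term collects the initial discrepancy and errors
  of order g squared. It contracts by 1 - g, while the condition on \<omega> lets
  \<open>\<gamma> powr \<theta>\<close> fall by a factor of at most 1 + g/2 per step, so the linear
  term becomes negligible.\<close>

lemma nn_integral_powr_exp:
  fixes p c :: real
  assumes "0 < p" "0 < c"
  shows "(\<integral>\<^sup>+ s. ennreal (indicator {0..} s * s powr (p - 1) * exp (- (c * s))) \<partial>lborel)
    = ennreal (Gamma p * c powr (- p))"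
proof -
  have "ennreal (Gamma p) = (\<integral>\<^sup>+ t. ennreal (indicator {0..} t * t powr (p - 1) / exp t) \<partial>lborel)"
    using assms(1) by (rule Gamma_conv_nn_integral_real)
  also have "\<dots> = ennreal \<bar>c\<bar> * (\<integral>\<^sup>+ s. ennreal (indicator {0..} (0 + c * s) * (0 + c * s) powr (p - 1) / exp (0 + c * s)) \<partial>lborel)"
    using assms by (intro nn_integral_real_affine) auto
  also have "(\<lambda>s. ennreal (indicator {0..} (0 + c * s) * (0 + c * s) powr (p - 1) / exp (0 + c * s)))
      = (\<lambda>s. ennreal (c powr (p - 1)) * ennreal (indicator {0..} s * s powr (p - 1) * exp (- (c * s))))"
  proof
    fix s
    show "ennreal (indicator {0..} (0 + c * s) * (0 + c * s) powr (p - 1) / exp (0 + c * s))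
      = ennreal (c powr (p - 1)) * ennreal (indicator {0..} s * s powr (p - 1) * exp (- (c * s)))"
      using assms by (cases "0 \<le> s")
        (auto simp: ennreal_mult[symmetric] powr_mult exp_minus field_simps indicator_def zero_le_mult_iff)
  qed
  also have "ennreal \<bar>c\<bar> * (\<integral>\<^sup>+ s. ennreal (c powr (p - 1)) * ennreal (indicator {0..} s * s powr (p - 1) * exp (- (c * s))) \<partial>lborel)
    = ennreal (c powr p) * (\<integral>\<^sup>+ s. ennreal (indicator {0..} s * s powr (p - 1) * exp (- (c * s))) \<partial>lborel)"
    using assms by (subst nn_integral_cmult)
      (auto simp: mult.assoc[symmetric] ennreal_mult[symmetric] powr_mult_base)
  finally have "ennreal (c powr (- p)) * ennreal (Gamma p) = ennreal (c powr (- p)) * ennreal (c powr p)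
     * (\<integral>\<^sup>+ s. ennreal (indicator {0..} s * s powr (p - 1) * exp (- (c * s))) \<partial>lborel)"
    by (simp add: mult.assoc)
  moreover have "c powr (- p) * c powr p = 1"
    using assms by (simp add: powr_add[symmetric])
  ultimately show ?thesis
    using assms Gamma_real_pos[of p] by (simp add: ennreal_mult[symmetric] mult.commute)
qed

text \<open>The substitution x = c w with c squared equal to 2 s makes the weight a standard normal
  density, and the mean of the cosine is then the normal characteristic function at 1/c.\<close>

lemma nn_integral_one_minus_cos_gaussian:
  fixes s :: real
  assumes "0 < s"
  shows "(\<integral>\<^sup>+ w. ennreal ((1 - cos w) * exp (- (s * w\<^sup>2))) \<partial>lborel)
    = ennreal (sqrt (pi / s) * (1 - exp (- 1 / (4 * s))))"
proof -
  interpret N: prob_space std_normal_distribution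
    by (rule prob_space_normal_density) simp
  define c where "c = sqrt (2 * s)"
  have c: "0 < c" "c\<^sup>2 = 2 * s" using assms by (auto simp: c_def)
  have int: "integrable std_normal_distribution (\<lambda>x. cos (x / c))"
    by (rule N.integrable_const_bound[of _ 1]) auto
  have "Re (char std_normal_distribution (1 / c)) = (\<integral>x. cos (x / c) \<partial>std_normal_distribution)"
    unfolding char_def
    by (subst integral_Re[symmetric])
       (auto intro!: N.integrable_const_bound[of _ 1] simp: Re_exp)
  then have E: "(\<integral>x. (1 - cos (x / c)) \<partial>std_normal_distribution) = 1 - exp (- 1 / (4 * s))"
    using int c N.prob_space by (simp add: char_std_normal_distribution power_divide)
  have "(\<integral>\<^sup>+x. ennreal (1 - cos (x / c)) \<partial>std_normal_distribution) = ennreal (1 - exp (- 1 / (4 * s)))"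
    using int by (subst nn_integral_eq_integral) (auto simp: E)
  also have "(\<integral>\<^sup>+x. ennreal (1 - cos (x / c)) \<partial>std_normal_distribution)
     = (\<integral>\<^sup>+x. ennreal (std_normal_density x) * ennreal (1 - cos (x / c)) \<partial>lborel)"
    by (subst nn_integral_density) auto
  also have "\<dots> = ennreal \<bar>c\<bar> * (\<integral>\<^sup>+w. ennreal (std_normal_density (0 + c * w)) * ennreal (1 - cos ((0 + c * w) / c)) \<partial>lborel)"
    using c by (intro nn_integral_real_affine) auto
  also have "(\<lambda>w. ennreal (std_normal_density (0 + c * w)) * ennreal (1 - cos ((0 + c * w) / c)))
     = (\<lambda>w. ennreal (1 / sqrt (2 * pi)) * ennreal ((1 - cos w) * exp (- (s * w\<^sup>2))))"
    using c by (auto simp: std_normal_density_def ennreal_mult[symmetric] power_mult_distrib field_simps fun_eq_iff)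
  also have "ennreal \<bar>c\<bar> * (\<integral>\<^sup>+w. ennreal (1 / sqrt (2 * pi)) * ennreal ((1 - cos w) * exp (- (s * w\<^sup>2))) \<partial>lborel)
     = ennreal (c / sqrt (2 * pi)) * (\<integral>\<^sup>+w. ennreal ((1 - cos w) * exp (- (s * w\<^sup>2))) \<partial>lborel)"
    using c by (subst nn_integral_cmult) (auto simp: mult.assoc[symmetric] ennreal_mult[symmetric])
  finally have "ennreal (sqrt (2 * pi) / c) * ennreal (1 - exp (- 1 / (4 * s)))
    = ennreal (sqrt (2 * pi) / c) * ennreal (c / sqrt (2 * pi)) * (\<integral>\<^sup>+w. ennreal ((1 - cos w) * exp (- (s * w\<^sup>2))) \<partial>lborel)"
    by (simp add: mult.assoc)
  moreover have "sqrt (2 * pi) / c * (c / sqrt (2 * pi)) = 1" using c by simp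
  moreover have "sqrt (2 * pi) / c = sqrt (pi / s)"
    using assms by (simp add: c_def real_sqrt_mult real_sqrt_divide)
  ultimately show ?thesis
    using c assms by (simp add: ennreal_mult[symmetric])
qed

text \<open>Write \<open>1 - exp (- 1 / (4 * s))\<close> as the integral of \<open>exp (- y)\<close>
  over 0 \<le> y \<le> 1/(4 s) and exchange the integrals: the inner one, over s \<le> 1/(4 y), is a
  power of y, and a Gamma integral remains.\<close>

lemma nn_integral_powr_one_minus_exp:
  fixes a :: real
  assumes "0 < a" "a < 2"
  shows "(\<integral>\<^sup>+ s. ennreal (indicator {0<..} s * s powr (a / 2 - 1) * (1 - exp (- 1 / (4 * s)))) \<partial>lborel)
    = ennreal (4 powr (- a / 2) * (2 / a) * Gamma (1 - a / 2))"
proof -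
  have 1: "ennreal (1 - exp (- r)) = (\<integral>\<^sup>+ y. ennreal (exp (- y)) * indicator {0..r} y \<partial>lborel)" if "0 \<le> r" for r :: real
  proof -
    have "(\<integral>\<^sup>+ y. ennreal (exp (- y)) * indicator {0..r} y \<partial>lborel) = ennreal ((- exp (- r)) - (- exp (- 0)))"
      using that by (intro nn_integral_FTC_Icc) (auto intro!: derivative_eq_intros)
    then show ?thesis by simp
  qed
  have 2: "(\<integral>\<^sup>+ s. ennreal (s powr (a / 2 - 1)) * indicator {0..r} s \<partial>lborel) = ennreal (r powr (a / 2) / (a / 2))"
    if "0 \<le> r" for r :: real
  proof -
    have "((\<lambda>s. s powr (a / 2 - 1)) has_integral r powr (a / 2 - 1 + 1) / (a / 2 - 1 + 1)) {0..r}"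
      using has_integral_powr_from_0[of "a / 2 - 1" r] assms that by simp
    then have "((\<lambda>s. if s \<in> {0..r} then s powr (a / 2 - 1) else 0) has_integral r powr (a / 2) / (a / 2)) UNIV"
      unfolding has_integral_restrict_UNIV by simp
    also have "(\<lambda>s. if s \<in> {0..r} then s powr (a / 2 - 1) else 0) = (\<lambda>s. indicator {0..r} s * s powr (a / 2 - 1))"
      by (rule ext) (simp add: indicator_def)
    finally have "((\<lambda>s. indicator {0..r} s * s powr (a / 2 - 1)) has_integral r powr (a / 2) / (a / 2)) UNIV" .
    then have "(\<integral>\<^sup>+ s. ennreal (indicator {0..r} s * s powr (a / 2 - 1)) \<partial>lborel) = ennreal (r powr (a / 2) / (a / 2))"
      by (intro nn_integral_has_integral_lborel) (auto simp: )
    then show ?thesis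
      by (subst (asm) nn_integral_cong[where v="\<lambda>s. ennreal (s powr (a / 2 - 1)) * indicator {0..r} s"])
         (auto simp: indicator_def)
  qed
  have "(\<integral>\<^sup>+ s. ennreal (indicator {0<..} s * s powr (a / 2 - 1) * (1 - exp (- 1 / (4 * s)))) \<partial>lborel)
     = (\<integral>\<^sup>+ s. \<integral>\<^sup>+ y. ennreal (indicator {0<..} s * s powr (a / 2 - 1)) * (ennreal (exp (- y)) * indicator {0..1 / (4 * s)} y) \<partial>lborel \<partial>lborel)"
  proof (intro nn_integral_cong)
    fix s :: real
    show "ennreal (indicator {0<..} s * s powr (a / 2 - 1) * (1 - exp (- 1 / (4 * s))))
      = (\<integral>\<^sup>+ y. ennreal (indicator {0<..} s * s powr (a / 2 - 1)) * (ennreal (exp (- y)) * indicator {0..1 / (4 * s)} y) \<partial>lborel)"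
      using 1[of "1 / (4 * s)"] by (cases "0 < s") (auto simp: nn_integral_cmult ennreal_mult)
  qed
  also have "\<dots> = (\<integral>\<^sup>+ y. \<integral>\<^sup>+ s. ennreal (indicator {0<..} s * s powr (a / 2 - 1)) * (ennreal (exp (- y)) * indicator {0..1 / (4 * s)} y) \<partial>lborel \<partial>lborel)"
    by (intro lborel_pair.Fubini') (simp add: indicator_def)
  also have "\<dots> = (\<integral>\<^sup>+ y. ennreal (4 powr (- a / 2) * (2 / a)) * ennreal (indicator {0..} y * y powr (1 - a / 2 - 1) * exp (- (1 * y))) \<partial>lborel)"
  proof (intro nn_integral_cong_AE)
    have "AE y in lborel. y \<noteq> (0::real)" by (rule AE_lborel_singleton)
    then show "AE y in lborel. (\<integral>\<^sup>+ s. ennreal (indicator {0<..} s * s powr (a / 2 - 1)) * (ennreal (exp (- y)) * indicator {0..1 / (4 * s)} y) \<partial>lborel)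
      = ennreal (4 powr (- a / 2) * (2 / a)) * ennreal (indicator {0..} y * y powr (1 - a / 2 - 1) * exp (- (1 * y)))"
    proof eventually_elim
      case (elim y)
      show ?case
      proof (cases "0 < y")
        case True
        have "(\<integral>\<^sup>+ s. ennreal (indicator {0<..} s * s powr (a / 2 - 1)) * (ennreal (exp (- y)) * indicator {0..1 / (4 * s)} y) \<partial>lborel)
          = (\<integral>\<^sup>+ s. ennreal (exp (- y)) * (ennreal (s powr (a / 2 - 1)) * indicator {0..1 / (4 * y)} s) \<partial>lborel)"
          using True by (intro nn_integral_cong) (auto simp: indicator_def field_simps)
        also have "\<dots> = ennreal (exp (- y)) * ennreal ((1 / (4 * y)) powr (a / 2) / (a / 2))"
          using True 2[of "1 / (4 * y)"] by (subst nn_integral_cmult) auto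
        also have "(1 / (4 * y)) powr (a / 2) = 4 powr (- a / 2) * y powr (- a / 2)"
          using True by (simp add: powr_divide powr_mult powr_minus field_simps)
        finally show ?thesis
          using True assms by (simp add: ennreal_mult[symmetric] algebra_simps)
      next
        case False
        with elim have "y < 0" by simp
        then have "(\<integral>\<^sup>+ s. ennreal (indicator {0<..} s * s powr (a / 2 - 1)) * (ennreal (exp (- y)) * indicator {0..1 / (4 * s)} y) \<partial>lborel)
          = (\<integral>\<^sup>+ s. 0 \<partial>(lborel :: real measure))"
          by (intro nn_integral_cong) (auto simp: indicator_def)
        with \<open>y < 0\<close> show ?thesis by simp
      qed
    qed
  qed
  also have "\<dots> = ennreal (4 powr (- a / 2) * (2 / a)) * ennreal (Gamma (1 - a / 2))"
    using nn_integral_powr_exp[of "1 - a / 2" 1] assms by (subst nn_integral_cmult) auto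
  finally show ?thesis
    using assms by (simp add: ennreal_mult[symmetric])
qed

text \<open>Writing \<open>\<bar>w\<bar> powr (- 1 - a)\<close> as a mixture of Gaussians reduces the integral to
  Gamma integrals.\<close>

lemma nn_integral_one_minus_cos_powr:
  fixes a :: real
  assumes "0 < a" "a < 2"
  shows "(\<integral>\<^sup>+ w. ennreal ((1 - cos w) * \<bar>w\<bar> powr (- 1 - a)) \<partial>lborel) = ennreal (1 / stable_const a)"
proof -
  \<comment> \<open>The exponent for which \<open>(w\<^sup>2) powr (- p)\<close> is
    \<open>\<bar>w\<bar> powr (- 1 - a)\<close>, so that the mixing weight is
    \<open>s powr (p - 1)\<close>.\<close>
  define p where "p = (1 + a) / 2"
  have p: "0 < p" "0 < Gamma p" using assms by (auto simp: p_def)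
  have G2: "0 < Gamma (1 - a / 2)" using assms by simp
  have mix: "ennreal (Gamma p) * ennreal ((1 - cos w) * \<bar>w\<bar> powr (- 1 - a))
     = (\<integral>\<^sup>+ s. ennreal (indicator {0<..} s * s powr (p - 1)) * ennreal ((1 - cos w) * exp (- (s * w\<^sup>2))) \<partial>lborel)"
     (is "?l = ?r") if "w \<noteq> 0" for w
  proof -
    have "?r = (\<integral>\<^sup>+ s. ennreal (1 - cos w) * ennreal (indicator {0..} s * s powr (p - 1) * exp (- (w\<^sup>2 * s))) \<partial>lborel)"
      by (intro nn_integral_cong) (auto simp: indicator_def ennreal_mult[symmetric] mult_ac)
    also have "\<dots> = ennreal (1 - cos w) * ennreal (Gamma p * (w\<^sup>2) powr (- p))"
      using that p by (subst nn_integral_cmult) (auto simp: nn_integral_powr_exp)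
    also have "(w\<^sup>2) powr (- p) = \<bar>w\<bar> powr (- 1 - a)"
    proof -
      have "(w\<^sup>2) powr (- p) = (\<bar>w\<bar> powr 2) powr (- p)" using that by (simp add: powr_numeral)
      also have "\<dots> = \<bar>w\<bar> powr (2 * - p)" by (rule powr_powr)
      also have "2 * - p = - 1 - a" by (simp add: p_def field_simps)
      finally show ?thesis .
    qed
    finally show ?thesis using p by (simp add: ennreal_mult[symmetric] mult_ac)
  qed
  have "ennreal (Gamma p) * (\<integral>\<^sup>+ w. ennreal ((1 - cos w) * \<bar>w\<bar> powr (- 1 - a)) \<partial>lborel)
    = (\<integral>\<^sup>+ w. ennreal (Gamma p) * ennreal ((1 - cos w) * \<bar>w\<bar> powr (- 1 - a)) \<partial>lborel)"
    by (subst nn_integral_cmult) auto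
  also have "\<dots> = (\<integral>\<^sup>+ w. \<integral>\<^sup>+ s. ennreal (indicator {0<..} s * s powr (p - 1)) * ennreal ((1 - cos w) * exp (- (s * w\<^sup>2))) \<partial>lborel \<partial>lborel)"
  proof (rule nn_integral_cong_AE)
    have "AE w in lborel. w \<noteq> (0::real)" by (rule AE_lborel_singleton)
    then show "AE w in lborel. ennreal (Gamma p) * ennreal ((1 - cos w) * \<bar>w\<bar> powr (- 1 - a))
      = (\<integral>\<^sup>+ s. ennreal (indicator {0<..} s * s powr (p - 1)) * ennreal ((1 - cos w) * exp (- (s * w\<^sup>2))) \<partial>lborel)"
      by eventually_elim (rule mix)
  qed
  also have "\<dots> = (\<integral>\<^sup>+ s. \<integral>\<^sup>+ w. ennreal (indicator {0<..} s * s powr (p - 1)) * ennreal ((1 - cos w) * exp (- (s * w\<^sup>2))) \<partial>lborel \<partial>lborel)"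
    by (intro lborel_pair.Fubini') simp
  also have "\<dots> = (\<integral>\<^sup>+ s. ennreal (sqrt pi) * ennreal (indicator {0<..} s * s powr (a / 2 - 1) * (1 - exp (- 1 / (4 * s)))) \<partial>lborel)"
  proof (intro nn_integral_cong)
    fix s :: real
    show "(\<integral>\<^sup>+ w. ennreal (indicator {0<..} s * s powr (p - 1)) * ennreal ((1 - cos w) * exp (- (s * w\<^sup>2))) \<partial>lborel)
      = ennreal (sqrt pi) * ennreal (indicator {0<..} s * s powr (a / 2 - 1) * (1 - exp (- 1 / (4 * s))))"
    proof (cases "0 < s")
      case True
      have "s powr (p - 1) / sqrt s = s powr (p - 1 - 1 / 2)"
        using True by (simp only: powr_diff[of s "p - 1" "1 / 2"] powr_half_sqrt less_imp_le)
      also have "p - 1 - 1 / 2 = a / 2 - 1" by (simp add: p_def field_simps)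
      finally have "s powr (p - 1) / sqrt s = s powr (a / 2 - 1)" .
      moreover have "s powr (p - 1) * sqrt (pi / s) = sqrt pi * (s powr (p - 1) / sqrt s)"
        by (simp add: real_sqrt_divide)
      ultimately have e: "s powr (p - 1) * sqrt (pi / s) = sqrt pi * s powr (a / 2 - 1)" by simp
      have "(\<integral>\<^sup>+ w. ennreal (indicator {0<..} s * s powr (p - 1)) * ennreal ((1 - cos w) * exp (- (s * w\<^sup>2))) \<partial>lborel)
        = ennreal (s powr (p - 1)) * ennreal (sqrt (pi / s) * (1 - exp (- 1 / (4 * s))))"
        using True by (subst nn_integral_cmult) (auto simp: nn_integral_one_minus_cos_gaussian)
      also have "\<dots> = ennreal ((s powr (p - 1) * sqrt (pi / s)) * (1 - exp (- 1 / (4 * s))))"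
        using True by (simp add: ennreal_mult[symmetric] mult.assoc)
      finally show ?thesis
        using True unfolding e by (simp add: ennreal_mult[symmetric] mult.assoc)
    qed simp
  qed
  also have "\<dots> = ennreal (sqrt pi) * ennreal (4 powr (- a / 2) * (2 / a) * Gamma (1 - a / 2))"
    using nn_integral_powr_one_minus_exp[OF assms] by (subst nn_integral_cmult) auto
  finally have *: "ennreal (Gamma p) * (\<integral>\<^sup>+ w. ennreal ((1 - cos w) * \<bar>w\<bar> powr (- 1 - a)) \<partial>lborel)
     = ennreal (sqrt pi * (4 powr (- a / 2) * (2 / a) * Gamma (1 - a / 2)))"
    using assms G2 by (simp add: ennreal_mult[symmetric])
  have "ennreal (1 / Gamma p) * ennreal (Gamma p) = 1"
  proof -
    have "Gamma p \<noteq> 0" using p(2) by linarith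
    then show ?thesis using p(1) by (simp add: ennreal_mult[symmetric])
  qed
  then have "(\<integral>\<^sup>+ w. ennreal ((1 - cos w) * \<bar>w\<bar> powr (- 1 - a)) \<partial>lborel)
    = ennreal (1 / Gamma p) * (ennreal (Gamma p) * (\<integral>\<^sup>+ w. ennreal ((1 - cos w) * \<bar>w\<bar> powr (- 1 - a)) \<partial>lborel))"
    by (simp add: mult.assoc[symmetric])
  also have "\<dots> = ennreal (sqrt pi * (4 powr (- a / 2) * (2 / a) * Gamma (1 - a / 2)) / Gamma p)"
    unfolding * using p by (simp add: ennreal_mult'[symmetric] mult_ac)
  \<comment> \<open>With \<open>4 powr (- a / 2) = 1 / 2 powr a\<close> the constants combine to the
    reciprocal of \<open>stable_const a\<close>; the normalization of the Levy measure is thus the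
    one that gives the symbol \<open>\<bar>u\<bar> powr a\<close>.\<close>
  also have "sqrt pi * (4 powr (- a / 2) * (2 / a) * Gamma (1 - a / 2)) / Gamma p = 1 / stable_const a"
  proof -
    have "4 powr (- (a / 2)) = (2 powr 2) powr (- (a / 2))" by (simp add: powr_numeral)
    also have "\<dots> = 1 / 2 powr a" by (simp add: powr_powr powr_minus field_simps)
    finally have 4: "4 powr (- (a / 2)) = 1 / 2 powr a" .
    have pi: "pi powr (- (1 / 2)) = 1 / sqrt pi"
      by (simp add: powr_minus powr_half_sqrt inverse_eq_divide)
    have 2: "(2::real) powr (a - 1) = 2 powr a / 2" by (simp add: powr_diff)
    show ?thesis
      using G2 assms unfolding stable_const_def p_def[symmetric] 2 by (simp add: 4 pi mult_ac)
  qed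
  finally show ?thesis .
qed

lemma stable_const_pos: "0 < a \<Longrightarrow> a < 2 \<Longrightarrow> 0 < stable_const a"
  unfolding stable_const_def by (intro divide_pos_pos mult_pos_pos) auto

section \<open>The invariant law of the Ornstein--Uhlenbeck process\<close>

text \<open>The law of \<open>a * y + b * z\<close> for independent y and z. Both a transition of
  the Ornstein-Uhlenbeck process and a step of the scheme have this form.\<close>

definition lin_law :: "real \<Rightarrow> real \<Rightarrow> real measure \<Rightarrow> real measure \<Rightarrow> real measure" where
  "lin_law a b \<mu> \<eta> = distr (\<mu> \<Otimes>\<^sub>M \<eta>) borel (\<lambda>(y, z). a * y + b * z)"

context
  fixes \<mu> \<eta> :: "real measure"
  assumes mu: "real_distribution \<mu>" and eta: "real_distribution \<eta>"
begin

interpretation M1: real_distribution \<mu> by (rule mu)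
interpretation M2: real_distribution \<eta> by (rule eta)
interpretation PP: pair_prob_space \<mu> \<eta> ..

lemma measurable_lin_law [measurable]:
  "(\<lambda>(y, z). a * y + b * z) \<in> borel_measurable (\<mu> \<Otimes>\<^sub>M \<eta>)" for a b :: real
  by measurable

lemma real_distribution_lin_law: "real_distribution (lin_law a b \<mu> \<eta>)"
  unfolding lin_law_def by (rule PP.real_distribution_distr) measurable

lemma integral_lin_law:
  fixes f :: "real \<Rightarrow> 'b::{banach, second_countable_topology}"
  assumes [measurable]: "f \<in> borel_measurable borel"
    and "integrable (lin_law a b \<mu> \<eta>) f"
  shows "(\<integral>x. f x \<partial>lin_law a b \<mu> \<eta>) = (\<integral>y. (\<integral>z. f (a * y + b * z) \<partial>\<eta>) \<partial>\<mu>)"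
proof -
  have "integrable (\<mu> \<Otimes>\<^sub>M \<eta>) (\<lambda>(y, z). f (a * y + b * z))"
    using assms(2) unfolding lin_law_def by (subst (asm) integrable_distr_eq) (auto simp: split_beta')
  then show ?thesis
    unfolding lin_law_def
    by (subst integral_distr) (auto simp: split_beta' PP.integral_fst'[symmetric])
qed

lemma char_lin_law: "char (lin_law a b \<mu> \<eta>) u = char \<mu> (a * u) * char \<eta> (b * u)"
proof -
  interpret L: real_distribution "lin_law a b \<mu> \<eta>" by (rule real_distribution_lin_law)
  have "char (lin_law a b \<mu> \<eta>) u = (\<integral>y. (\<integral>z. iexp (u * (a * y + b * z)) \<partial>\<eta>) \<partial>\<mu>)"
    unfolding char_def by (intro integral_lin_law L.integrable_iexp) auto
  also have "\<dots> = (\<integral>y. (\<integral>z. iexp (a * u * y) * iexp (b * u * z) \<partial>\<eta>) \<partial>\<mu>)"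
    by (simp add: exp_add[symmetric] algebra_simps)
  finally show ?thesis unfolding char_def by simp
qed

text \<open>Fibres over the first coordinate; this is the shape in which invariance under a
  transition kernel is stated.\<close>

lemma emeasure_lin_law:
  assumes [measurable]: "A \<in> sets borel"
  shows "emeasure (lin_law a b \<mu> \<eta>) A = (\<integral>\<^sup>+ y. emeasure \<eta> {z. a * y + b * z \<in> A} \<partial>\<mu>)"
proof -
  have "emeasure (lin_law a b \<mu> \<eta>) A = emeasure (\<mu> \<Otimes>\<^sub>M \<eta>) ((\<lambda>(y, z). a * y + b * z) -` A \<inter> space (\<mu> \<Otimes>\<^sub>M \<eta>))"
    unfolding lin_law_def by (rule emeasure_distr) auto
  also have "\<dots> = (\<integral>\<^sup>+ y. emeasure \<eta> (Pair y -` ((\<lambda>(y, z). a * y + b * z) -` A \<inter> space (\<mu> \<Otimes>\<^sub>M \<eta>))) \<partial>\<mu>)"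
    by (rule M2.emeasure_pair_measure_alt) (rule measurable_sets[OF measurable_lin_law], simp)
  also have "\<dots> = (\<integral>\<^sup>+ y. emeasure \<eta> {z. a * y + b * z \<in> A} \<partial>\<mu>)"
    by (intro nn_integral_cong arg_cong2[where f=emeasure]) (auto simp: space_pair_measure)
  finally show ?thesis .
qed

lemma integrable_lin_law:
  assumes "integrable \<mu> (\<lambda>y. y)" "integrable \<eta> (\<lambda>z. z)"
  shows "integrable (lin_law a b \<mu> \<eta>) (\<lambda>x. x)"
proof -
  have "integrable (\<mu> \<Otimes>\<^sub>M \<eta>) (\<lambda>p. fst p)"
    using integrable_distr[of fst "\<mu> \<Otimes>\<^sub>M \<eta>" \<mu> "\<lambda>y. y"] assms by (simp add: M2.distr_pair_fst)
  moreover have "integrable (\<mu> \<Otimes>\<^sub>M \<eta>) (\<lambda>p. snd p)"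
  proof -
    have "distr (\<mu> \<Otimes>\<^sub>M \<eta>) \<eta> snd = distr (\<eta> \<Otimes>\<^sub>M \<mu>) \<eta> fst"
      by (subst PP.distr_pair_swap) (simp add: distr_distr comp_def split_beta')
    then show ?thesis
      using integrable_distr[of snd "\<mu> \<Otimes>\<^sub>M \<eta>" \<eta> "\<lambda>y. y"] assms by (simp add: M1.distr_pair_fst)
  qed
  ultimately show ?thesis
    unfolding lin_law_def by (subst integrable_distr_eq) (auto simp: split_beta')
qed

end

section \<open>Cadlag paths and the pathwise variation of constants formula\<close>

text \<open>The one-sided limits bound f near each point; compactness leaves finitely many such
  neighbourhoods, and the sum of their bounds serves for all of them.\<close>

lemma cadlag_bounded:
  assumes "cadlag f"
  obtains B where "\<And>s. 0 \<le> s \<Longrightarrow> s \<le> t \<Longrightarrow> \<bar>f s\<bar> \<le> B"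
proof -
  have "\<exists>d>0. \<exists>B. \<forall>y. \<bar>y - s\<bar> < d \<longrightarrow> 0 \<le> y \<longrightarrow> \<bar>f y\<bar> \<le> B" if "0 \<le> s" for s
  proof -
    have r: "(f \<longlongrightarrow> f s) (at_right s)" using assms that by (auto simp: cadlag_def)
    then have "eventually (\<lambda>y. dist (f y) (f s) < 1) (at_right s)" by (rule tendstoD) simp
    then obtain d1 where d1: "s < d1" "\<And>y. s < y \<Longrightarrow> y < d1 \<Longrightarrow> dist (f y) (f s) < 1"
      by (auto simp: eventually_at_right_field)
    have "\<exists>d2<s. \<exists>l. \<forall>y>d2. y < s \<longrightarrow> 0 \<le> y \<longrightarrow> dist (f y) l < 1"
    \<comment> \<open>At \<open>s = 0\<close> there is no left limit, but the claim ranges over 0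
      \<le> y < s and is vacuous there: any negative \<open>d2\<close> will do.\<close>
    proof (cases "s = 0")
      case False
      with that have "0 < s" by simp
      then obtain l where "(f \<longlongrightarrow> l) (at_left s)" using assms unfolding cadlag_def by blast
      then have "eventually (\<lambda>y. dist (f y) l < 1) (at_left s)" by (rule tendstoD) simp
      then show ?thesis by (auto simp: eventually_at_left_field)
    qed (auto intro!: exI[of _ "-1"])
    then obtain d2 l where d2: "d2 < s" "\<And>y. d2 < y \<Longrightarrow> y < s \<Longrightarrow> 0 \<le> y \<Longrightarrow> dist (f y) l < 1" by blast
    show ?thesis
    proof (intro exI conjI allI impI)
      show "0 < min (d1 - s) (s - d2)" using d1 d2 by simp
      fix y assume y: "\<bar>y - s\<bar> < min (d1 - s) (s - d2)" "0 \<le> y"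
      show "\<bar>f y\<bar> \<le> \<bar>f s\<bar> + \<bar>l\<bar> + 1"
        using d1(2)[of y] d2(2)[of y] y by (cases y s rule: linorder_cases) (auto simp: dist_real_def)
    qed
  qed
  then obtain d B where d: "\<And>s. 0 \<le> s \<Longrightarrow> 0 < d s"
    "\<And>s y. 0 \<le> s \<Longrightarrow> \<bar>y - s\<bar> < d s \<Longrightarrow> 0 \<le> y \<Longrightarrow> \<bar>f y\<bar> \<le> B s" by metis
  have "compact {0..t}" by simp
  moreover have "\<And>s. s \<in> {0..t} \<Longrightarrow> open (ball s (d s))" by simp
  moreover have "{0..t} \<subseteq> (\<Union>s\<in>{0..t}. ball s (d s))" using d(1) by fastforce
  ultimately obtain C where C: "C \<subseteq> {0..t}" "finite C" "{0..t} \<subseteq> (\<Union>s\<in>C. ball s (d s))"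
    by (rule compactE_image)
  have "\<bar>f y\<bar> \<le> (\<Sum>s\<in>C. \<bar>B s\<bar>)" if "0 \<le> y" "y \<le> t" for y
  proof -
    have "y \<in> (\<Union>s\<in>C. ball s (d s))" using subsetD[OF C(3), of y] that by simp
    then obtain s where s: "s \<in> C" "dist s y < d s" by auto
    then have "\<bar>f y\<bar> \<le> B s" using d(2)[of s y] C(1) that by (auto simp: dist_real_def abs_minus_commute)
    also have "\<dots> \<le> \<bar>B s\<bar>" by simp
    also have "\<dots> \<le> (\<Sum>s\<in>C. \<bar>B s\<bar>)" using C s by (intro member_le_sum) auto
    finally show ?thesis .
  qed
  then show ?thesis by (rule that)
qed

lemma cadlag_tendsto_from_right:
  assumes "cadlag f" "0 \<le> s" "r \<longlonglongrightarrow> s" "\<And>n::nat. s < r n"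
  shows "(\<lambda>n. f (r n)) \<longlonglongrightarrow> f s"
proof -
  have "(f \<longlongrightarrow> f s) (at_right s)" using assms by (auto simp: cadlag_def)
  moreover have "filterlim r (at_right s) sequentially"
    using assms by (intro tendsto_imp_filterlim_at_right) auto
  ultimately show ?thesis by (rule filterlim_compose)
qed

text \<open>Measurability is the point: by right continuity f is the pointwise limit of its values
  on finer and finer grids, each of which factors through an integer-valued floor. Boundedness does
  the rest.\<close>

lemma cadlag_set_integrable:
  assumes "cadlag f"
  shows "set_integrable lborel {0..t} f"
proof -
  obtain B where B: "\<And>s. 0 \<le> s \<Longrightarrow> s \<le> t \<Longrightarrow> \<bar>f s\<bar> \<le> B" using cadlag_bounded[OF assms] by blast
  \<comment> \<open>The least multiple of \<open>1 / Suc n\<close> strictly above s. Strictness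
    matters because the right limit excludes s itself.\<close>
  define r where "r n s = (real_of_int \<lfloor>real (Suc n) * s\<rfloor> + 1) / real (Suc n)" for n s
  have r: "s < r n s" "r n s \<le> s + 1 / real (Suc n)" for n s
  proof -
    have "s * real (Suc n) < real_of_int \<lfloor>real (Suc n) * s\<rfloor> + 1"
      "real_of_int \<lfloor>real (Suc n) * s\<rfloor> + 1 \<le> s * real (Suc n) + 1"
      unfolding mult.commute[of s] by linarith+
    then show "s < r n s" "r n s \<le> s + 1 / real (Suc n)"
      unfolding r_def by (simp_all add: pos_less_divide_eq pos_divide_le_eq distrib_right del: of_nat_Suc)
  qed
  have lim: "(\<lambda>n. r n s) \<longlonglongrightarrow> s" for s
  proof (rule tendsto_sandwich[of "\<lambda>_. s" _ _ "\<lambda>n. s + 1 / real (Suc n)"])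
    show "(\<lambda>n. s + 1 / real (Suc n)) \<longlonglongrightarrow> s"
      using tendsto_add[OF tendsto_const LIMSEQ_inverse_real_of_nat, of s] by (simp add: inverse_eq_divide)
  qed (use r in \<open>auto intro!: always_eventually less_imp_le\<close>)
  have [measurable]: "(\<lambda>s. f (r n s)) \<in> borel_measurable borel" for n
  proof -
    have "(\<lambda>k. f ((real_of_int k + 1) / real (Suc n))) \<in> measurable (count_space UNIV) borel" by simp
    from measurable_compose[OF _ this, of "\<lambda>s. \<lfloor>real (Suc n) * s\<rfloor>" borel] show ?thesis
      unfolding r_def by simp
  qed
  have "(\<lambda>s. indicator {0..t} s *\<^sub>R f s) \<in> borel_measurable lborel"
  proof (rule borel_measurable_LIMSEQ_real)
    fix s show "(\<lambda>n. indicator {0..t} s *\<^sub>R f (r n s)) \<longlonglongrightarrow> indicator {0..t} s *\<^sub>R f s"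
      using cadlag_tendsto_from_right[OF assms _ lim r(1), of s] by (auto simp: indicator_def)
  qed measurable
  then show ?thesis
    unfolding set_integrable_def using B
    by (intro integrableI_bounded_set[where A="{0..t}" and B=B]) (auto simp: indicator_def emeasure_lborel_Icc_eq)
qed

text \<open>This is d(exp(t) X) = exp(t) dZ without a stochastic integral. On each cell the equation
  expresses the increment of Z by the increment and the integral of X; summation by parts leaves an
  error that is the Lebesgue integral of a bounded function tending to 0.\<close>

lemma OU_riemann_sum_tendsto:
  fixes x t :: real
  assumes cX: "cadlag X" and t: "0 < t"
    and eq: "\<And>s. 0 \<le> s \<Longrightarrow> X s = x - (LBINT r:{0..s}. X r) + Z s"
  shows "(\<lambda>n. \<Sum>i<Suc n. exp (i * (t / Suc n)) * (Z (Suc i * (t / Suc n)) - Z (i * (t / Suc n))))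
    \<longlonglongrightarrow> exp t * X t - X 0"
proof -
  have intX: "X integrable_on {0..s}" for s
    using cadlag_set_integrable[OF cX] by (rule set_borel_integral_eq_integral(1))
  have eq': "X s = x - integral {0..s} X + Z s" if "0 \<le> s" for s
    using eq[OF that] set_borel_integral_eq_integral(2)[OF cadlag_set_integrable[OF cX]] by simp
  \<comment> \<open>\<open>k n s\<close> is the index of the cell containing s. In the error
    integrand \<open>F n\<close>, X is taken at the right end of the cell and the exponential at its
    left end; both products tend to \<open>X s * exp s\<close>, the first by right
    continuity.\<close>
  define k where "k n s = real_of_int \<lfloor>s / (t / real (Suc n))\<rfloor>" for n s
  define F where "F n s = X ((k n s + 1) * (t / Suc n)) * exp s - exp (k n s * (t / Suc n)) * X s" for n s
  have k: "k n s * (t / Suc n) \<le> s" "s < (k n s + 1) * (t / Suc n)" for n s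
  proof -
    have h: "0 < t / real (Suc n)" using t by simp
    have "k n s \<le> s / (t / real (Suc n))" "s / (t / real (Suc n)) < k n s + 1" unfolding k_def by linarith+
    then show "k n s * (t / Suc n) \<le> s" "s < (k n s + 1) * (t / Suc n)"
      using h by (simp_all only: pos_le_divide_eq pos_divide_less_eq)
  qed
  have part: "(\<Sum>i<m. exp (i * (t / Suc n)) * (Z (Suc i * (t / Suc n)) - Z (i * (t / Suc n))))
      = exp (m * (t / Suc n)) * X (m * (t / Suc n)) - X 0 - integral {0..m * (t / Suc n)} (F n)
      \<and> F n integrable_on {0..m * (t / Suc n)}" for m n
  proof (induction m)
    case (Suc m)
    define h where "h = t / real (Suc n)"
    have h: "0 < h" using t by (simp add: h_def)
    define p q where "p = real m * h" and "q = real (Suc m) * h"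
    have pq: "0 \<le> p" "p < q" using h by (auto simp: p_def q_def)
    have kpq: "k n s = real m" if "p \<le> s" "s < q" for s
    proof -
      have "\<lfloor>s / h\<rfloor> = int m"
        using that h by (intro floor_unique) (auto simp: p_def q_def field_simps)
      then show ?thesis by (simp add: k_def h_def)
    qed
    have 1: "((\<lambda>s. X q * exp s - exp p * X s) has_integral X q * (exp q - exp p) - exp p * integral {p..q} X) {p..q}"
    proof (intro has_integral_diff has_integral_mult_right)
      show "(exp has_integral exp q - exp p) {p..q}"
        using pq by (intro fundamental_theorem_of_calculus)
          (auto intro!: derivative_eq_intros simp flip: has_real_derivative_iff_has_vector_derivative)
      show "(X has_integral integral {p..q} X) {p..q}"
        using integrable_subinterval_real[OF intX[of q], of p q] pq by auto
    qed
    \<comment> \<open>The cell index jumps at the right end q, so the integrands may differ at this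
      one point.\<close>
    have 2: "(F n has_integral X q * (exp q - exp p) - exp p * integral {p..q} X) {p..q}"
    proof (rule has_integral_spike_finite[OF _ _ 1])
      fix s assume "s \<in> {p..q} - {q}"
      then have "k n s = real m" using kpq by auto
      then show "F n s = X q * exp s - exp p * X s"
        by (simp add: F_def p_def q_def h_def mult.commute add.commute)
    qed simp
    have 3: "F n integrable_on {0..p}" using Suc.IH by (simp add: p_def h_def)
    have 4: "(F n has_integral integral {0..p} (F n) + (X q * (exp q - exp p) - exp p * integral {p..q} X)) {0..q}"
      using pq 2 3 by (intro has_integral_combine[of 0 p q]) auto
    have 5: "integral {0..p} X + integral {p..q} X = integral {0..q} X"
      using pq intX by (intro Henstock_Kurzweil_Integration.integral_combine) auto
    have 6: "Z q - Z p = X q - X p + integral {p..q} X"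
      using eq'[of p] eq'[of q] 5 pq by simp
    have "(\<Sum>i<Suc m. exp (i * (t / Suc n)) * (Z (Suc i * (t / Suc n)) - Z (i * (t / Suc n))))
      = exp p * X p - X 0 - integral {0..p} (F n) + exp p * (Z q - Z p)"
      using Suc.IH by (simp add: p_def q_def h_def del: of_nat_Suc)
    also have "\<dots> = exp q * X q - X 0 - integral {0..q} (F n)"
      unfolding 6 integral_unique[OF 4] by (simp add: algebra_simps)
    finally show ?case using 4 by (auto simp: q_def h_def has_integral_iff simp del: of_nat_Suc)
  qed (use has_integral_refl(2)[of "F n" 0] in \<open>auto simp: integrable_on_def\<close>)
  \<comment> \<open>The right end of the cell containing s may exceed t, though by at most one cell;
    hence a bound on [0, 2 t].\<close>
  obtain B where B: "\<And>s. 0 \<le> s \<Longrightarrow> s \<le> 2 * t \<Longrightarrow> \<bar>X s\<bar> \<le> B" using cadlag_bounded[OF cX] by blast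
  have kn: "0 \<le> k n s" "(k n s + 1) * (t / Suc n) \<le> 2 * t" if "0 \<le> s" "s \<le> t" for n s
  proof -
    show "0 \<le> k n s" using that t by (simp add: k_def)
    have "(k n s + 1) * (t / Suc n) = k n s * (t / Suc n) + t / Suc n" by (simp add: distrib_right add_divide_distrib)
    also have "\<dots> \<le> t + t"
    proof (rule add_mono)
      show "k n s * (t / Suc n) \<le> t" by (rule order_trans[OF k(1) that(2)])
      show "t / Suc n \<le> t" using t by (simp add: field_simps)
    qed
    finally show "(k n s + 1) * (t / Suc n) \<le> 2 * t" by simp
  qed
  have "(\<lambda>n. integral {0..t} (F n)) \<longlonglongrightarrow> integral {0..t} (\<lambda>s. 0)"
  proof (rule dominated_convergence(2))
    fix n
    show "F n integrable_on {0..t}" using part[where m="Suc n" and n=n] by (simp del: of_nat_Suc)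
    show "norm (F n s) \<le> B * exp t + exp t * B" if "s \<in> {0..t}" for s
    proof -
      have "\<bar>F n s\<bar> \<le> \<bar>X ((k n s + 1) * (t / Suc n))\<bar> * exp s + exp (k n s * (t / Suc n)) * \<bar>X s\<bar>"
        unfolding F_def by (rule order_trans[OF abs_triangle_ineq4]) (simp add: abs_mult)
      also have "\<dots> \<le> B * exp t + exp t * B"
      proof (intro add_mono mult_mono)
        show "\<bar>X ((k n s + 1) * (t / Suc n))\<bar> \<le> B"
          using that kn[of s n] k(2)[of s n] by (intro B) auto
        show "\<bar>X s\<bar> \<le> B" using that by (intro B) auto
        show "exp (k n s * (t / Suc n)) \<le> exp t" using order_trans[OF k(1)[of n s], of t] that by simp
        show "0 \<le> B" using B[of 0] t by simp
      qed (use that in auto)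
      finally show ?thesis by simp
    qed
  next
    show "(\<lambda>s. B * exp t + exp t * B) integrable_on {0..t}" by (rule integrable_const_ivl)
    fix s assume s: "s \<in> {0..t}"
    have z: "(\<lambda>n. t / real (Suc n)) \<longlonglongrightarrow> 0"
      using tendsto_mult_right_zero[OF LIMSEQ_inverse_real_of_nat, of t] by (simp add: divide_inverse)
    have kk: "k n s * (t / Suc n) \<ge> s - t / Suc n" for n
      using k(2)[of s n] by (simp add: distrib_right add_divide_distrib)
    have l: "(\<lambda>n. k n s * (t / Suc n)) \<longlonglongrightarrow> s"
    proof (rule tendsto_sandwich[of "\<lambda>n. s - t / Suc n" _ _ "\<lambda>_. s"])
      show "(\<lambda>n. s - t / real (Suc n)) \<longlonglongrightarrow> s" using tendsto_diff[OF tendsto_const z, of s] by simp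
    qed (use k(1) kk in auto)
    have r: "(\<lambda>n. (k n s + 1) * (t / Suc n)) \<longlonglongrightarrow> s"
      using tendsto_add[OF l z] by (simp add: distrib_right add_divide_distrib)
    have "(\<lambda>n. F n s) \<longlonglongrightarrow> X s * exp s - exp s * X s"
      unfolding F_def
      using s by (intro tendsto_intros l cadlag_tendsto_from_right[OF cX _ r k(2)]) auto
    then show "(\<lambda>n. F n s) \<longlonglongrightarrow> 0" by simp
  qed
  then have "(\<lambda>n. exp t * X t - X 0 - integral {0..t} (F n)) \<longlonglongrightarrow> exp t * X t - X 0 - 0"
    by (intro tendsto_diff tendsto_const) simp
  moreover have "(\<Sum>i<Suc n. exp (i * (t / Suc n)) * (Z (Suc i * (t / Suc n)) - Z (i * (t / Suc n))))
      = exp t * X t - X 0 - integral {0..t} (F n)" for n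
    using part[where m="Suc n" and n=n] by (simp del: of_nat_Suc sum.lessThan_Suc)
  ultimately show ?thesis by simp
qed

text \<open>The sum is geometric with ratio \<open>exp (h n)\<close>, so it is the claimed limit
  times \<open>h n / (exp (h n) - 1)\<close>, and this quotient tends to 1 by the derivative of the
  exponential at 0.\<close>

lemma riemann_sum_exp_tendsto:
  fixes a t :: real
  assumes "0 < a" "0 < t"
  shows "(\<lambda>n. \<Sum>i<Suc n. t / Suc n * exp (a * (i * (t / Suc n)))) \<longlonglongrightarrow> (exp (a * t) - 1) / a"
proof -
  define h where "h n = a * t / real (Suc n)" for n
  have h: "0 < h n" for n using assms by (simp add: h_def)
  have h0: "h \<longlonglongrightarrow> 0"
    using tendsto_mult_right_zero[OF LIMSEQ_inverse_real_of_nat, of "a * t"] unfolding h_def divide_inverse by simp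
  have "((\<lambda>x. (exp (0 + x) - exp 0) / x) \<longlongrightarrow> exp (0::real)) (at 0)"
    using DERIV_exp[of "0::real"] unfolding DERIV_def by simp
  moreover have "filterlim h (at 0) sequentially"
    using h0 h by (auto simp: filterlim_at less_imp_neq[symmetric] intro!: always_eventually)
  ultimately have "(\<lambda>n. (exp (0 + h n) - exp 0) / h n) \<longlonglongrightarrow> exp 0"
    by (rule filterlim_compose)
  then have "(\<lambda>n. ((exp (a * t) - 1) / a) * inverse ((exp (0 + h n) - exp 0) / h n)) \<longlonglongrightarrow> ((exp (a * t) - 1) / a) * inverse (exp 0)"
    by (intro tendsto_intros) auto
  moreover have "((exp (a * t) - 1) / a) * inverse ((exp (0 + h n) - exp 0) / h n) = (\<Sum>i<Suc n. t / Suc n * exp (a * (i * (t / Suc n))))" for n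
  proof -
    have ne: "exp (h n) \<noteq> 1" using h[of n] by simp
    have "(\<Sum>i<Suc n. t / Suc n * exp (a * (i * (t / Suc n)))) = t / Suc n * (\<Sum>i<Suc n. exp (h n) ^ i)"
      unfolding sum_distrib_left by (intro sum.cong) (auto simp: h_def exp_of_nat_mult[symmetric] field_simps)
    also have "(\<Sum>i<Suc n. exp (h n) ^ i) = (exp (h n) ^ Suc n - 1) / (exp (h n) - 1)"
      using ne by (rule geometric_sum)
    also have "exp (h n) ^ Suc n = exp (a * t)"
      by (simp add: exp_of_nat_mult[symmetric] h_def del: of_nat_Suc power_Suc)
    finally have S: "(\<Sum>i<Suc n. t / Suc n * exp (a * (i * (t / Suc n)))) = t / Suc n * ((exp (a * t) - 1) / (exp (h n) - 1))" .
    have "t / real (Suc n) = h n / a" using assms by (simp add: h_def)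
    then show ?thesis unfolding S by (simp add: mult_ac del: of_nat_Suc)
  qed
  ultimately show ?thesis by simp
qed

section \<open>Laws of the Ornstein-Uhlenbeck process\<close>

lemma (in prob_space) char_distr_tendsto:
  assumes [measurable]: "\<And>n. S n \<in> borel_measurable M" "Y \<in> borel_measurable M"
    and "AE \<omega> in M. (\<lambda>n. S n \<omega>) \<longlonglongrightarrow> Y \<omega>"
  shows "(\<lambda>n. char (distr M borel (S n)) u) \<longlonglongrightarrow> char (distr M borel Y) u"
proof -
  have "(\<lambda>n. \<integral>\<omega>. iexp (u * S n \<omega>) \<partial>M) \<longlonglongrightarrow> (\<integral>\<omega>. iexp (u * Y \<omega>) \<partial>M)"
  proof (rule integral_dominated_convergence[where w="\<lambda>_. 1"])
    show "AE \<omega> in M. (\<lambda>n. iexp (u * S n \<omega>)) \<longlonglongrightarrow> iexp (u * Y \<omega>)"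
      using assms(3) by eventually_elim (intro tendsto_intros)
  qed auto
  then show ?thesis unfolding char_def by (simp add: integral_distr)
qed

lemma char_distr_affine:
  assumes [measurable]: "Y \<in> borel_measurable M"
  shows "char (distr M borel (\<lambda>\<omega>. c * Y \<omega>)) u = char (distr M borel Y) (c * u)"
  unfolding char_def by (simp add: integral_distr mult_ac)

text \<open>The increments of Z over the cells are independent and stable, so the characteristic
  function of the Riemann sum is the exponential of a deterministic Riemann sum of
  \<open>exp (a * s)\<close>. The limit gives the law of
  \<open>exp t * (X t - exp (- t) * x)\<close>, which is then rescaled.\<close>

lemma char_OU_solution:
  assumes a: "1 < a"
    and Z: "symmetric_stable_process a M Z" and X: "OU_solution M Z x X" and t: "0 < t"
  shows "char (distr M borel (\<lambda>\<omega>. X t \<omega> - exp (- t) * x)) u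
    = of_real (exp (- (1 - exp (- a * t)) / a * \<bar>u\<bar> powr a))"
proof -
  interpret prob_space M using Z by (simp add: symmetric_stable_process_def levy_process_def)
  have Zm [measurable]: "Z s \<in> borel_measurable M" if "0 \<le> s" for s
    using Z that by (simp add: symmetric_stable_process_def levy_process_def)
  have Xm [measurable]: "X s \<in> borel_measurable M" if "0 \<le> s" for s
    using X that by (simp add: OU_solution_def)
  define h where "h n = t / real (Suc n)" for n
  have h: "0 < h n" for n using t by (simp add: h_def)
  define W where "W n i \<omega> = exp (i * h n) * (Z (Suc i * h n) \<omega> - Z (i * h n) \<omega>)" for n i \<omega>
  have Wm [measurable]: "W n i \<in> borel_measurable M" for n i
    unfolding W_def using h[of n] by (intro borel_measurable_times borel_measurable_diff Zm borel_measurable_const) auto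
  have lim: "AE \<omega> in M. (\<lambda>n. \<Sum>i<Suc n. W n i \<omega>) \<longlonglongrightarrow> exp t * (X t \<omega> - exp (- t) * x)"
  proof -
    have "AE \<omega> in M. Z 0 \<omega> = 0" using Z by (simp add: symmetric_stable_process_def levy_process_def)
    moreover have "AE \<omega> in M. cadlag (\<lambda>t. X t \<omega>) \<and> (\<forall>t\<ge>0. X t \<omega> = x - (LBINT s:{0..t}. X s \<omega>) + Z t \<omega>)"
      using X by (simp add: OU_solution_def)
    ultimately show ?thesis
    proof eventually_elim
      case (elim \<omega>)
      \<comment> \<open>The initial value is read off from the equation at time 0, where the
        integral vanishes and Z is almost surely 0.\<close>
      have "X 0 \<omega> = x - (LBINT s:{0..0}. X s \<omega>) + Z 0 \<omega>" using elim by blast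
      also have "(LBINT s:{0..0}. X s \<omega>) = 0"
        using set_borel_integral_eq_integral(2)[OF cadlag_set_integrable[of "\<lambda>t. X t \<omega>" 0]] elim by simp
      finally have "X 0 \<omega> = x" using elim by simp
      moreover have "(\<lambda>n. \<Sum>i<Suc n. exp (i * (t / Suc n)) * (Z (Suc i * (t / Suc n)) \<omega> - Z (i * (t / Suc n)) \<omega>))
        \<longlonglongrightarrow> exp t * X t \<omega> - X 0 \<omega>"
        using elim t by (intro OU_riemann_sum_tendsto[where x=x]) auto
      ultimately show ?case
        by (simp add: W_def h_def algebra_simps exp_minus del: of_nat_Suc sum.lessThan_Suc)
    qed
  qed
  have charW: "char (distr M borel (W n i)) v = of_real (exp (- h n * exp (a * (i * h n)) * \<bar>v\<bar> powr a))" for n i v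
  proof -
    have "distr M borel (\<lambda>\<omega>. Z (i * h n + h n) \<omega> - Z (i * h n) \<omega>) = distr M borel (Z (h n))"
      using Z h[of n] by (simp add: symmetric_stable_process_def levy_process_def)
    moreover have "char (distr M borel (Z (h n))) u = complex_of_real (exp (- h n * \<bar>u\<bar> powr a))" for u
      using Z h[of n] by (auto simp: symmetric_stable_process_def less_imp_le)
    moreover have "(\<lambda>\<omega>. Z (Suc i * h n) \<omega> - Z (i * h n) \<omega>) \<in> borel_measurable M"
      using h[of n] by (intro borel_measurable_diff Zm) auto
    ultimately show ?thesis
      unfolding W_def using a
      by (subst char_distr_affine) (auto simp: algebra_simps abs_mult powr_mult exp_powr_real)
  qed
  have c1: "char (distr M borel (\<lambda>\<omega>. \<Sum>i<Suc n. W n i \<omega>)) v = of_real (exp (- (\<Sum>i<Suc n. t / Suc n * exp (a * (i * (t / Suc n)))) * \<bar>v\<bar> powr a))" for n v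
  proof -
    have "indep_vars (\<lambda>_. borel) (\<lambda>i \<omega>. Z (Suc i * h n) \<omega> - Z (i * h n) \<omega>) {..<Suc n}"
    proof -
      have "\<forall>(m::nat) (s::nat \<Rightarrow> real). 0 \<le> s 0 \<and> (\<forall>i<m. s i \<le> s (Suc i)) \<longrightarrow>
        indep_vars (\<lambda>_. borel) (\<lambda>i \<omega>. Z (s (Suc i)) \<omega> - Z (s i) \<omega>) {..<m}"
        using Z by (simp add: symmetric_stable_process_def levy_process_def)
      from this[rule_format, of "\<lambda>i. real i * h n" "Suc n"] show ?thesis
        using h[of n] by simp
    qed
    then have "indep_vars (\<lambda>_. borel) (W n) {..<Suc n}"
      unfolding W_def by (rule indep_vars_compose2[where Y="\<lambda>i y. exp (real i * h n) * y" and M'="\<lambda>_. borel"]) simp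
    then have "char (distr M borel (\<lambda>\<omega>. \<Sum>i<Suc n. W n i \<omega>)) v = (\<Prod>i<Suc n. char (distr M borel (W n i)) v)"
      by (rule char_distr_sum)
    also have "\<dots> = of_real (exp (\<Sum>i<Suc n. - h n * exp (a * (i * h n)) * \<bar>v\<bar> powr a))"
      unfolding charW by (simp add: exp_sum del: prod.lessThan_Suc sum.lessThan_Suc)
    finally show ?thesis
      by (simp add: h_def sum_distrib_right sum_negf del: sum.lessThan_Suc of_nat_Suc)
  qed
  have c2: "(\<lambda>n. complex_of_real (exp (- (\<Sum>i<Suc n. t / Suc n * exp (a * (i * (t / Suc n)))) * \<bar>v\<bar> powr a)))
    \<longlonglongrightarrow> of_real (exp (- ((exp (a * t) - 1) / a) * \<bar>v\<bar> powr a))" for v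
    using a t by (intro tendsto_intros riemann_sum_exp_tendsto) auto
  have c3: "(\<lambda>n. char (distr M borel (\<lambda>\<omega>. \<Sum>i<Suc n. W n i \<omega>)) v) \<longlonglongrightarrow> char (distr M borel (\<lambda>\<omega>. exp t * (X t \<omega> - exp (- t) * x))) v" for v
    using t lim by (intro char_distr_tendsto borel_measurable_sum borel_measurable_times borel_measurable_diff Xm Wm) auto
  have *: "char (distr M borel (\<lambda>\<omega>. exp t * (X t \<omega> - exp (- t) * x))) v = of_real (exp (- ((exp (a * t) - 1) / a) * \<bar>v\<bar> powr a))" for v
    using c2[of v] unfolding c1[symmetric] by (rule LIMSEQ_unique[OF c3])
  have "char (distr M borel (\<lambda>\<omega>. X t \<omega> - exp (- t) * x)) u = char (distr M borel (\<lambda>\<omega>. exp t * (X t \<omega> - exp (- t) * x))) (exp (- t) * u)"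
    using t by (subst char_distr_affine) (auto intro!: borel_measurable_diff Xm simp: mult.assoc[symmetric] exp_add[symmetric])
  also have "\<dots> = of_real (exp (- (1 - exp (- a * t)) / a * \<bar>u\<bar> powr a))"
    unfolding * by (simp add: abs_mult powr_mult exp_powr_real diff_divide_distrib algebra_simps exp_add[symmetric])
  finally show ?thesis .
qed

text \<open>Invariance at time t expresses \<open>char \<nu> u\<close> as
  \<open>char \<nu> (exp (- t) * u)\<close> times the characteristic function of the accumulated
  noise. As t runs through the positive integers, the first factor tends to
  \<open>char \<nu> 0 = 1\<close>, so every invariant law is identified.\<close>

lemma char_OU_invariant_measure:
  assumes a: "1 < a"
    and Z: "symmetric_stable_process a M Z" and X: "\<And>x. OU_solution M Z x (X x)"
    and inv: "invariant_measure (\<lambda>t x. distr M borel (X x t)) \<nu>"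
  shows "real_distribution \<nu>" "char \<nu> u = of_real (exp (- (1 / a) * \<bar>u\<bar> powr a))"
proof -
  interpret prob_space M using Z by (simp add: symmetric_stable_process_def levy_process_def)
  show nu: "real_distribution \<nu>"
    using inv by (auto simp: invariant_measure_def real_distribution_def real_distribution_axioms_def dest: sets_eq_imp_space_eq)
  interpret N: real_distribution \<nu> by (rule nu)
  have [measurable]: "X x s \<in> borel_measurable M" if "0 \<le> s" for s x
    using X[of x] that by (simp add: OU_solution_def)
  have step: "char \<nu> u = char \<nu> (exp (- t) * u) * of_real (exp (- (1 - exp (- a * t)) / a * \<bar>u\<bar> powr a))" if t: "0 < t" for t u
  proof -
    define \<mu> where "\<mu> = distr M borel (\<lambda>\<omega>. X 0 t \<omega> - exp (- t) * 0)"
    have mu: "real_distribution \<mu>" unfolding \<mu>_def using t by (intro real_distribution_distr) simp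
    have cmu: "char \<mu> v = of_real (exp (- (1 - exp (- a * t)) / a * \<bar>v\<bar> powr a))" for v
      unfolding \<mu>_def by (rule char_OU_solution[OF a Z X t])
    \<comment> \<open>The noise part has the same law for every starting point, by Levy uniqueness,
      so the transition kernel consists of translates of one law \<open>\<mu>\<close>.\<close>
    have law: "distr M borel (\<lambda>\<omega>. X x t \<omega> - exp (- t) * x) = \<mu>" for x
    proof (rule Levy_uniqueness)
      show "real_distribution (distr M borel (\<lambda>\<omega>. X x t \<omega> - exp (- t) * x))"
        using t by (intro real_distribution_distr) simp
      show "char (distr M borel (\<lambda>\<omega>. X x t \<omega> - exp (- t) * x)) = char \<mu>"
        using char_OU_solution[OF a Z X t] cmu by (auto simp: fun_eq_iff)
    qed (rule mu)
    have em: "emeasure (distr M borel (X x t)) A = emeasure \<mu> {z. exp (- t) * x + 1 * z \<in> A}" if [measurable]: "A \<in> sets borel" for x A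
      unfolding law[of x, symmetric] using t by (subst (1 2) emeasure_distr) (auto simp: vimage_def)
    have "\<nu> = lin_law (exp (- t)) 1 \<nu> \<mu>"
    proof (rule measure_eqI)
      show "sets \<nu> = sets (lin_law (exp (- t)) 1 \<nu> \<mu>)" by (simp add: lin_law_def)
      fix A assume "A \<in> sets \<nu>"
      then have [measurable]: "A \<in> sets borel" by simp
      have "(\<integral>\<^sup>+ x. emeasure (distr M borel (X x t)) A \<partial>\<nu>) = emeasure \<nu> A"
        using inv t by (simp add: invariant_measure_def)
      then show "emeasure \<nu> A = emeasure (lin_law (exp (- t)) 1 \<nu> \<mu>) A"
        by (simp add: em emeasure_lin_law[OF nu mu])
    qed
    then have "char \<nu> u = char (lin_law (exp (- t)) 1 \<nu> \<mu>) u" by simp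
    then show ?thesis by (simp add: char_lin_law[OF nu mu] cmu)
  qed
  have e0: "(\<lambda>n. exp (- real (Suc n))) \<longlonglongrightarrow> 0" 
  proof -
    have "(\<lambda>n. exp (- 1) ^ Suc n) \<longlonglongrightarrow> (0::real)" by (intro LIMSEQ_Suc LIMSEQ_power_zero) simp
    then show ?thesis by (simp add: exp_of_nat_mult[symmetric] del: of_nat_Suc power_Suc)
  qed
  have e1: "(\<lambda>n. exp (- a * real (Suc n))) \<longlonglongrightarrow> 0" 
  proof -
    have "(\<lambda>n. exp (- a) ^ Suc n) \<longlonglongrightarrow> (0::real)" using a by (intro LIMSEQ_Suc LIMSEQ_power_zero) simp
    then show ?thesis by (simp add: exp_of_nat_mult[symmetric] mult.commute del: of_nat_Suc power_Suc)
  qed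
  have "(\<lambda>n. char \<nu> (exp (- real (Suc n)) * u) * of_real (exp (- (1 - exp (- a * real (Suc n))) / a * \<bar>u\<bar> powr a)))
     \<longlonglongrightarrow> char \<nu> (0 * u) * of_real (exp (- (1 - 0) / a * \<bar>u\<bar> powr a))"
    using a by (intro tendsto_intros e0 e1 isCont_tendsto_compose[OF N.isCont_char]) auto
  then have "(\<lambda>n. char \<nu> u) \<longlonglongrightarrow> char \<nu> (0 * u) * of_real (exp (- (1 - 0) / a * \<bar>u\<bar> powr a))"
    by (subst (asm) step[symmetric]) auto
  then show "char \<nu> u = of_real (exp (- (1 / a) * \<bar>u\<bar> powr a))"
    by (simp add: LIMSEQ_const_iff N.char_zero)
qed

section \<open>The Pareto law and its symbol\<close>

lemma nn_integral_even:
  fixes f :: "real \<Rightarrow> ennreal"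
  assumes [measurable]: "f \<in> borel_measurable borel" and even: "\<And>x. f (- x) = f x"
  shows "(\<integral>\<^sup>+ x. f x \<partial>lborel) = 2 * (\<integral>\<^sup>+ x. f x * indicator {0..} x \<partial>lborel)"
proof -
  have "(\<integral>\<^sup>+ x. f x * indicator {..<0} x \<partial>lborel) = ennreal \<bar>- 1\<bar> * (\<integral>\<^sup>+ x. f (0 + (- 1) * x) * indicator {..<0} (0 + (- 1) * x) \<partial>lborel)"
    by (intro nn_integral_real_affine) auto
  also have "\<dots> = (\<integral>\<^sup>+ x. f x * indicator {0<..} x \<partial>lborel)"
    by (simp add: even) (auto intro!: nn_integral_cong simp: indicator_def)
  also have "\<dots> = (\<integral>\<^sup>+ x. f x * indicator {0..} x \<partial>lborel)"
  proof (rule nn_integral_cong_AE)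
    have "AE x in lborel. x \<noteq> (0::real)" by (rule AE_lborel_singleton)
    then show "AE x in lborel. f x * indicator {0<..} x = f x * indicator {0..} x"
      by eventually_elim (auto simp: indicator_def)
  qed
  finally have "(\<integral>\<^sup>+ x. f x * indicator {0..} x \<partial>lborel) + (\<integral>\<^sup>+ x. f x * indicator {..<0} x \<partial>lborel)
      = 2 * (\<integral>\<^sup>+ x. f x * indicator {0..} x \<partial>lborel)" by (simp add: mult_2)
  moreover have "(\<integral>\<^sup>+ x. f x * indicator {0..} x \<partial>lborel) + (\<integral>\<^sup>+ x. f x * indicator {..<0} x \<partial>lborel) = (\<integral>\<^sup>+ x. f x \<partial>lborel)"
    by (subst nn_integral_add[symmetric]) (auto intro!: nn_integral_cong simp: indicator_def)
  ultimately show ?thesis by simp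
qed

lemma nn_integral_powr_Ici:
  fixes b c :: real
  assumes "1 < b" "0 < c"
  shows "(\<integral>\<^sup>+ x. ennreal (x powr (- b)) * indicator {c..} x \<partial>lborel) = ennreal (c powr (1 - b) / (b - 1))"
proof -
  have "(\<integral>\<^sup>+ x. ennreal (x powr (- b)) * indicator {c..} x \<partial>lborel) = ennreal (0 - (- (c powr (1 - b) / (b - 1))))"
  proof (rule nn_integral_FTC_atLeast[where F="\<lambda>x. - (x powr (1 - b) / (b - 1))"])
    fix x :: real assume "c \<le> x"
    with assms have "0 < x" by simp
    have "- ((1 - b) * y / (b - 1)) = y" for y using assms by (simp add: field_simps)
    then show "((\<lambda>x. - (x powr (1 - b) / (b - 1))) has_real_derivative x powr (- b)) (at x)"
      using DERIV_minus[OF DERIV_cdivide[OF has_real_derivative_powr[of x "1 - b"], of "b - 1"]] assms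
        \<open>0 < x\<close> by simp
  next
    have "((\<lambda>x. x powr (1 - b)) \<longlongrightarrow> 0) at_top"
      using assms by (intro tendsto_neg_powr filterlim_ident) auto
    from tendsto_minus[OF tendsto_divide[OF this tendsto_const[of "b - 1"]]] assms
    show "((\<lambda>x. - (x powr (1 - b) / (b - 1))) \<longlongrightarrow> 0) at_top" by simp
  qed auto
  then show ?thesis by simp
qed

text \<open>Up to a constant, \<bar>x\<bar> is the integral of
  \<open>(1 - cos (u * x)) * \<bar>u\<bar> powr (- 2)\<close> over u. Tonelli turns the first moment
  into an integral of one minus the characteristic function against the same weight: the integrand
  is at most \<open>u powr (a - 2)\<close> on (0, 1), integrable as \<open>a > 1\<close>, and at
  most \<open>u powr (- 2)\<close> beyond.\<close>

lemma integrable_real_distribution_ident: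
  fixes a :: real
  assumes mu: "real_distribution \<mu>" and a: "1 < a" "a < 2"
    and char: "\<And>u. char \<mu> u = of_real (exp (- (1 / a) * \<bar>u\<bar> powr a))"
  shows "integrable \<mu> (\<lambda>x. x)"
proof -
  interpret real_distribution \<mu> by (rule mu)
  define C where "C = 1 / stable_const 1"
  have C: "0 < C" using stable_const_pos[of 1] by (simp add: C_def)
  have abs: "ennreal C * ennreal \<bar>x\<bar> = (\<integral>\<^sup>+ u. ennreal ((1 - cos (u * x)) * \<bar>u\<bar> powr (- 2)) \<partial>lborel)" for x
  proof (cases "x = 0")
    case False
    have "ennreal C = (\<integral>\<^sup>+ w. ennreal ((1 - cos w) * \<bar>w\<bar> powr (- 2)) \<partial>lborel)"
      using nn_integral_one_minus_cos_powr[of 1] by (simp add: C_def)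
    also have "\<dots> = ennreal \<bar>x\<bar> * (\<integral>\<^sup>+ u. ennreal ((1 - cos (0 + x * u)) * \<bar>0 + x * u\<bar> powr (- 2)) \<partial>lborel)"
      using False by (intro nn_integral_real_affine) auto
    also have "\<dots> = ennreal \<bar>x\<bar> * (ennreal (\<bar>x\<bar> powr (- 2)) * (\<integral>\<^sup>+ u. ennreal ((1 - cos (u * x)) * \<bar>u\<bar> powr (- 2)) \<partial>lborel))"
      by (subst nn_integral_cmult[symmetric]) (auto simp: ennreal_mult[symmetric] abs_mult powr_mult mult_ac)
    finally have "ennreal C * ennreal \<bar>x\<bar> = (ennreal \<bar>x\<bar> * ennreal \<bar>x\<bar> * ennreal (\<bar>x\<bar> powr (- 2))) * (\<integral>\<^sup>+ u. ennreal ((1 - cos (u * x)) * \<bar>u\<bar> powr (- 2)) \<partial>lborel)"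
      by (simp add: mult_ac)
    moreover have "\<bar>x\<bar> * \<bar>x\<bar> * \<bar>x\<bar> powr (- 2) = 1"
      using False by (simp add: powr_minus powr_numeral power2_eq_square field_simps)
    ultimately show ?thesis by (simp add: ennreal_mult[symmetric])
  qed simp
  have Re: "(\<integral>\<^sup>+ x. ennreal (1 - cos (u * x)) \<partial>\<mu>) = ennreal (1 - exp (- (1 / a) * \<bar>u\<bar> powr a))" for u
  proof -
    have i: "integrable \<mu> (\<lambda>x. cos (u * x))" by (rule integrable_const_bound[of _ 1]) auto
    have "Re (char \<mu> u) = (\<integral>x. cos (u * x) \<partial>\<mu>)"
      unfolding char_def by (subst integral_Re[symmetric]) (auto intro!: integrable_const_bound[of _ 1] simp: Re_exp)
    then have "(\<integral>x. 1 - cos (u * x) \<partial>\<mu>) = 1 - exp (- (1 / a) * \<bar>u\<bar> powr a)"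
      using i prob_space by (simp add: char del: space_eq_univ)
    then show ?thesis using i by (subst nn_integral_eq_integral) auto
  qed
  have "ennreal C * (\<integral>\<^sup>+ x. ennreal \<bar>x\<bar> \<partial>\<mu>) = (\<integral>\<^sup>+ x. \<integral>\<^sup>+ u. ennreal ((1 - cos (u * x)) * \<bar>u\<bar> powr (- 2)) \<partial>lborel \<partial>\<mu>)"
    by (subst nn_integral_cmult[symmetric]) (auto simp: abs)
  also have "\<dots> = (\<integral>\<^sup>+ u. \<integral>\<^sup>+ x. ennreal ((1 - cos (u * x)) * \<bar>u\<bar> powr (- 2)) \<partial>\<mu> \<partial>lborel)"
  proof -
    interpret P: pair_sigma_finite \<mu> lborel ..
    show ?thesis by (intro P.Fubini'[symmetric]) simp
  qed
  also have "\<dots> = (\<integral>\<^sup>+ u. ennreal (\<bar>u\<bar> powr (- 2)) * ennreal (1 - exp (- (1 / a) * \<bar>u\<bar> powr a)) \<partial>lborel)"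
    by (subst Re[symmetric], subst nn_integral_cmult[symmetric]) (auto simp: ennreal_mult[symmetric] mult.commute)
  also have "\<dots> = 2 * (\<integral>\<^sup>+ u. ennreal (\<bar>u\<bar> powr (- 2)) * ennreal (1 - exp (- (1 / a) * \<bar>u\<bar> powr a)) * indicator {0..} u \<partial>lborel)"
    by (intro nn_integral_even) auto
  finally have eq: "ennreal C * (\<integral>\<^sup>+ x. ennreal \<bar>x\<bar> \<partial>\<mu>)
    = 2 * (\<integral>\<^sup>+ u. ennreal (\<bar>u\<bar> powr (- 2)) * ennreal (1 - exp (- (1 / a) * \<bar>u\<bar> powr a)) * indicator {0..} u \<partial>lborel)" .
  have "(\<integral>\<^sup>+ u. ennreal (\<bar>u\<bar> powr (- 2)) * ennreal (1 - exp (- (1 / a) * \<bar>u\<bar> powr a)) * indicator {0..} u \<partial>lborel)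
    \<le> (\<integral>\<^sup>+ u. ennreal (indicator {0..1} u * u powr (a - 2)) + ennreal (u powr (- 2)) * indicator {1..} u \<partial>lborel)"
  proof (intro nn_integral_mono)
    fix u :: real
    have "1 - exp (- (1 / a) * \<bar>u\<bar> powr a) \<le> (1 / a) * \<bar>u\<bar> powr a"
      using exp_ge_add_one_self[of "- (1 / a) * \<bar>u\<bar> powr a"] by simp
    also have "\<dots> \<le> 1 * \<bar>u\<bar> powr a" using a by (intro mult_right_mono) auto
    finally have 1: "1 - exp (- (1 / a) * \<bar>u\<bar> powr a) \<le> \<bar>u\<bar> powr a" by simp
    have 2: "1 - exp (- (1 / a) * \<bar>u\<bar> powr a) \<le> 1" by simp
    have 3: "0 \<le> 1 - exp (- (1 / a) * \<bar>u\<bar> powr a)" using a by simp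
    show "ennreal (\<bar>u\<bar> powr (- 2)) * ennreal (1 - exp (- (1 / a) * \<bar>u\<bar> powr a)) * indicator {0..} u
      \<le> ennreal (indicator {0..1} u * u powr (a - 2)) + ennreal (u powr (- 2)) * indicator {1..} u"
    proof (cases "u \<ge> 1")
      case True
      have "ennreal (\<bar>u\<bar> powr (- 2)) * ennreal (1 - exp (- (1 / a) * \<bar>u\<bar> powr a)) \<le> ennreal (u powr (- 2))"
        using True mult_left_mono[OF 2, of "u powr (- 2)"] 3 by (simp add: ennreal_mult[symmetric])
      also have "\<dots> \<le> ennreal (indicator {0..1} u * u powr (a - 2)) + ennreal (u powr (- 2))" by simp
      finally show ?thesis using True by simp
    next
      case False
      show ?thesis
      proof (cases "0 \<le> u")
        case True
        have "\<bar>u\<bar> powr (- 2) * (1 - exp (- (1 / a) * \<bar>u\<bar> powr a)) \<le> \<bar>u\<bar> powr (- 2) * \<bar>u\<bar> powr a"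
          by (rule mult_left_mono[OF 1]) simp
        also have "\<dots> = u powr (a - 2)" using True by (simp add: powr_add[symmetric])
        finally show ?thesis using True False 3 by (simp add: ennreal_mult[symmetric])
      qed simp
    qed
  qed
  also have "\<dots> < \<infinity>"
  proof -
    have "((\<lambda>u. u powr (a - 2)) has_integral 1 powr (a - 2 + 1) / (a - 2 + 1)) {0..1}"
      using has_integral_powr_from_0[of "a - 2" 1] a by simp
    then have "((\<lambda>u. if u \<in> {0..1} then u powr (a - 2) else 0) has_integral 1 / (a - 1)) UNIV"
      unfolding has_integral_restrict_UNIV by simp
    also have "(\<lambda>u::real. if u \<in> {0..1} then u powr (a - 2) else 0) = (\<lambda>u. indicator {0..1} u * u powr (a - 2))"
      by (rule ext) (simp add: indicator_def)
    finally have "(\<integral>\<^sup>+ u. ennreal (indicator {0..1} u * u powr (a - 2)) \<partial>lborel) = ennreal (1 / (a - 1))"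
      by (intro nn_integral_has_integral_lborel) auto
    then show ?thesis
      using nn_integral_powr_Ici[of 2 1] by (subst nn_integral_add) (auto simp: ennreal_add_less_top)
  qed
  finally have "ennreal C * (\<integral>\<^sup>+ x. ennreal \<bar>x\<bar> \<partial>\<mu>) < \<infinity>"
    unfolding eq by (simp add: ennreal_mult_less_top)
  then have "(\<integral>\<^sup>+ x. ennreal \<bar>x\<bar> \<partial>\<mu>) < \<infinity>"
    using C by (auto simp: ennreal_mult_less_top)
  then show ?thesis by (intro integrableI_bounded) auto
qed

section \<open>The Pareto law and its moments\<close>

definition pareto_law :: "real \<Rightarrow> real measure" where
  "pareto_law a = density lborel (\<lambda>z. ennreal (pareto_density a z))"

lemma pareto_density_measurable [measurable]: "pareto_density a \<in> borel_measurable borel"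
  unfolding pareto_density_def by measurable

lemma pareto_density_nonneg: "0 < a \<Longrightarrow> 0 \<le> pareto_density a z"
  by (simp add: pareto_density_def)

lemma pareto_density_minus [simp]: "pareto_density a (- z) = pareto_density a z"
  by (simp add: pareto_density_def)

lemma nn_integral_pareto_law:
  assumes "0 < a" and [measurable]: "f \<in> borel_measurable borel" and "\<And>z. 0 \<le> f z"
  shows "(\<integral>\<^sup>+ z. ennreal (f z) \<partial>pareto_law a) = (\<integral>\<^sup>+ z. ennreal (pareto_density a z * f z) \<partial>lborel)"
  unfolding pareto_law_def using assms pareto_density_nonneg
  by (subst nn_integral_density) (auto simp: ennreal_mult)

lemma nn_integral_pareto_powr:
  fixes a b :: real
  assumes "0 < a" "b < a"
  shows "(\<integral>\<^sup>+ z. ennreal (\<bar>z\<bar> powr b) \<partial>pareto_law a) = ennreal (a / (a - b))"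
proof -
  have "(\<integral>\<^sup>+ z. ennreal (\<bar>z\<bar> powr b) \<partial>pareto_law a) = (\<integral>\<^sup>+ z. ennreal (pareto_density a z * \<bar>z\<bar> powr b) \<partial>lborel)"
    using assms by (intro nn_integral_pareto_law) auto
  also have "\<dots> = 2 * (\<integral>\<^sup>+ z. ennreal (pareto_density a z * \<bar>z\<bar> powr b) * indicator {0..} z \<partial>lborel)"
    by (intro nn_integral_even) auto
  also have "(\<integral>\<^sup>+ z. ennreal (pareto_density a z * \<bar>z\<bar> powr b) * indicator {0..} z \<partial>lborel)
    = (\<integral>\<^sup>+ z. ennreal (a / 2) * (ennreal (z powr (- (a + 1 - b))) * indicator {1..} z) \<partial>lborel)"
  proof (rule nn_integral_cong_AE)
    have "AE z in lborel. z \<noteq> (1::real)" by (rule AE_lborel_singleton)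
    then show "AE z in lborel. ennreal (pareto_density a z * \<bar>z\<bar> powr b) * indicator {0..} z
      = ennreal (a / 2) * (ennreal (z powr (- (a + 1 - b))) * indicator {1..} z)"
    proof eventually_elim
      case (elim z)
      show ?case
      proof (cases "1 < z")
        case True
        have "a / (2 * z powr (a + 1)) * z powr b = a / 2 * z powr (- (a + 1 - b))"
          using True by (simp add: powr_diff powr_minus powr_add field_simps)
        then show ?thesis using True assms by (simp add: pareto_density_def ennreal_mult[symmetric])
      qed (use elim in \<open>auto simp: pareto_density_def indicator_def\<close>)
    qed
  qed
  also have "\<dots> = ennreal (a / 2) * ennreal (1 / (a - b))"
    using assms nn_integral_powr_Ici[of "a + 1 - b" 1] by (subst nn_integral_cmult) auto
  also have "2 * (ennreal (a / 2) * ennreal (1 / (a - b))) = ennreal (2 * (a / 2 * (1 / (a - b))))"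
  proof -
    have "2 * ennreal y = ennreal (2 * y)" if "0 \<le> y" for y using that by (simp add: ennreal_mult)
    then show ?thesis using assms by (simp only: ennreal_mult[symmetric] mult_nonneg_nonneg divide_nonneg_nonneg less_imp_le zero_le_one diff_ge_0_iff_ge zero_le_numeral)
  qed
  also have "2 * (a / 2 * (1 / (a - b))) = a / (a - b)"
  proof -
    have "2 * (a / 2 * c) = a * c" for c by simp
    then show ?thesis by (simp only: times_divide_eq_right mult_1_right)
  qed
  finally show ?thesis .
qed

lemma real_distribution_pareto_law:
  assumes "0 < a" shows "real_distribution (pareto_law a)"
proof -
  have "(\<integral>\<^sup>+ z. ennreal (\<bar>z\<bar> powr 0) \<partial>pareto_law a) = emeasure (pareto_law a) UNIV"
  proof -
    \<comment> \<open>\<open>0 powr 0\<close> is 0, so the integrand equals 1 only off the origin,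
      which is a null set.\<close>
    have "AE z in pareto_law a. z \<noteq> 0"
      unfolding pareto_law_def by (subst AE_density) (auto simp: pareto_density_def)
    then have "(\<integral>\<^sup>+ z. ennreal (\<bar>z\<bar> powr 0) \<partial>pareto_law a) = (\<integral>\<^sup>+ z. 1 \<partial>pareto_law a)"
      by (intro nn_integral_cong_AE) auto
    then show ?thesis by (simp add: pareto_law_def)
  qed
  then have "emeasure (pareto_law a) UNIV = 1"
    using nn_integral_pareto_powr[of a 0] assms by simp
  then show ?thesis
    by (intro real_distribution.intro prob_spaceI) (auto simp: real_distribution_axioms_def pareto_law_def)
qed

lemma integrable_pareto_law:
  assumes "1 < a" shows "integrable (pareto_law a) (\<lambda>z. z)"
proof (rule integrableI_bounded)
  have "(\<integral>\<^sup>+ z. ennreal (norm z) \<partial>pareto_law a) = (\<integral>\<^sup>+ z. ennreal (\<bar>z\<bar> powr 1) \<partial>pareto_law a)" by simp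
  also have "\<dots> < \<infinity>" using assms by (subst nn_integral_pareto_powr) auto
  finally show "(\<integral>\<^sup>+ z. ennreal (norm z) \<partial>pareto_law a) < \<infinity>" .
qed (simp add: pareto_law_def)

section \<open>The Taylor remainder of the cosine and the Pareto symbol\<close>

lemma nonneg_of_deriv_nonneg:
  fixes f f' :: "real \<Rightarrow> real"
  assumes "\<And>x. (f has_real_derivative f' x) (at x)" "\<And>x. 0 \<le> x \<Longrightarrow> 0 \<le> f' x" "0 \<le> f 0" "0 \<le> x"
  shows "0 \<le> f x"
proof -
  have "f 0 \<le> f x"
  proof (rule DERIV_nonneg_imp_nondecreasing[OF assms(4)])
    fix y :: real assume "0 \<le> y"
    then show "\<exists>z. (f has_real_derivative z) (at y) \<and> 0 \<le> z" using assms(1,2) by blast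
  qed
  with assms show ?thesis by simp
qed

text \<open>Starting from sin x \<le> x, each bound follows from an earlier one because its
  derivative is the expression bounded there.\<close>

lemma cos_taylor_bounds:
  fixes x :: real
  assumes "0 \<le> x"
  shows "0 \<le> cos x - 1 + x\<^sup>2 / 2" "cos x - 1 + x\<^sup>2 / 2 \<le> x ^ 4 / 24" "0 \<le> x - sin x" "x - sin x \<le> x ^ 3 / 6"
proof -
  have A: "0 \<le> x - sin x" if "0 \<le> x" for x :: real using sin_x_le_x[OF that] by simp
  have B: "0 \<le> cos x - 1 + x\<^sup>2 / 2" if "0 \<le> x" for x :: real
    by (rule nonneg_of_deriv_nonneg[OF _ A _ that]) (auto intro!: derivative_eq_intros)
  have C: "0 \<le> x ^ 3 / 6 - (x - sin x)" if "0 \<le> x" for x :: real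
    by (rule nonneg_of_deriv_nonneg[OF _ B _ that]) (auto intro!: derivative_eq_intros simp: field_simps power2_eq_square)
  have D: "0 \<le> x ^ 4 / 24 - (cos x - 1 + x\<^sup>2 / 2)" if "0 \<le> x" for x :: real
    by (rule nonneg_of_deriv_nonneg[OF _ C _ that]) (auto intro!: derivative_eq_intros simp: field_simps power3_eq_cube)
  show "0 \<le> cos x - 1 + x\<^sup>2 / 2" "cos x - 1 + x\<^sup>2 / 2 \<le> x ^ 4 / 24" "0 \<le> x - sin x" "x - sin x \<le> x ^ 3 / 6"
    using A[OF assms] B[OF assms] C[OF assms] D[OF assms] by auto
qed

text \<open>Adding s squared over 2 leaves the fourth-order remainder of the cosine, so that the
  kernel is of order \<open>s powr (3 - a)\<close> at 0. Its integral is what the Pareto symbol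
  contains beyond the quadratic term.\<close>

definition cos_kernel :: "real \<Rightarrow> real \<Rightarrow> real" where
  "cos_kernel a s = (cos s - 1 + s\<^sup>2 / 2) * s powr (- 1 - a)"

definition cos_tail :: "real \<Rightarrow> real \<Rightarrow> real" where
  "cos_tail a w = integral {0..w} (cos_kernel a)"

lemma cos_kernel_bounds:
  assumes "0 \<le> s"
  shows "0 \<le> cos_kernel a s" "cos_kernel a s \<le> s powr (3 - a) / 24"
proof -
  show "0 \<le> cos_kernel a s" using cos_taylor_bounds[OF assms] by (simp add: cos_kernel_def)
  show "cos_kernel a s \<le> s powr (3 - a) / 24"
  proof (cases "s = 0")
    case False
    with assms have s: "0 < s" by simp
    have "cos_kernel a s \<le> s ^ 4 / 24 * s powr (- 1 - a)"
      unfolding cos_kernel_def using cos_taylor_bounds[OF assms] by (intro mult_right_mono) auto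
    also have "\<dots> = s powr 4 * s powr (- 1 - a) / 24" using s by (simp add: powr_numeral)
    also have "s powr 4 * s powr (- 1 - a) = s powr (3 - a)" by (simp add: powr_add[symmetric])
    finally show ?thesis .
  qed (simp add: cos_kernel_def)
qed

lemma cos_kernel_measurable [measurable]: "cos_kernel a \<in> borel_measurable borel"
  unfolding cos_kernel_def by measurable

lemma cos_kernel_set_integrable:
  assumes "a < 2"
  shows "set_integrable lborel {0..w} (cos_kernel a)"
  unfolding set_integrable_def
proof (rule integrableI_bounded_set[where A="{0..w}" and B="w powr (3 - a) / 24"])
  show "AE s\<in>{0..w} in lborel. norm (indicator {0..w} s *\<^sub>R cos_kernel a s) \<le> w powr (3 - a) / 24"
  proof (intro AE_I2 impI)
    fix s assume s: "s \<in> {0..w}"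
    have "s powr (3 - a) \<le> w powr (3 - a)" using s assms by (intro powr_mono2) auto
    then show "norm (indicator {0..w} s *\<^sub>R cos_kernel a s) \<le> w powr (3 - a) / 24"
      using s cos_kernel_bounds[of s a] by simp
  qed
qed (auto simp: emeasure_lborel_Icc_eq)

lemma cos_kernel_integrable: "a < 2 \<Longrightarrow> cos_kernel a integrable_on {0..w}"
  by (rule set_borel_integral_eq_integral(1)[OF cos_kernel_set_integrable])

lemma cos_kernel_has_derivative:
  assumes "0 < s"
  shows "(cos_kernel a has_real_derivative (s - sin s) * s powr (- 1 - a)
    - (1 + a) * (cos s - 1 + s\<^sup>2 / 2) * s powr (- 2 - a)) (at s)"
proof -
  have "((\<lambda>s. s powr (- 1 - a)) has_real_derivative (- 1 - a) * s powr (- 1 - a - 1)) (at s)"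
    by (rule has_real_derivative_powr[OF assms])
  then have "((\<lambda>s. (cos s - 1 + s\<^sup>2 / 2) * s powr (- 1 - a)) has_real_derivative
      (- sin s + s) * s powr (- 1 - a) + ((- 1 - a) * s powr (- 1 - a - 1)) * (cos s - 1 + s\<^sup>2 / 2)) (at s)"
    by (intro DERIV_mult) (auto intro!: derivative_eq_intros)
  moreover have "- 1 - a - 1 = - 2 - a" by simp
  ultimately have "((\<lambda>s. (cos s - 1 + s\<^sup>2 / 2) * s powr (- 1 - a)) has_real_derivative
      (- sin s + s) * s powr (- 1 - a) + ((- 1 - a) * s powr (- 2 - a)) * (cos s - 1 + s\<^sup>2 / 2)) (at s)" by metis
  then show ?thesis unfolding cos_kernel_def by (rule DERIV_cong) (simp add: algebra_simps)
qed

lemma cos_kernel_deriv_bound: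
  fixes a s :: real
  assumes "0 < s" "1 < a" "a < 2"
  shows "\<bar>(s - sin s) * s powr (- 1 - a) - (1 + a) * (cos s - 1 + s\<^sup>2 / 2) * s powr (- 2 - a)\<bar> \<le> s powr (2 - a)"
proof -
  have 1: "(s - sin s) * s powr (- 1 - a) \<le> s ^ 3 / 6 * s powr (- 1 - a)" "0 \<le> (s - sin s) * s powr (- 1 - a)"
    using cos_taylor_bounds[of s] assms by (auto intro!: mult_right_mono)
  have "(1 + a) * (cos s - 1 + s\<^sup>2 / 2) \<le> 3 * (s ^ 4 / 24)"
    using cos_taylor_bounds[of s] assms by (intro mult_mono) auto
  then have 2: "(1 + a) * (cos s - 1 + s\<^sup>2 / 2) * s powr (- 2 - a) \<le> 3 * (s ^ 4 / 24) * s powr (- 2 - a)"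
    by (rule mult_right_mono) simp
  have 5: "0 \<le> (1 + a) * (cos s - 1 + s\<^sup>2 / 2) * s powr (- 2 - a)"
    using cos_taylor_bounds[of s] assms by (intro mult_nonneg_nonneg) auto
  have 3: "s ^ 3 / 6 * s powr (- 1 - a) = s powr (2 - a) / 6"
  proof -
    have "s ^ 3 / 6 * s powr (- 1 - a) = s powr 3 * s powr (- 1 - a) / 6" using assms by (simp add: powr_numeral)
    then show ?thesis by (simp add: powr_add[symmetric])
  qed
  have 4: "3 * (s ^ 4 / 24) * s powr (- 2 - a) = s powr (2 - a) / 8"
  proof -
    have "3 * (s ^ 4 / 24) * s powr (- 2 - a) = s powr 4 * s powr (- 2 - a) / 8" using assms by (simp add: powr_numeral)
    then show ?thesis by (simp add: powr_add[symmetric])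
  qed
  have "0 \<le> s powr (2 - a)" by simp
  then show ?thesis using 1 2 3 4 5 by linarith
qed

lemma cos_tail_has_derivative:
  assumes "0 < w" "a < 2"
  shows "(cos_tail a has_real_derivative cos_kernel a w) (at w)"
proof -
  have c: "isCont (cos_kernel a) w"
    using cos_kernel_has_derivative[OF assms(1)] by (rule DERIV_isCont)
  have "((\<lambda>u. integral {0..u} (cos_kernel a)) has_vector_derivative cos_kernel a w) (at w within {0..w + 1})"
    using assms c
    by (intro integral_has_vector_derivative_continuous_at[where S="{}", simplified] cos_kernel_integrable)
       (auto intro: continuous_at_imp_continuous_at_within)
  moreover have "at w within {0..w + 1} = at w"
    using assms by (intro at_within_interior) auto
  ultimately show ?thesis
    unfolding cos_tail_def by (simp add: has_real_derivative_iff_has_vector_derivative)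
qed

lemma cos_tail_bounds:
  assumes "0 \<le> w" "1 < a" "a < 2"
  shows "0 \<le> cos_tail a w" "cos_tail a w \<le> w powr (4 - a) / 48"
proof -
  show "0 \<le> cos_tail a w"
    unfolding cos_tail_def using cos_kernel_bounds assms
    by (intro Henstock_Kurzweil_Integration.integral_nonneg cos_kernel_integrable) auto
  have i: "((\<lambda>s. s powr (3 - a) / 24) has_integral w powr (3 - a + 1) / (3 - a + 1) / 24) {0..w}"
    using has_integral_powr_from_0[of "3 - a" w] assms by (intro has_integral_divide) auto
  have "cos_tail a w \<le> integral {0..w} (\<lambda>s. s powr (3 - a) / 24)"
    unfolding cos_tail_def using cos_kernel_bounds assms i
    by (intro integral_le cos_kernel_integrable) (auto simp: integrable_on_def)
  also have "\<dots> = w powr (3 - a + 1) / (3 - a + 1) / 24" by (rule integral_unique[OF i])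
  also have "3 - a + 1 = 4 - a" by simp
  also have "w powr (4 - a) / (4 - a) / 24 \<le> w powr (4 - a) / 2 / 24"
    using assms by (intro divide_right_mono divide_left_mono) auto
  also have "\<dots> = w powr (4 - a) / 48" by simp
  finally show "cos_tail a w \<le> w powr (4 - a) / 48" .
qed

text \<open>For w \<ge> 0 this is the characteristic function of the Pareto law. The term in
  \<open>w powr a\<close> is what the density without its cutoff would give; the last two terms
  restore the missing part inside the cutoff, split into the quadratic and the higher-order
  contribution of the cosine.\<close>

definition pareto_symbol :: "real \<Rightarrow> real \<Rightarrow> real" where
  "pareto_symbol a w = 1 - a / (2 * stable_const a) * w powr a + a / (2 * (2 - a)) * w\<^sup>2 - a * w powr a * cos_tail a w"

lemma has_integral_one_minus_cos_powr:
  assumes a: "1 < a" "a < 2" and w: "0 \<le> w"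
  shows "((\<lambda>t. (1 - cos t) * t powr (- 1 - a)) has_integral w powr (2 - a) / (2 * (2 - a)) - cos_tail a w) {0..w}"
proof -
  have "((\<lambda>t. t powr (1 - a)) has_integral w powr (1 - a + 1) / (1 - a + 1)) {0..w}"
    using has_integral_powr_from_0[of "1 - a" w] a w by auto
  moreover have "1 - a + 1 = 2 - a" by simp
  ultimately have "((\<lambda>t. t powr (1 - a)) has_integral w powr (2 - a) / (2 - a)) {0..w}" by metis
  then have "((\<lambda>t. t powr (1 - a) / 2 - cos_kernel a t) has_integral w powr (2 - a) / (2 - a) / 2 - cos_tail a w) {0..w}"
    unfolding cos_tail_def using cos_kernel_integrable[of a w] a
    by (intro has_integral_diff has_integral_divide integrable_integral) auto
  also have "w powr (2 - a) / (2 - a) / 2 = w powr (2 - a) / (2 * (2 - a))"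
    by (simp only: divide_divide_eq_left mult.commute)
  finally show ?thesis
  proof (rule has_integral_eq[rotated])
    fix t assume "t \<in> {0..w}"
    show "t powr (1 - a) / 2 - cos_kernel a t = (1 - cos t) * t powr (- 1 - a)"
    proof (cases "t = 0")
      case False
      with \<open>t \<in> {0..w}\<close> have t: "0 < t" by simp
      then have "t\<^sup>2 / 2 * t powr (- 1 - a) = t powr 2 * t powr (- 1 - a) / 2" by (simp add: powr_numeral)
      also have "t powr 2 * t powr (- 1 - a) = t powr (1 - a)" by (simp add: powr_add[symmetric])
      finally show ?thesis by (simp add: cos_kernel_def algebra_simps)
    qed (simp add: cos_kernel_def)
  qed
qed

lemma nn_integral_one_minus_cos_powr_Icc:
  assumes a: "1 < a" "a < 2" and w: "0 \<le> w"
  shows "(\<integral>\<^sup>+ t. ennreal ((1 - cos t) * t powr (- 1 - a)) * indicator {0..w} t \<partial>lborel)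
    = ennreal (w powr (2 - a) / (2 * (2 - a)) - cos_tail a w)"
proof -
  have "((\<lambda>t. if t \<in> {0..w} then (1 - cos t) * t powr (- 1 - a) else 0) has_integral w powr (2 - a) / (2 * (2 - a)) - cos_tail a w) UNIV"
    unfolding has_integral_restrict_UNIV by (rule has_integral_one_minus_cos_powr[OF assms])
  also have "(\<lambda>t. if t \<in> {0..w} then (1 - cos t) * t powr (- 1 - a) else 0) = (\<lambda>t. (1 - cos t) * t powr (- 1 - a) * indicator {0..w} t)"
    by (rule ext) (simp add: indicator_def)
  finally have "(\<integral>\<^sup>+ t. ennreal ((1 - cos t) * t powr (- 1 - a) * indicator {0..w} t) \<partial>lborel)
    = ennreal (w powr (2 - a) / (2 * (2 - a)) - cos_tail a w)"
    by (intro nn_integral_has_integral_lborel) auto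
  moreover have "ennreal ((1 - cos t) * t powr (- 1 - a)) * indicator {0..w} t = ennreal ((1 - cos t) * t powr (- 1 - a) * indicator {0..w} t)" for t
    by (simp add: indicator_def)
  ultimately show ?thesis by simp
qed

text \<open>The substitution t = w z leads to the integral of
  \<open>(1 - cos t) * \<bar>t\<bar> powr (- 1 - a)\<close> over \<bar>t\<bar> > w, which is
  obtained by subtracting the explicit part over \<bar>t\<bar> \<le> w from the known integral over
  the line.\<close>

lemma
  assumes a: "1 < a" "a < 2" and w: "0 < w"
  shows nn_integral_one_minus_cos_pareto: "(\<integral>\<^sup>+ z. ennreal (1 - cos (w * z)) \<partial>pareto_law a) = ennreal (1 - pareto_symbol a w)"
    and pareto_symbol_le_1: "pareto_symbol a w \<le> 1"
proof -
  define q where "q t = (1 - cos t) * \<bar>t\<bar> powr (- 1 - a)" for t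
  define m where "m = w powr (2 - a) / (2 * (2 - a)) - cos_tail a w"
  define A where "A = (\<integral>\<^sup>+ t. ennreal (q t) * indicator {t. w < \<bar>t\<bar>} t \<partial>lborel)"
  have [measurable]: "q \<in> borel_measurable borel" unfolding q_def by measurable
  have m_int: "(\<integral>\<^sup>+ t. ennreal (q t) * indicator {t. \<bar>t\<bar> \<le> w} t \<partial>lborel) = 2 * ennreal m"
  proof -
    have "(\<integral>\<^sup>+ t. ennreal (q t) * indicator {t. \<bar>t\<bar> \<le> w} t \<partial>lborel)
      = 2 * (\<integral>\<^sup>+ t. ennreal (q t) * indicator {t. \<bar>t\<bar> \<le> w} t * indicator {0..} t \<partial>lborel)"
      by (intro nn_integral_even) (auto simp: q_def indicator_def)
    also have "(\<integral>\<^sup>+ t. ennreal (q t) * indicator {t. \<bar>t\<bar> \<le> w} t * indicator {0..} t \<partial>lborel)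
      = (\<integral>\<^sup>+ t. ennreal ((1 - cos t) * t powr (- 1 - a)) * indicator {0..w} t \<partial>lborel)"
      by (intro nn_integral_cong) (auto simp: q_def indicator_def)
    also have "\<dots> = ennreal m" unfolding m_def using a w by (intro nn_integral_one_minus_cos_powr_Icc) auto
    finally show ?thesis .
  qed
  have "ennreal (1 / stable_const a) = (\<integral>\<^sup>+ t. ennreal (q t) * indicator {t. w < \<bar>t\<bar>} t + ennreal (q t) * indicator {t. \<bar>t\<bar> \<le> w} t \<partial>lborel)"
    unfolding q_def using a
    by (subst nn_integral_one_minus_cos_powr[symmetric]) (auto intro!: nn_integral_cong simp: indicator_def)
  also have "\<dots> = A + 2 * ennreal m"
    unfolding A_def by (subst nn_integral_add) (auto simp: m_int)
  finally have AD: "ennreal (1 / stable_const a) = A + 2 * ennreal m" .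
  have m0: "0 \<le> m"
    using has_integral_one_minus_cos_powr[of a w] a w unfolding m_def by (rule_tac has_integral_nonneg) auto
  \<comment> \<open>The subtraction takes place among extended nonnegative numbers; it is licit
    because A is finite, being a summand of a finite sum.\<close>
  have A: "A = ennreal (1 / stable_const a - 2 * m)" and D0: "0 \<le> 1 / stable_const a - 2 * m"
  proof -
    have "A < top" using AD by (metis ennreal_less_top ennreal_add_eq_top less_top)
    then obtain r where r: "A = ennreal r" "0 \<le> r" by (cases A) auto
    have "ennreal (1 / stable_const a) = ennreal (r + 2 * m)"
      unfolding AD r using r m0 by (simp add: ennreal_mult)
    then have "1 / stable_const a = r + 2 * m"
      using r m0 stable_const_pos[of a] a by (subst (asm) ennreal_inj) auto
    then show "A = ennreal (1 / stable_const a - 2 * m)" "0 \<le> 1 / stable_const a - 2 * m" using r by simp_all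
  qed
  have sym: "a / 2 * w powr a * (1 / stable_const a - 2 * m) = 1 - pareto_symbol a w"
  proof -
    have "w powr a * w powr (2 - a) = w powr 2" by (simp add: powr_add[symmetric])
    also have "\<dots> = w\<^sup>2" using w by (simp add: powr_numeral)
    finally have "a / (2 * (2 - a)) * w\<^sup>2 = a * w powr a * (w powr (2 - a) / (2 * (2 - a)))" by (simp add: mult_ac)
    then show ?thesis unfolding pareto_symbol_def m_def by (simp add: algebra_simps)
  qed
  have "(\<integral>\<^sup>+ z. ennreal (1 - cos (w * z)) \<partial>pareto_law a) = (\<integral>\<^sup>+ z. ennreal (pareto_density a z * (1 - cos (w * z))) \<partial>lborel)"
    using a by (intro nn_integral_pareto_law) auto
  also have "\<dots> = ennreal \<bar>1 / w\<bar> * (\<integral>\<^sup>+ t. ennreal (pareto_density a (0 + 1 / w * t) * (1 - cos (w * (0 + 1 / w * t)))) \<partial>lborel)"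
    using w by (intro nn_integral_real_affine) auto
  also have "\<dots> = ennreal (1 / w) * (\<integral>\<^sup>+ t. ennreal (a / 2 * w powr (a + 1)) * (ennreal (q t) * indicator {t. w < \<bar>t\<bar>} t) \<partial>lborel)"
  proof -
    have "ennreal (pareto_density a (0 + 1 / w * t) * (1 - cos (w * (0 + 1 / w * t))))
      = ennreal (a / 2 * w powr (a + 1)) * (ennreal (q t) * indicator {t. w < \<bar>t\<bar>} t)" for t
    proof (cases "w < \<bar>t\<bar>")
      case True
      have "\<bar>t\<bar> powr (- 1 - a) = 1 / \<bar>t\<bar> powr (a + 1)"
        by (simp add: powr_minus_divide[symmetric] add.commute)
      then have "a / (2 * \<bar>t / w\<bar> powr (a + 1)) = a / 2 * w powr (a + 1) * \<bar>t\<bar> powr (- 1 - a)"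
        using w True by (simp add: powr_divide)
      then have e: "pareto_density a (t / w) = a / 2 * w powr (a + 1) * \<bar>t\<bar> powr (- 1 - a)"
        using True w by (simp add: pareto_density_def)
      show ?thesis
        using True w a by (simp add: e q_def ennreal_mult[symmetric] mult_ac)
    qed (use w in \<open>simp add: pareto_density_def\<close>)
    then show ?thesis using w by simp
  qed
  also have "\<dots> = ennreal (1 / w) * (ennreal (a / 2 * w powr (a + 1)) * A)"
    unfolding A_def by (subst nn_integral_cmult) auto
  also have "\<dots> = ennreal (1 / w * (a / 2 * w powr (a + 1)) * (1 / stable_const a - 2 * m))"
    unfolding A using w a by (simp add: ennreal_mult''[symmetric] ennreal_mult'[symmetric] mult_ac)
  also have "1 / w * (a / 2 * w powr (a + 1)) = a / 2 * w powr a" using w by (simp add: powr_add)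
  also note sym
  finally show "(\<integral>\<^sup>+ z. ennreal (1 - cos (w * z)) \<partial>pareto_law a) = ennreal (1 - pareto_symbol a w)" .
  have "0 \<le> a / 2 * w powr a * (1 / stable_const a - 2 * m)" using D0 a by (intro mult_nonneg_nonneg) auto
  then show "pareto_symbol a w \<le> 1" unfolding sym by simp
qed

lemma char_pareto_law:
  assumes a: "1 < a" "a < 2" and w: "0 \<le> w"
  shows "char (pareto_law a) w = of_real (pareto_symbol a w)"
proof -
  interpret real_distribution "pareto_law a" using a by (intro real_distribution_pareto_law) simp
  show ?thesis
  proof (cases "w = 0")
    case True
    then show ?thesis using char_zero by (simp add: pareto_symbol_def)
  next
    case False
    have i: "integrable (pareto_law a) (\<lambda>x. cos (w * x))" by (rule integrable_const_bound[of _ 1]) auto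
    have "ennreal (\<integral>x. 1 - cos (w * x) \<partial>pareto_law a) = (\<integral>\<^sup>+x. ennreal (1 - cos (w * x)) \<partial>pareto_law a)"
      using i by (intro nn_integral_eq_integral[symmetric]) auto
    also have "\<dots> = ennreal (1 - pareto_symbol a w)"
      using a w False by (intro nn_integral_one_minus_cos_pareto) auto
    finally have "(\<integral>x. 1 - cos (w * x) \<partial>pareto_law a) = 1 - pareto_symbol a w"
      using a w False pareto_symbol_le_1[of a w] by (subst (asm) ennreal_inj) (auto intro!: integral_nonneg_AE)
    then have c: "(\<integral>x. cos (w * x) \<partial>pareto_law a) = pareto_symbol a w"
      using i prob_space by (simp del: space_eq_univ)
    \<comment> \<open>Reflection preserves the density, so the sine integral equals its own
      negative; the characteristic function is real.\<close>
    have "(\<integral>x. sin (w * x) \<partial>pareto_law a) = (\<integral>x. pareto_density a x * sin (w * x) \<partial>lborel)"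
      unfolding pareto_law_def using pareto_density_nonneg[of a] a by (subst integral_density) auto
    also have "\<dots> = \<bar>- 1\<bar> *\<^sub>R (\<integral>x. pareto_density a (0 + (- 1) * x) * sin (w * (0 + (- 1) * x)) \<partial>lborel)"
      by (intro lborel_integral_real_affine) auto
    also have "\<dots> = - (\<integral>x. pareto_density a x * sin (w * x) \<partial>lborel)" by simp
    also have "(\<integral>x. pareto_density a x * sin (w * x) \<partial>lborel) = (\<integral>x. sin (w * x) \<partial>pareto_law a)"
      unfolding pareto_law_def using pareto_density_nonneg[of a] a by (subst integral_density) auto
    finally have s: "(\<integral>x. sin (w * x) \<partial>pareto_law a) = 0" by simp
    have "integrable (pareto_law a) (\<lambda>x. iexp (w * x))" by (rule integrable_iexp) auto
    then have "Re (char (pareto_law a) w) = pareto_symbol a w" "Im (char (pareto_law a) w) = 0"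
      unfolding char_def by (simp_all flip: integral_Re integral_Im add: Re_exp Im_exp c s)
    then show ?thesis by (simp add: complex_eq_iff)
  qed
qed

section \<open>From characteristic functions to Lipschitz test functions\<close>

text \<open>\<open>k x y\<close> is the signed indicator of the interval between 0 and x, so the
  inner integral is the primitive of g at x. Exchanging the integrals converts the mean of a
  primitive into an integral of g against signed tails of \<open>\<mu>\<close>; this is legitimate
  because the norm of \<open>k x\<close> in L1 is \<bar>x\<bar>.\<close>

lemma integral_signed_tail:
  fixes g :: "real \<Rightarrow> real"
  assumes mu: "real_distribution \<mu>" and int: "integrable \<mu> (\<lambda>x. x)"
    and [measurable]: "g \<in> borel_measurable borel" and g: "\<And>y. \<bar>g y\<bar> \<le> 1"
  defines "k \<equiv> \<lambda>x y. indicator {0<..<x} y - indicator {x<..<0} y :: real"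
  shows "integrable lborel (\<lambda>y. g y * (\<integral>x. k x y \<partial>\<mu>))"
    and "(\<integral>x. (\<integral>y. g y * k x y \<partial>lborel) \<partial>\<mu>) = (\<integral>y. g y * (\<integral>x. k x y \<partial>\<mu>) \<partial>lborel)"
    and "integrable \<mu> (\<lambda>x. \<integral>y. g y * k x y \<partial>lborel)"
proof -
  interpret real_distribution \<mu> by (rule mu)
  interpret P: pair_sigma_finite \<mu> lborel ..
  have k_eq: "k x y = (if 0 < y \<and> y < x then 1 else 0) - (if x < y \<and> y < 0 then 1 else 0)" for x y
    by (auto simp: k_def indicator_def)
  have [measurable]: "(\<lambda>(x, y). k x y) \<in> borel_measurable (\<mu> \<Otimes>\<^sub>M lborel)"
    unfolding k_eq by measurable
  have abs_k: "\<bar>k x y\<bar> = indicator {0<..<x} y + indicator {x<..<0} y" for x y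
    by (auto simp: k_def indicator_def)
  have ik: "integrable lborel (\<lambda>y. k x y)" for x
    unfolding k_def by (intro Bochner_Integration.integrable_diff integrable_real_indicator)
      (auto intro!: emeasure_bounded_finite[unfolded infinity_ennreal_def])
  have norm_k: "(\<integral>y. norm (k x y) \<partial>lborel) = \<bar>x\<bar>" for x
  proof (cases "0 \<le> x")
    case True
    then have "{x<..<0} = {}" by auto
    then show ?thesis unfolding real_norm_def abs_k using True by simp
  next
    case False
    then have "{0<..<x} = {}" by auto
    then show ?thesis unfolding real_norm_def abs_k using False by simp
  qed
  have "integrable (\<mu> \<Otimes>\<^sub>M lborel) (\<lambda>(x, y). k x y)"
  proof (rule P.Fubini_integrable)
    show "integrable \<mu> (\<lambda>x. \<integral>y. norm (case (x, y) of (x, y) \<Rightarrow> k x y) \<partial>lborel)"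
      unfolding prod.case norm_k using int by (rule integrable_abs)
  qed (use ik in simp_all)
  then have I: "integrable (\<mu> \<Otimes>\<^sub>M lborel) (\<lambda>(x, y). g y * k x y)"
  proof (rule Bochner_Integration.integrable_bound)
    show "AE p in \<mu> \<Otimes>\<^sub>M lborel. norm (case p of (x, y) \<Rightarrow> g y * k x y) \<le> norm (case p of (x, y) \<Rightarrow> k x y)"
      by (intro AE_I2) (auto simp: abs_mult split: prod.splits intro!: mult_left_le_one_le g)
  qed measurable
  from P.integrable_snd[OF I] show "integrable lborel (\<lambda>y. g y * (\<integral>x. k x y \<partial>\<mu>))" by simp
  from P.integrable_fst[OF I] show "integrable \<mu> (\<lambda>x. \<integral>y. g y * k x y \<partial>lborel)" .
  from P.Fubini_integral[OF I] show "(\<integral>x. (\<integral>y. g y * k x y \<partial>lborel) \<partial>\<mu>) = (\<integral>y. g y * (\<integral>x. k x y \<partial>\<mu>) \<partial>lborel)"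
    by simp
qed

lemma lipschitz_integrable:
  fixes h :: "real \<Rightarrow> real"
  assumes mu: "real_distribution \<mu>" and int: "integrable \<mu> (\<lambda>x. x)"
    and h: "C-lipschitz_on UNIV h"
  shows "integrable \<mu> h"
proof -
  interpret real_distribution \<mu> by (rule mu)
  have [measurable]: "h \<in> borel_measurable borel"
    using lipschitz_on_continuous_on[OF h] by (intro borel_measurable_continuous_onI)
  have "integrable \<mu> (\<lambda>x. \<bar>h 0\<bar> + C * \<bar>x\<bar>)" using int by auto
  then show ?thesis
  proof (rule Bochner_Integration.integrable_bound)
    show "AE x in \<mu>. norm (h x) \<le> norm (\<bar>h 0\<bar> + C * \<bar>x\<bar>)"
    proof (rule AE_I2)
      fix x
      have "\<bar>h x - h 0\<bar> \<le> C * \<bar>x\<bar>"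
        using lipschitz_onD[OF h, of x 0] by (simp add: dist_real_def)
      then show "norm (h x) \<le> norm (\<bar>h 0\<bar> + C * \<bar>x\<bar>)" by simp
    qed
  qed simp
qed

text \<open>A Lipschitz function is within \<open>\<epsilon>\<close> of its moving average, whose derivative is a
  difference quotient; so no almost everywhere differentiability is needed.\<close>

lemma lipschitz_integral_diff_le_cdf:
  fixes h f :: "real \<Rightarrow> real"
  assumes mu1: "real_distribution \<mu>1" "integrable \<mu>1 (\<lambda>x. x)"
    and mu2: "real_distribution \<mu>2" "integrable \<mu>2 (\<lambda>x. x)"
    and h: "1-lipschitz_on UNIV h"
    and f: "integrable lborel f" and cdf: "AE y in lborel. cdf \<mu>1 y - cdf \<mu>2 y = f y"
  shows "\<bar>(\<integral>x. h x \<partial>\<mu>1) - (\<integral>x. h x \<partial>\<mu>2)\<bar> \<le> (\<integral>y. \<bar>f y\<bar> \<partial>lborel)"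
proof (rule field_le_epsilon)
  interpret M1: real_distribution \<mu>1 by (rule mu1)
  interpret M2: real_distribution \<mu>2 by (rule mu2)
  fix e :: real assume e: "0 < e"
  define \<epsilon> where "\<epsilon> = e / 4"
  have eps: "0 < \<epsilon>" using e by (simp add: \<epsilon>_def)
  have cont: "continuous_on UNIV h" using h by (rule lipschitz_on_continuous_on)
  have hl: "\<bar>h x - h y\<bar> \<le> \<bar>x - y\<bar>" for x y
    using lipschitz_onD[OF h, of x y] by (simp add: dist_real_def)
  obtain P where P: "\<And>x. (P has_real_derivative h x) (at x)"
  proof -
    have "\<exists>F. \<forall>x. (-\<infinity>::ereal) < ereal x \<longrightarrow> ereal x < \<infinity> \<longrightarrow> (F has_vector_derivative h x) (at x)"
      using cont by (intro einterval_antiderivative) (auto simp: continuous_on_eq_continuous_at)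
    then show ?thesis using that by (auto simp: has_real_derivative_iff_has_vector_derivative)
  qed
  define g where "g y = (h (y + \<epsilon>) - h y) / \<epsilon>" for y
  define G where "G x = (P (x + \<epsilon>) - P x) / \<epsilon>" for x
  have g1: "\<bar>g y\<bar> \<le> 1" for y using hl[of "y + \<epsilon>" y] eps by (simp add: g_def)
  have [measurable]: "h \<in> borel_measurable borel" using cont by (rule borel_measurable_continuous_onI)
  have gm [measurable]: "g \<in> borel_measurable borel" unfolding g_def by measurable
  have gcont: "continuous_on A g" for A
    unfolding g_def using eps by (intro continuous_intros continuous_on_subset[OF cont] continuous_on_compose2[OF cont]) auto
  have dG: "(G has_real_derivative g x) (at x)" for x
  proof -
    have "((\<lambda>x. P (x + \<epsilon>)) has_real_derivative h (x + \<epsilon>)) (at x)"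
      using P[of "x + \<epsilon>"] by (simp add: DERIV_shift)
    then show ?thesis unfolding G_def g_def by (intro DERIV_cdivide DERIV_diff P)
  qed
  define k :: "real \<Rightarrow> real \<Rightarrow> real" where "k = (\<lambda>x y. indicator {0<..<x} y - indicator {x<..<0} y)"
  define H where "H x = (\<integral>y. g y * k x y \<partial>lborel)" for x
  have H: "H x = G x - G 0" for x
  proof -
    have "(LBINT y=ereal 0..ereal x. g y) = G x - G 0"
      using dG gcont by (intro interval_integral_FTC_finite) (auto simp: has_real_derivative_iff_has_vector_derivative[symmetric] intro: has_field_derivative_at_within)
    moreover have "(LBINT y=ereal 0..ereal x. g y) = H x"
    proof (cases "0 \<le> x")
      case True
      then have "{x<..<0} = {}" by auto
      with True show ?thesis
        by (auto simp: interval_lebesgue_integral_def H_def k_def set_lebesgue_integral_def einterval_eq mult.commute)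
    next
      case False
      then have "{0<..<x} = {}" by auto
      with False show ?thesis
        by (auto simp: interval_lebesgue_integral_def H_def k_def set_lebesgue_integral_def einterval_eq mult.commute)
    qed
    ultimately show ?thesis by simp
  qed
  have Gh: "\<bar>G x - h x\<bar> \<le> \<epsilon>" for x
  proof -
    obtain z where "x < z" "z < x + \<epsilon>" "P (x + \<epsilon>) - P x = (x + \<epsilon> - x) * h z"
      using MVT2[of x "x + \<epsilon>" P h] P eps by auto
    then have "G x = h z" "\<bar>z - x\<bar> \<le> \<epsilon>" using eps by (auto simp: G_def)
    then show ?thesis using hl[of z x] by simp
  qed
  have dH: "\<bar>(\<integral>x. H x \<partial>\<mu>) - ((\<integral>x. h x \<partial>\<mu>) - G 0)\<bar> \<le> \<epsilon>"
    if mu: "real_distribution \<mu>" "integrable \<mu> (\<lambda>x. x)" for \<mu>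
  proof -
    interpret real_distribution \<mu> by (rule mu)
    have iH: "integrable \<mu> H" using integral_signed_tail(3)[OF mu gm g1] unfolding H_def[abs_def] k_def .
    have ih: "integrable \<mu> h" using mu h by (rule lipschitz_integrable)
    have "(\<integral>x. H x \<partial>\<mu>) - ((\<integral>x. h x \<partial>\<mu>) - G 0) = (\<integral>x. H x - (h x - G 0) \<partial>\<mu>)"
      using iH ih prob_space by (simp del: space_eq_univ)
    also have "\<bar>\<dots>\<bar> \<le> (\<integral>x. \<bar>H x - (h x - G 0)\<bar> \<partial>\<mu>)" by (rule integral_abs_bound)
    also have "\<dots> \<le> (\<integral>x. \<epsilon> \<partial>\<mu>)" 
    proof (rule integral_mono)
      show "integrable \<mu> (\<lambda>x. \<bar>H x - (h x - G 0)\<bar>)"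
        using iH ih by (intro integrable_abs Bochner_Integration.integrable_diff) auto
    qed (use Gh in \<open>auto simp: H\<close>)
    finally show ?thesis using prob_space by simp
  qed
  \<comment> \<open>Away from 0 and from the atoms, the signed tail is a fixed step function minus
    the distribution function. The step function cancels between the two laws, leaving minus the
    difference of the distribution functions.\<close>
  have tail: "(\<integral>x. k x y \<partial>\<mu>) = indicator {0<..} y - cdf \<mu> y"
    if mu: "real_distribution \<mu>" and y: "y \<noteq> 0" "measure \<mu> {y} = 0" for \<mu> y
  proof -
    interpret real_distribution \<mu> by (rule mu)
    have "k x y = (if 0 < y then indicator {y<..} x else - indicator {..<y} x)" for x
      using y by (auto simp: k_def indicator_def)
    then have "(\<integral>x. k x y \<partial>\<mu>) = (if 0 < y then prob {y<..} else - prob {..<y})" by simp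
    moreover have "prob {y<..} = 1 - cdf \<mu> y"
    proof -
      have "{y<..} = UNIV - {..y}" by auto
      then show ?thesis using prob_compl[of "{..y}"] by (simp add: cdf_def)
    qed
    moreover have "cdf \<mu> y = prob {..<y}"
    proof -
      have "{..y} = {..<y} \<union> {y}" by auto
      then have "prob {..y} = prob {..<y} + prob {y}" using finite_measure_Union[of "{..<y}" "{y}"] by simp
      then show ?thesis using y by (simp add: cdf_def)
    qed
    ultimately show ?thesis using y by auto
  qed
  have "countable ({y. measure \<mu>1 {y} \<noteq> 0} \<union> {y. measure \<mu>2 {y} \<noteq> 0} \<union> {0})"
    using M1.countable_support M2.countable_support by simp
  then have "AE y in lborel. y \<notin> {y. measure \<mu>1 {y} \<noteq> 0} \<union> {y. measure \<mu>2 {y} \<noteq> 0} \<union> {0}"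
    by (intro AE_not_in countable_imp_null_set_lborel)
  then have ae: "AE y in lborel. g y * (\<integral>x. k x y \<partial>\<mu>1) - g y * (\<integral>x. k x y \<partial>\<mu>2) = - (g y * f y)"
    using cdf
  proof eventually_elim
    case (elim y)
    then have "(\<integral>x. k x y \<partial>\<mu>1) - (\<integral>x. k x y \<partial>\<mu>2) = - f y"
      using tail[OF mu1(1), of y] tail[OF mu2(1), of y] by simp
    then show ?case by (simp add: right_diff_distrib[symmetric])
  qed
  have [measurable]: "f \<in> borel_measurable borel" using f by simp
  have igf: "integrable lborel (\<lambda>y. g y * f y)"
    by (rule Bochner_Integration.integrable_bound[OF f]) (auto simp: abs_mult intro!: mult_left_le_one_le g1)
  have "(\<integral>x. H x \<partial>\<mu>1) - (\<integral>x. H x \<partial>\<mu>2) = (\<integral>y. g y * (\<integral>x. k x y \<partial>\<mu>1) - g y * (\<integral>x. k x y \<partial>\<mu>2) \<partial>lborel)"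
    unfolding H_def[abs_def] k_def
    using integral_signed_tail(1)[OF mu1 gm g1] integral_signed_tail(1)[OF mu2 gm g1]
    by (simp add: integral_signed_tail(2)[OF mu1 gm g1] integral_signed_tail(2)[OF mu2 gm g1])
  also have "\<dots> = (\<integral>y. - (g y * f y) \<partial>lborel)"
  proof (rule integral_cong_AE[OF _ _ ae])
    show "(\<lambda>y. g y * (\<integral>x. k x y \<partial>\<mu>1) - g y * (\<integral>x. k x y \<partial>\<mu>2)) \<in> borel_measurable lborel"
      unfolding k_def
      using integral_signed_tail(1)[OF mu1 gm g1] integral_signed_tail(1)[OF mu2 gm g1]
      by (intro borel_measurable_diff borel_measurable_integrable)
  qed simp
  also have "\<bar>\<dots>\<bar> \<le> (\<integral>y. \<bar>- (g y * f y)\<bar> \<partial>lborel)" by (rule integral_abs_bound)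
  also have "\<dots> \<le> (\<integral>y. \<bar>f y\<bar> \<partial>lborel)"
  proof (rule integral_mono)
    show "integrable lborel (\<lambda>y. \<bar>- (g y * f y)\<bar>)" using igf by simp
    show "\<bar>- (g y * f y)\<bar> \<le> \<bar>f y\<bar>" for y by (simp add: abs_mult mult_left_le_one_le g1)
  qed (use f in simp)
  finally have "\<bar>(\<integral>x. H x \<partial>\<mu>1) - (\<integral>x. H x \<partial>\<mu>2)\<bar> \<le> (\<integral>y. \<bar>f y\<bar> \<partial>lborel)" .
  with dH[OF mu1] dH[OF mu2] have "\<bar>(\<integral>x. h x \<partial>\<mu>1) - (\<integral>x. h x \<partial>\<mu>2)\<bar> \<le> (\<integral>y. \<bar>f y\<bar> \<partial>lborel) + 2 * \<epsilon>"
    by linarith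
  then show "\<bar>(\<integral>x. h x \<partial>\<mu>1) - (\<integral>x. h x \<partial>\<mu>2)\<bar> \<le> (\<integral>y. \<bar>f y\<bar> \<partial>lborel) + e"
    using e by (simp add: \<epsilon>_def)
qed

lemma set_integrable_bounded_mult:
  fixes g f :: "real \<Rightarrow> real"
  assumes "set_integrable lborel A f" "g \<in> borel_measurable borel" "\<And>x. \<bar>g x\<bar> \<le> 1"
  shows "set_integrable lborel A (\<lambda>x. g x * f x)"
  unfolding set_integrable_def
proof (rule Bochner_Integration.integrable_bound[OF assms(1)[unfolded set_integrable_def]])
  have "(\<lambda>x. g x * (indicator A x *\<^sub>R f x)) \<in> borel_measurable lborel"
    using assms by (intro borel_measurable_times) (auto simp: set_integrable_def)
  then show "(\<lambda>x. indicator A x *\<^sub>R (g x * f x)) \<in> borel_measurable lborel" by (simp add: mult_ac)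
  show "AE x in lborel. norm (indicator A x *\<^sub>R (g x * f x)) \<le> norm (indicator A x *\<^sub>R f x)"
    using assms(3) by (auto simp: abs_mult indicator_def intro!: mult_left_le_one_le)
qed

lemma set_integral_bounded_mult_le:
  fixes g f :: "real \<Rightarrow> real"
  assumes "set_integrable lborel A f" "g \<in> borel_measurable borel" "\<And>x. \<bar>g x\<bar> \<le> 1"
  shows "\<bar>LBINT x:A. g x * f x\<bar> \<le> (LBINT x:A. \<bar>f x\<bar>)"
proof -
  have "\<bar>LBINT x:A. g x * f x\<bar> \<le> (\<integral>x. \<bar>indicator A x *\<^sub>R (g x * f x)\<bar> \<partial>lborel)"
    unfolding set_lebesgue_integral_def by (rule integral_abs_bound)
  also have "\<dots> \<le> (\<integral>x. \<bar>indicator A x *\<^sub>R f x\<bar> \<partial>lborel)"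
  proof (rule integral_mono)
    show "integrable lborel (\<lambda>x. \<bar>indicator A x *\<^sub>R (g x * f x)\<bar>)"
      using set_integrable_bounded_mult[OF assms] unfolding set_integrable_def by (rule integrable_abs)
    show "integrable lborel (\<lambda>x. \<bar>indicator A x *\<^sub>R f x\<bar>)"
      using assms(1) unfolding set_integrable_def by (rule integrable_abs)
  qed (use assms(3) in \<open>auto simp: abs_mult indicator_def intro!: mult_left_le_one_le\<close>)
  also have "\<dots> = (LBINT x:A. \<bar>f x\<bar>)"
    unfolding set_lebesgue_integral_def by (intro Bochner_Integration.integral_cong) (auto simp: indicator_def)
  finally show ?thesis .
qed

lemma inverse_quadratic_integral:
  "integrable lborel (\<lambda>x::real. 1 / (1 + x\<^sup>2))" "(\<integral>x. 1 / (1 + (x::real)\<^sup>2) \<partial>lborel) \<le> pi"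
proof -
  have "(\<integral>\<^sup>+x. ennreal (1 / (1 + (x::real)\<^sup>2)) * indicator {0..} x \<partial>lborel) = ennreal (pi / 2 - arctan 0)"
  proof (rule nn_integral_FTC_atLeast)
    fix x :: real
    show "(arctan has_real_derivative 1 / (1 + x\<^sup>2)) (at x)"
      by (auto intro!: derivative_eq_intros simp: inverse_eq_divide)
  qed (auto intro: tendsto_arctan_at_top)
  then have "(\<integral>\<^sup>+x. ennreal (1 / (1 + (x::real)\<^sup>2)) \<partial>lborel) = 2 * ennreal (pi / 2)"
    by (subst nn_integral_even) auto
  also have "2 * ennreal (pi / 2) = ennreal (2 * (pi / 2))" by (subst ennreal_mult) auto
  finally have "has_bochner_integral lborel (\<lambda>x::real. 1 / (1 + x\<^sup>2)) (2 * (pi / 2))"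
    by (intro has_bochner_integral_nn_integral) auto
  then show "integrable lborel (\<lambda>x::real. 1 / (1 + x\<^sup>2))" "(\<integral>x. 1 / (1 + (x::real)\<^sup>2) \<partial>lborel) \<le> pi"
    by (simp_all add: has_bochner_integral_iff)
qed

section \<open>Sine transforms of kernels with two integrable derivatives\<close>

text \<open>K stands for a real difference of characteristic functions divided by u. The conditions
  are those of two integrations by parts on the half-line: K and \<open>K''\<close> integrable, with
  vanishing boundary terms. At 0 only \<open>u * K' u\<close> has to vanish since the sine supplies
  the factor u, and \<open>K''\<close> may be singular there. N bounds both L1 norms.\<close>

locale sine_kernel =
  fixes K K' K'' :: "real \<Rightarrow> real" and N :: real
  assumes DK: "\<And>u. 0 < u \<Longrightarrow> (K has_real_derivative K' u) (at u)"
    and DK': "\<And>u. 0 < u \<Longrightarrow> (K' has_real_derivative K'' u) (at u)"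
    and contK'': "\<And>u. 0 < u \<Longrightarrow> isCont K'' u"
    and intK: "set_integrable lborel {0<..} K" and intK'': "set_integrable lborel {0<..} K''"
    and limK0: "(K \<longlongrightarrow> 0) (at_right 0)" and limK'0: "((\<lambda>u. u * K' u) \<longlongrightarrow> 0) (at_right 0)"
    and limK: "(K \<longlongrightarrow> 0) at_top" and limK': "(K' \<longlongrightarrow> 0) at_top"
    and normK: "(LBINT u:{0<..}. \<bar>K u\<bar>) \<le> N" and normK'': "(LBINT u:{0<..}. \<bar>K'' u\<bar>) \<le> N"
begin

text \<open>Levy inversion folded onto the half-line; for two laws it is the difference of their
  distribution functions.\<close>

definition sine_transform :: "real \<Rightarrow> real" where
  "sine_transform x = (LBINT u:{0<..}. sin (u * x) * K u) / pi"

lemma sine_transform_bound: "\<bar>sine_transform x\<bar> \<le> N / pi"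
proof -
  have "\<bar>LBINT u:{0<..}. sin (u * x) * K u\<bar> \<le> N"
    using set_integral_bounded_mult_le[OF intK, of "\<lambda>u. sin (u * x)"] normK by simp
  then show ?thesis by (simp add: sine_transform_def divide_right_mono)
qed

lemma sine_transform_decay: "\<bar>sine_transform x\<bar> * x\<^sup>2 \<le> N / pi"
proof (cases "x = 0")
  case True
  then show ?thesis using sine_transform_bound[of 0] by simp
next
  case x: False
  define q where "q u = sin (u * x) * K u + sin (u * x) * K'' u / x\<^sup>2" for u
  \<comment> \<open>An explicit primitive of q that performs both integrations by parts at once: the
    terms with the cosine and \<open>K'\<close> cancel upon differentiation.\<close>
  define Q where "Q u = - (cos (u * x) * K u / x) + sin (u * x) * K' u / x\<^sup>2" for u
  have i1: "set_integrable lborel {0<..} (\<lambda>u. sin (u * x) * K u)"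
    by (rule set_integrable_bounded_mult[OF intK]) auto
  have i2: "set_integrable lborel {0<..} (\<lambda>u. sin (u * x) * K'' u)"
    by (rule set_integrable_bounded_mult[OF intK'']) auto
  have ei: "einterval 0 \<infinity> = {0<..}" by (auto simp: einterval_def)
  have "(LBINT u=0..\<infinity>. q u) = 0 - 0"
  proof (rule interval_integral_FTC_integrable[where F=Q])
    fix u assume "0 < ereal u"
    then have u: "0 < u" by simp
    have "(Q has_real_derivative q u) (at u)"
      unfolding Q_def q_def using x u
      by (auto intro!: derivative_eq_intros DK DK' simp: field_simps power2_eq_square)
    then show "(Q has_vector_derivative q u) (at u)" by (simp add: has_real_derivative_iff_has_vector_derivative)
    show "isCont q u"
      unfolding q_def using x u by (intro continuous_intros contK'' DERIV_isCont[OF DK]) auto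
  next
    show "set_integrable lborel (einterval 0 \<infinity>) q"
      unfolding ei q_def using i1 i2 by (intro set_integral_add(1) set_integrable_divide) auto
    have c: "((\<lambda>u. cos (u * x) * K u) \<longlongrightarrow> 0) F" if "(K \<longlongrightarrow> 0) F" for F
      by (rule Lim_null_comparison[OF _ tendsto_norm_zero[OF that]]) (auto simp: abs_mult intro!: mult_left_le_one_le always_eventually)
    have s: "((\<lambda>u. sin (u * x) * K' u) \<longlongrightarrow> 0) at_top"
      by (rule Lim_null_comparison[OF _ tendsto_norm_zero[OF limK']]) (auto simp: abs_mult intro!: mult_left_le_one_le always_eventually)
    \<comment> \<open>\<open>K'\<close> itself need not be bounded at 0; \<bar>sin (u x)\<bar> \<le>
      \<bar>u x\<bar> reduces the boundary term to \<open>u * K' u\<close>.\<close>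
    have s0: "((\<lambda>u. sin (u * x) * K' u) \<longlongrightarrow> 0) (at_right 0)"
    proof (rule Lim_null_comparison)
      show "((\<lambda>u. \<bar>x\<bar> * \<bar>u * K' u\<bar>) \<longlongrightarrow> 0) (at_right 0)"
        using tendsto_mult_right_zero[OF tendsto_rabs_zero[OF limK'0]] .
      have "\<bar>sin (u * x)\<bar> \<le> \<bar>u * x\<bar>" for u by (rule abs_sin_x_le_abs_x)
      then show "\<forall>\<^sub>F u in at_right 0. norm (sin (u * x) * K' u) \<le> \<bar>x\<bar> * \<bar>u * K' u\<bar>"
        by (intro always_eventually allI) (simp add: abs_mult mult_right_mono mult.assoc[symmetric] mult.commute[of "\<bar>x\<bar>"])
    qed
    have "(Q \<longlongrightarrow> - (0 / x) + 0 / x\<^sup>2) (at_right 0)"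
      unfolding Q_def using x by (intro tendsto_intros c[OF limK0] s0) auto
    then show "((Q \<circ> real_of_ereal) \<longlongrightarrow> 0) (at_right 0)"
      by (simp add: zero_ereal_def ereal_tendsto_simps)
    have "(Q \<longlongrightarrow> - (0 / x) + 0 / x\<^sup>2) at_top"
      unfolding Q_def using x by (intro tendsto_intros c[OF limK] s) auto
    then show "((Q \<circ> real_of_ereal) \<longlongrightarrow> 0) (at_left \<infinity>)"
      by (simp add: ereal_tendsto_simps)
  qed simp
  then have "(LBINT u:{0<..}. q u) = 0"
    by (simp add: interval_lebesgue_integral_def ei)
  moreover have "(LBINT u:{0<..}. q u) = (LBINT u:{0<..}. sin (u * x) * K u) + (LBINT u:{0<..}. sin (u * x) * K'' u) / x\<^sup>2"
    unfolding q_def using i1 i2 by (subst set_integral_add(2)) (auto intro!: set_integrable_divide)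
  ultimately have "pi * sine_transform x * x\<^sup>2 = - (LBINT u:{0<..}. sin (u * x) * K'' u)"
    using x by (simp add: sine_transform_def field_simps)
  then have "pi * (\<bar>sine_transform x\<bar> * x\<^sup>2) = \<bar>LBINT u:{0<..}. sin (u * x) * K'' u\<bar>"
    by (metis abs_minus_cancel abs_mult abs_of_nonneg mult.assoc pi_ge_zero zero_le_power2)
  also have "\<dots> \<le> N"
    using set_integral_bounded_mult_le[OF intK'', of "\<lambda>u. sin (u * x)"] normK'' by simp
  finally show ?thesis by (simp add: field_simps)
qed

lemma N_nonneg: "0 \<le> N"
  using sine_transform_bound[of 0] by (simp add: sine_transform_def pos_le_divide_eq)

lemma sine_transform_measurable [measurable]: "sine_transform \<in> borel_measurable borel"
proof -
  have [measurable]: "(\<lambda>u. indicator {0<..} u *\<^sub>R K u) \<in> borel_measurable borel"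
    using intK by (simp add: set_integrable_def)
  have "(\<lambda>x. \<integral>u. sin (u * x) * (indicator {0<..} u *\<^sub>R K u) \<partial>lborel) \<in> borel_measurable borel" by measurable
  then show ?thesis
    unfolding sine_transform_def set_lebesgue_integral_def by (simp add: mult_ac)
qed

text \<open>Adding the uniform bound and the quadratic decay gives the majorant
  \<open>2 * N / pi * (1 / (1 + x\<^sup>2))\<close>, and the integral of
  \<open>1 / (1 + x\<^sup>2)\<close> over the line is at most \<open>pi\<close>.\<close>

lemma
  shows sine_transform_integrable: "integrable lborel sine_transform"
    and sine_transform_L1: "(\<integral>x. \<bar>sine_transform x\<bar> \<partial>lborel) \<le> 2 * N"
proof -
  have b: "\<bar>sine_transform x\<bar> \<le> 2 * N / pi * (1 / (1 + x\<^sup>2))" for x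
  proof -
    have "\<bar>sine_transform x\<bar> * (1 + x\<^sup>2) \<le> 2 * N / pi"
      using sine_transform_bound[of x] sine_transform_decay[of x] by (simp add: distrib_left add_divide_distrib)
    moreover have "0 < 1 + x\<^sup>2" by (simp add: add_pos_nonneg)
    ultimately have "\<bar>sine_transform x\<bar> \<le> 2 * N / pi / (1 + x\<^sup>2)" by (simp only: pos_le_divide_eq)
    then show ?thesis by simp
  qed
  show i: "integrable lborel sine_transform"
  proof (rule Bochner_Integration.integrable_bound)
    show "integrable lborel (\<lambda>x. 2 * N / pi * (1 / (1 + x\<^sup>2)))"
      using inverse_quadratic_integral(1) by (rule integrable_mult_right)
    show "AE x in lborel. norm (sine_transform x) \<le> norm (2 * N / pi * (1 / (1 + x\<^sup>2)))"
      unfolding real_norm_def by (rule AE_I2, rule order_trans[OF b abs_ge_self])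
  qed simp
  have "(\<integral>x. \<bar>sine_transform x\<bar> \<partial>lborel) \<le> (\<integral>x. 2 * N / pi * (1 / (1 + x\<^sup>2)) \<partial>lborel)"
    by (rule integral_mono[OF integrable_abs[OF i] integrable_mult_right[OF inverse_quadratic_integral(1)] b])
  also have "\<dots> = 2 * N / pi * (\<integral>x. 1 / (1 + x\<^sup>2) \<partial>lborel)" by (rule integral_mult_right_zero)
  also have "\<dots> \<le> 2 * N / pi * pi"
    using inverse_quadratic_integral(2) N_nonneg by (intro mult_left_mono) auto
  finally show "(\<integral>x. \<bar>sine_transform x\<bar> \<partial>lborel) \<le> 2 * N" by simp
qed

text \<open>Inversion gives only differences between two points; this limit fixes the additive
  constant.\<close>

lemma sine_transform_at_bot: "(sine_transform \<longlongrightarrow> 0) at_bot"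
proof (rule Lim_null_comparison)
  have "((\<lambda>x::real. N / pi * (1 / x) ^ 2) \<longlongrightarrow> N / pi * 0 ^ 2) at_bot"
    by (intro tendsto_intros tendsto_divide_0[OF tendsto_const] filterlim_at_bot_imp_at_infinity filterlim_ident)
  then show "((\<lambda>x::real. N / pi * (1 / x) ^ 2) \<longlongrightarrow> 0) at_bot" by simp
  have "eventually (\<lambda>x::real. x \<le> - 1) at_bot" by (rule eventually_le_at_bot)
  then show "\<forall>\<^sub>F x in at_bot. norm (sine_transform x) \<le> N / pi * (1 / x) ^ 2"
  proof eventually_elim
    case (elim x)
    then have "0 < x\<^sup>2" by simp
    then show ?case using sine_transform_decay[of x] by (simp add: power_divide pos_le_divide_eq del: divide_divide_eq_left)
  qed
qed

end

context sine_kernel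
begin

text \<open>The even extension to the whole line, where the symmetric truncated integrals of Levy
  inversion live.\<close>

lemma integrable_even_kernel:
  "integrable lborel (\<lambda>t. sin (\<bar>t\<bar> * b) * K \<bar>t\<bar>)" (is ?I)
  "(\<integral>t. sin (\<bar>t\<bar> * b) * K \<bar>t\<bar> \<partial>lborel) = 2 * pi * sine_transform b" (is ?E)
proof -
  define p where "p u = indicator {0<..} u *\<^sub>R (sin (u * b) * K u)" for u
  have p: "integrable lborel p"
    using set_integrable_bounded_mult[OF intK, of "\<lambda>u. sin (u * b)"] unfolding set_integrable_def p_def by simp
  have pm: "integrable lborel (\<lambda>u. p (0 + (- 1) * u))"
    using p by (subst lborel_integrable_real_affine_iff) auto
  have eq: "sin (\<bar>t\<bar> * b) * K \<bar>t\<bar> = p t + p (0 + (- 1) * t)" for t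
    by (cases t "0::real" rule: linorder_cases) (auto simp: p_def)
  show ?I unfolding eq using p pm by (rule Bochner_Integration.integrable_add)
  have "(\<integral>t. p t \<partial>lborel) = \<bar>- 1\<bar> *\<^sub>R (\<integral>t. p (0 + (- 1) * t) \<partial>lborel)"
    by (rule lborel_integral_real_affine) simp
  moreover have "(\<integral>t. sin (\<bar>t\<bar> * b) * K \<bar>t\<bar> \<partial>lborel) = (\<integral>t. p t \<partial>lborel) + (\<integral>t. p (0 + (- 1) * t) \<partial>lborel)"
    unfolding eq using p pm by (rule Bochner_Integration.integral_add)
  moreover have "(\<integral>t. p t \<partial>lborel) = pi * sine_transform b"
    by (simp add: sine_transform_def p_def set_lebesgue_integral_def)
  ultimately show ?E by simp
qed

end

section \<open>Levy inversion for the difference of two laws\<close>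

text \<open>The kernel of Levy's inversion formula for the mass of (a, b]. At t = 0 division yields
  the value 0 instead of the limit b - a, on a null set.\<close>

definition inversion_kernel :: "real \<Rightarrow> real \<Rightarrow> real \<Rightarrow> complex" where
  "inversion_kernel a b t = (iexp (- (t * a)) - iexp (- (t * b))) / (\<i> * t)"

lemma inversion_kernel_measurable [measurable]: "inversion_kernel a b \<in> borel_measurable borel"
  unfolding inversion_kernel_def by measurable

lemma cmod_inversion_kernel_le:
  assumes "a \<le> b" shows "cmod (inversion_kernel a b t) \<le> b - a"
proof (cases "t = 0")
  case False
  then show ?thesis
    using Levy_Inversion_aux2[of "- b" "- a" t] assms by (simp add: inversion_kernel_def)
qed (use assms in \<open>simp add: inversion_kernel_def\<close>)

lemma Re_inversion_kernel: "Re (inversion_kernel a b t) = (sin (t * b) - sin (t * a)) / t"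
proof -
  have "inversion_kernel a b t = (- \<i> * (iexp (- (t * a)) - iexp (- (t * b)))) / t"
    by (simp add: inversion_kernel_def divide_simps)
  also have "Re \<dots> = (sin (t * b) - sin (t * a)) / t"
    by (simp add: Re_exp Im_exp diff_divide_distrib)
  finally show ?thesis .
qed

lemma char_uminus:
  assumes "real_distribution \<mu>" shows "char \<mu> (- t) = cnj (char \<mu> t)"
proof -
  have "char \<mu> (- t) = (\<integral>x. cnj (iexp (t * x)) \<partial>\<mu>)"
    unfolding char_def by (intro Bochner_Integration.integral_cong) (auto simp: exp_cnj)
  then show ?thesis by (simp add: char_def)
qed

text \<open>A relation on the positive half-line suffices: conjugate symmetry of characteristic
  functions extends it to all arguments, and the difference is real and even.\<close>

locale sine_kernel_laws = sine_kernel +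
  fixes \<mu>1 \<mu>2 :: "real measure"
  assumes mu1: "real_distribution \<mu>1" and mu2: "real_distribution \<mu>2"
    and char_diff: "\<And>u. 0 < u \<Longrightarrow> char \<mu>1 u - char \<mu>2 u = of_real (u * K u)"
begin

lemma char_diff_abs: "char \<mu>1 t - char \<mu>2 t = of_real (\<bar>t\<bar> * K \<bar>t\<bar>)"
proof (cases t "0::real" rule: linorder_cases)
  case less
  have "char \<mu>1 t - char \<mu>2 t = cnj (char \<mu>1 (- t) - char \<mu>2 (- t))"
    using char_uminus[OF mu1, of "- t"] char_uminus[OF mu2, of "- t"] by simp
  then show ?thesis using less char_diff[of "- t"] by simp
next
  case equal
  then show ?thesis
    using real_distribution.char_zero[OF mu1] real_distribution.char_zero[OF mu2] by simp
qed (simp add: char_diff)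

text \<open>Only the real part of the inversion kernel survives, as the integral over \<open>[-T, T]\<close> is real.\<close>

lemma inversion_difference:
  assumes ab: "a \<le> b"
    and "measure \<mu>1 {a} = 0" "measure \<mu>1 {b} = 0" "measure \<mu>2 {a} = 0" "measure \<mu>2 {b} = 0"
  shows "measure \<mu>1 {a<..b} - measure \<mu>2 {a<..b} = sine_transform b - sine_transform a"
proof -
  interpret M1: real_distribution \<mu>1 by (rule mu1)
  interpret M2: real_distribution \<mu>2 by (rule mu2)
  \<comment> \<open>The real part of the inversion kernel times
    \<open>\<bar>t\<bar> * K \<bar>t\<bar>\<close>: the quotient of \<bar>t\<bar> and t is a sign,
    absorbed by the oddness of the sine.\<close>
  define S where "S t = (sin (\<bar>t\<bar> * b) - sin (\<bar>t\<bar> * a)) * K \<bar>t\<bar>" for t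
  have S: "integrable lborel S" "(\<integral>t. S t \<partial>lborel) = 2 * pi * (sine_transform b - sine_transform a)"
    using integrable_even_kernel[of b] integrable_even_kernel[of a]
    by (auto simp: S_def[abs_def] left_diff_distrib right_diff_distrib)
  have int: "complex_set_integrable lborel {- T..T} (\<lambda>t. inversion_kernel a b t * char \<mu> t)"
    if "real_distribution \<mu>" for \<mu> T
  proof -
    interpret real_distribution \<mu> by fact
    show ?thesis
      unfolding set_integrable_def
    proof (rule integrableI_bounded_set[where A="{- T..T}" and B="(b - a) * 1"])
      show "AE t\<in>{- T..T} in lborel. norm (indicator {- T..T} t *\<^sub>R (inversion_kernel a b t * char \<mu> t)) \<le> (b - a) * 1"
      proof (intro AE_I2 impI)
        fix t assume t: "t \<in> {- T..T}"
        have "norm (inversion_kernel a b t * char \<mu> t) \<le> (b - a) * 1"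
          unfolding norm_mult using ab by (intro mult_mono cmod_inversion_kernel_le cmod_char_le_1) auto
        with t show "norm (indicator {- T..T} t *\<^sub>R (inversion_kernel a b t * char \<mu> t)) \<le> (b - a) * 1"
          by simp
      qed
    qed (auto simp: emeasure_lborel_Icc_eq)
  qed
  have Re: "Re (1 / (2 * pi) * (CLBINT t=-real n..real n. inversion_kernel a b t * char \<mu>1 t))
      - Re (1 / (2 * pi) * (CLBINT t=-real n..real n. inversion_kernel a b t * char \<mu>2 t))
    = 1 / (2 * pi) * (\<integral>t. indicator {- real n..real n} t * S t \<partial>lborel)" for n :: nat
  proof -
    have "(CLBINT t=-real n..real n. inversion_kernel a b t * char \<mu>1 t) - (CLBINT t=-real n..real n. inversion_kernel a b t * char \<mu>2 t)
      = (CLBINT t:{- real n..real n}. inversion_kernel a b t * char \<mu>1 t) - (CLBINT t:{- real n..real n}. inversion_kernel a b t * char \<mu>2 t)"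
      using interval_integral_Icc[of "- real n" "real n" "\<lambda>t. inversion_kernel a b t * char \<mu>1 t"]
        interval_integral_Icc[of "- real n" "real n" "\<lambda>t. inversion_kernel a b t * char \<mu>2 t"] by simp
    also have "\<dots> = (CLBINT t:{- real n..real n}. inversion_kernel a b t * char \<mu>1 t - inversion_kernel a b t * char \<mu>2 t)"
      using int[OF mu1] int[OF mu2] by (intro set_integral_diff(2)[symmetric])
    also have "\<dots> = (CLBINT t:{- real n..real n}. inversion_kernel a b t * (char \<mu>1 t - char \<mu>2 t))"
      by (simp add: right_diff_distrib)
    finally have "Re (CLBINT t=-real n..real n. inversion_kernel a b t * char \<mu>1 t) - Re (CLBINT t=-real n..real n. inversion_kernel a b t * char \<mu>2 t)
      = Re (CLBINT t:{- real n..real n}. inversion_kernel a b t * (char \<mu>1 t - char \<mu>2 t))"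
      by (simp flip: minus_complex.sel)
    also have "\<dots> = (\<integral>t. Re (indicator {- real n..real n} t *\<^sub>R (inversion_kernel a b t * (char \<mu>1 t - char \<mu>2 t))) \<partial>lborel)"
      unfolding set_lebesgue_integral_def
      using set_integral_diff(1)[OF int[OF mu1] int[OF mu2], of "real n"]
      by (intro integral_Re[symmetric]) (simp add: set_integrable_def right_diff_distrib)
    also have "\<dots> = (\<integral>t. indicator {- real n..real n} t * S t \<partial>lborel)"
    proof (rule integral_cong_AE)
      have "AE t in lborel. t \<noteq> (0::real)" by (rule AE_lborel_singleton)
      then show "AE t in lborel. Re (indicator {- real n..real n} t *\<^sub>R (inversion_kernel a b t * (char \<mu>1 t - char \<mu>2 t))) = indicator {- real n..real n} t * S t"
      proof eventually_elim
        case (elim t)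
        then show ?case
          by (cases t "0::real" rule: linorder_cases)
             (auto simp: char_diff_abs S_def Re_inversion_kernel field_simps)
      qed
      show "(\<lambda>t. indicator {- real n..real n} t * S t) \<in> borel_measurable lborel"
        using S(1) by simp
    qed simp
    finally show ?thesis by (simp add: diff_divide_distrib[symmetric])
  qed
  have l1: "(\<lambda>n. 1 / (2 * pi) * (CLBINT t=-real n..real n. inversion_kernel a b t * char \<mu>1 t)) \<longlonglongrightarrow> of_real (measure \<mu>1 {a<..b})"
    using M1.Levy_Inversion[of a b] assms unfolding inversion_kernel_def by simp
  have l2: "(\<lambda>n. 1 / (2 * pi) * (CLBINT t=-real n..real n. inversion_kernel a b t * char \<mu>2 t)) \<longlonglongrightarrow> of_real (measure \<mu>2 {a<..b})"
    using M2.Levy_Inversion[of a b] assms unfolding inversion_kernel_def by simp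
  have "(\<lambda>n. 1 / (2 * pi) * (\<integral>t. indicator {- real n..real n} t * S t \<partial>lborel)) \<longlonglongrightarrow> measure \<mu>1 {a<..b} - measure \<mu>2 {a<..b}"
    using tendsto_diff[OF tendsto_Re[OF l1] tendsto_Re[OF l2]] unfolding Re by simp
  moreover have "(\<lambda>n. 1 / (2 * pi) * (\<integral>t. indicator {- real n..real n} t * S t \<partial>lborel)) \<longlonglongrightarrow> 1 / (2 * pi) * (\<integral>t. S t \<partial>lborel)"
  proof (intro tendsto_mult tendsto_const integral_dominated_convergence)
    show "integrable lborel (\<lambda>t. \<bar>S t\<bar>)" using S by simp
    show "AE t in lborel. (\<lambda>n. indicator {- real n..real n} t * S t) \<longlonglongrightarrow> S t"
    proof (rule AE_I2)
      fix t :: real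
      have "eventually (\<lambda>n. \<bar>t\<bar> \<le> real n) sequentially"
        using filterlim_real_sequentially by (simp add: filterlim_at_top)
      then have "eventually (\<lambda>n. S t = indicator {- real n..real n} t * S t) sequentially"
        by eventually_elim (auto simp: indicator_def)
      then show "(\<lambda>n. indicator {- real n..real n} t * S t) \<longlonglongrightarrow> S t"
        by (rule Lim_transform_eventually[OF tendsto_const])
    qed
  qed (use S(1) in \<open>auto simp: indicator_def intro!: borel_measurable_times borel_measurable_integrable\<close>)
  ultimately have "measure \<mu>1 {a<..b} - measure \<mu>2 {a<..b} = 1 / (2 * pi) * (\<integral>t. S t \<partial>lborel)"
    by (rule LIMSEQ_unique)
  then show ?thesis by (simp add: S(2))
qed

text \<open>Inversion is applied to intervals whose left ends tend to minus infinity while avoiding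
  the countably many atoms; there both the distribution functions and the sine transform vanish in
  the limit.\<close>

lemma cdf_diff_eq: "AE y in lborel. cdf \<mu>1 y - cdf \<mu>2 y = sine_transform y"
proof -
  interpret M1: real_distribution \<mu>1 by (rule mu1)
  interpret M2: real_distribution \<mu>2 by (rule mu2)
  define A where "A = {y. measure \<mu>1 {y} \<noteq> 0} \<union> {y. measure \<mu>2 {y} \<noteq> 0}"
  have cA: "countable A" unfolding A_def using M1.countable_support M2.countable_support by simp
  have "\<exists>x. x \<notin> A \<and> x \<le> - real n" for n
  proof -
    have "\<not> {- real n - 1<..<- real n} \<subseteq> A"
      using cA uncountable_open_interval[of "- real n - 1" "- real n"] countable_subset by auto
    then show ?thesis by (auto intro: less_imp_le)
  qed
  then obtain s where s: "\<And>n. s n \<notin> A" "\<And>n. s n \<le> - real n" by metis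
  have s_bot: "filterlim s at_bot sequentially"
  proof (rule filterlim_at_bot_mono[OF _ always_eventually])
    show "filterlim (\<lambda>n. - real n) at_bot sequentially"
      using filterlim_real_sequentially by (simp add: filterlim_uminus_at_top)
  qed (use s in auto)
  have "cdf \<mu>1 y - cdf \<mu>2 y = sine_transform y" if "y \<notin> A" for y
  proof -
    have "(\<lambda>n. (cdf \<mu>1 (s n) - cdf \<mu>2 (s n)) + (sine_transform y - sine_transform (s n))) \<longlonglongrightarrow> (0 - 0) + (sine_transform y - 0)"
      by (intro tendsto_intros filterlim_compose[OF M1.cdf_lim_at_bot s_bot] filterlim_compose[OF M2.cdf_lim_at_bot s_bot]
          filterlim_compose[OF sine_transform_at_bot s_bot])
    moreover have "eventually (\<lambda>n. (cdf \<mu>1 (s n) - cdf \<mu>2 (s n)) + (sine_transform y - sine_transform (s n)) = cdf \<mu>1 y - cdf \<mu>2 y) sequentially"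
    proof -
      have "eventually (\<lambda>n. s n < y) sequentially"
        using s_bot unfolding filterlim_at_bot_dense by blast
      then show ?thesis
      proof eventually_elim
        case (elim n)
        have "measure \<mu>1 {s n<..y} - measure \<mu>2 {s n<..y} = sine_transform y - sine_transform (s n)"
          using elim s(1)[of n] that by (intro inversion_difference) (auto simp: A_def)
        then show ?case using elim M1.cdf_diff_eq[of "s n" y] M2.cdf_diff_eq[of "s n" y] by simp
      qed
    qed
    ultimately have "(\<lambda>n::nat. cdf \<mu>1 y - cdf \<mu>2 y) \<longlonglongrightarrow> (0 - 0) + (sine_transform y - 0)"
      by (rule Lim_transform_eventually)
    then show ?thesis by (simp add: LIMSEQ_const_iff)
  qed
  moreover have "AE y in lborel. y \<notin> A"
    using cA by (intro AE_not_in countable_imp_null_set_lborel)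
  ultimately show ?thesis by auto
qed

lemma lipschitz_integral_diff_le:
  assumes "integrable \<mu>1 (\<lambda>x. x)" "integrable \<mu>2 (\<lambda>x. x)" "1-lipschitz_on UNIV h"
  shows "\<bar>(\<integral>x. h x \<partial>\<mu>1) - (\<integral>x. h x \<partial>\<mu>2)\<bar> \<le> 2 * N"
  using lipschitz_integral_diff_le_cdf[OF mu1 assms(1) mu2 assms(2,3) sine_transform_integrable cdf_diff_eq]
    sine_transform_L1 by (rule order_trans)

end

section \<open>One step of the scheme\<close>

lemma powr_le_power_one_plus:
  fixes u p :: real
  assumes "0 < u" "0 \<le> p" "p \<le> real n"
  shows "u powr p \<le> (1 + u) ^ n"
proof -
  have "u powr p \<le> (1 + u) powr p" using assms by (intro powr_mono2) auto
  also have "\<dots> \<le> (1 + u) powr real n" using assms by (intro powr_mono) auto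
  also have "\<dots> = (1 + u) ^ n" using assms by (intro powr_realpow) auto
  finally show ?thesis .
qed

lemma power_one_plus_mono: "0 < u \<Longrightarrow> m \<le> n \<Longrightarrow> (1 + u) ^ m \<le> (1 + u :: real) ^ n"
  by (intro power_increasing) auto

lemma exp_remainder_bounds:
  fixes x :: real
  assumes "0 \<le> x"
  shows "0 \<le> exp (- x) - 1 + x" "exp (- x) - 1 + x \<le> x\<^sup>2 / 2" "0 \<le> 1 - exp (- x)" "1 - exp (- x) \<le> x"
proof -
  have A: "0 \<le> exp (- x) - 1 + x" for x :: real using exp_ge_add_one_self[of "- x"] by simp
  have "0 \<le> x\<^sup>2 / 2 - (exp (- x) - 1 + x)"
    by (rule nonneg_of_deriv_nonneg[of _ "\<lambda>x. exp (- x) - 1 + x"]) (use A assms in \<open>auto intro!: derivative_eq_intros\<close>)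
  then show "exp (- x) - 1 + x \<le> x\<^sup>2 / 2" by simp
  show "0 \<le> exp (- x) - 1 + x" "1 - exp (- x) \<le> x" using A[of x] by auto
  show "0 \<le> 1 - exp (- x)" using assms by simp
qed

lemma powr_shift: "0 < u \<Longrightarrow> ((\<lambda>u. u powr p) has_real_derivative p * u powr q) (at u)" if "q = p - 1" for p q u :: real
  using has_real_derivative_powr[of u p] that by simp

section \<open>Error terms of one step and their derivatives\<close>

text \<open>Here g is the step size and s the factor in front of the Pareto variable. The two
  inequalities with B convert every error term, whether it carries g squared or a fourth power of s,
  into a multiple of s squared with a constant uniform in g.\<close>

locale stable_step =
  fixes a g s B :: real
  assumes a: "1 < a" "a < 2" and g: "0 < g" "g \<le> 1 / 2" and s: "0 < s"
    and g2: "g\<^sup>2 \<le> B * s\<^sup>2" and s2: "s\<^sup>2 \<le> B"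
begin

lemma B_pos: "0 < B"
proof -
  have "0 < s\<^sup>2" using s by simp
  with s2 show ?thesis by linarith
qed

text \<open>The symbol of the Pareto step, minus that of the stable step, is \<open>u * (c1 * s\<^sup>2 * u - a * s powr a * J u - X u)\<close>.\<close>

definition J where "J u = u powr (a - 1) * cos_tail a (s * u)"
definition J' where "J' u = (a - 1) * u powr (a - 2) * cos_tail a (s * u) + u powr (a - 1) * (s * cos_kernel a (s * u))"
text \<open>The derivative of \<open>cos_kernel a\<close> on the positive half-line.\<close>

definition kd where "kd w = (w - sin w) * w powr (- 1 - a) - (1 + a) * (cos w - 1 + w\<^sup>2 / 2) * w powr (- 2 - a)"
definition J'' where "J'' u = (a - 1) * (a - 2) * u powr (a - 3) * cos_tail a (s * u)
  + 2 * ((a - 1) * u powr (a - 2) * (s * cos_kernel a (s * u))) + u powr (a - 1) * (s\<^sup>2 * kd (s * u))"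

lemma
  assumes u: "0 < u"
  shows J_deriv: "(J has_real_derivative J' u) (at u)"
    and J'_deriv: "(J' has_real_derivative J'' u) (at u)"
proof -
  have su: "0 < s * u" using s u by simp
  have dl: "((\<lambda>u. s * u) has_real_derivative s) (at u)" by (auto intro!: derivative_eq_intros)
  have d1: "((\<lambda>u. cos_tail a (s * u)) has_real_derivative cos_kernel a (s * u) * s) (at u)"
    by (rule DERIV_chain2[OF cos_tail_has_derivative[OF su a(2)] dl])
  have d2: "((\<lambda>u. cos_kernel a (s * u)) has_real_derivative kd (s * u) * s) (at u)"
    unfolding kd_def by (rule DERIV_chain2[OF cos_kernel_has_derivative[OF su] dl])
  have p1: "((\<lambda>u. u powr (a - 1)) has_real_derivative (a - 1) * u powr (a - 2)) (at u)"
    using u by (intro powr_shift) auto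
  have p2: "((\<lambda>u. u powr (a - 2)) has_real_derivative (a - 2) * u powr (a - 3)) (at u)"
    using u by (intro powr_shift) auto
  show "(J has_real_derivative J' u) (at u)"
    unfolding J_def[abs_def] J'_def
    by (rule DERIV_cong[OF DERIV_mult[OF p1 d1]]) (simp add: algebra_simps)
  show "(J' has_real_derivative J'' u) (at u)"
    unfolding J'_def[abs_def] J''_def
    by (rule DERIV_cong[OF DERIV_add[OF DERIV_mult[OF DERIV_cmult[OF p2] d1] DERIV_mult[OF p1 DERIV_cmult[OF d2]]]])
       (simp add: algebra_simps power2_eq_square)
qed

text \<open>Scaling: the remainder, s times its kernel, and s squared times the derivative of the
  kernel, all at s u, each carry exactly \<open>s powr (4 - a)\<close>. A derivative in u therefore
  costs one power of u and none of s.\<close>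

lemma
  assumes u: "0 < u"
  shows J_bound: "\<bar>J u\<bar> \<le> s powr (4 - a) * u ^ 3"
    and J'_bound: "\<bar>J' u\<bar> \<le> s powr (4 - a) * u ^ 2"
    and J''_bound: "\<bar>J'' u\<bar> \<le> 2 * s powr (4 - a) * u"
proof -
  have su: "0 < s * u" using s u by simp
  define S where "S = s powr (4 - a)"
  have S: "0 \<le> S" by (simp add: S_def)
  have t: "\<bar>cos_tail a (s * u)\<bar> \<le> S * u powr (4 - a) / 48"
    using cos_tail_bounds[of "s * u" a] a su s u by (simp add: S_def powr_mult)
  have k: "\<bar>s * cos_kernel a (s * u)\<bar> \<le> S * u powr (3 - a) / 24"
  proof -
    have "\<bar>s * cos_kernel a (s * u)\<bar> = s * cos_kernel a (s * u)"
      using cos_kernel_bounds[of "s * u" a] s su by simp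
    also have "\<dots> \<le> s * ((s * u) powr (3 - a) / 24)"
      using cos_kernel_bounds[of "s * u" a] s su by (intro mult_left_mono) auto
    also have "\<dots> = (s powr 1 * s powr (3 - a)) * u powr (3 - a) / 24" using s u by (simp add: powr_mult)
    also have "s powr 1 * s powr (3 - a) = S" by (simp only: S_def powr_add[symmetric]) simp
    finally show ?thesis .
  qed
  have k2: "\<bar>s\<^sup>2 * kd (s * u)\<bar> \<le> S * u powr (2 - a)"
  proof -
    have "\<bar>s\<^sup>2 * kd (s * u)\<bar> \<le> s\<^sup>2 * (s * u) powr (2 - a)"
      using cos_kernel_deriv_bound[OF su a] unfolding kd_def abs_mult by (simp add: mult_left_mono)
    also have "\<dots> = (s powr 2 * s powr (2 - a)) * u powr (2 - a)" using s u by (simp add: powr_mult powr_numeral)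
    also have "s powr 2 * s powr (2 - a) = S" by (simp add: S_def powr_add[symmetric])
    finally show ?thesis .
  qed
  have u1: "u powr 1 = u" "u powr 2 = u ^ 2" "u powr 3 = u ^ 3" using u by (auto simp: powr_numeral)
  have A: "\<bar>u powr p * x\<bar> \<le> S * u powr (p + q) / c" if "\<bar>x\<bar> \<le> S * u powr q / c" for p q x c
  proof -
    have "\<bar>u powr p * x\<bar> = u powr p * \<bar>x\<bar>" by (simp add: abs_mult)
    also have "\<dots> \<le> u powr p * (S * u powr q / c)" using that by (intro mult_left_mono) auto
    finally show ?thesis by (simp add: powr_add mult_ac)
  qed
  have 1: "\<bar>u powr (a - 1) * cos_tail a (s * u)\<bar> \<le> S * u ^ 3 / 48"
    using A[OF t, of "a - 1"] by (simp add: u1)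
  have 2: "\<bar>u powr (a - 2) * cos_tail a (s * u)\<bar> \<le> S * u ^ 2 / 48"
    using A[OF t, of "a - 2"] by (simp add: u1)
  have 3: "\<bar>u powr (a - 3) * cos_tail a (s * u)\<bar> \<le> S * u / 48"
    using A[OF t, of "a - 3"] u by (simp add: u1)
  have 4: "\<bar>u powr (a - 1) * (s * cos_kernel a (s * u))\<bar> \<le> S * u ^ 2 / 24"
    using A[OF k, of "a - 1"] by (simp add: u1)
  have 5: "\<bar>u powr (a - 2) * (s * cos_kernel a (s * u))\<bar> \<le> S * u / 24"
    using A[OF k, of "a - 2"] u by (simp add: u1)
  have 6: "\<bar>u powr (a - 1) * (s\<^sup>2 * kd (s * u))\<bar> \<le> S * u"
    using A[where c=1, of _ "2 - a" "a - 1"] k2 u by (simp add: u1)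
  have C: "\<bar>c * x\<bar> \<le> y" if "\<bar>x\<bar> \<le> y" "\<bar>c\<bar> \<le> 1" for c x y :: real
    using mult_mono[OF that(2,1)] that by (simp add: abs_mult)
  have Su: "0 \<le> S * u ^ 3" "0 \<le> S * u ^ 2" "0 \<le> S * u" using S u by auto
  show "\<bar>J u\<bar> \<le> s powr (4 - a) * u ^ 3"
    unfolding J_def S_def[symmetric] using 1 Su by linarith
  have "\<bar>(a - 1) * (u powr (a - 2) * cos_tail a (s * u))\<bar> \<le> S * u ^ 2 / 48" using a by (intro C[OF 2]) auto
  then show "\<bar>J' u\<bar> \<le> s powr (4 - a) * u ^ 2"
    unfolding J'_def S_def[symmetric] mult.assoc using 4 Su by linarith
  have "\<bar>(a - 1) * (a - 2)\<bar> \<le> 1 * 1" unfolding abs_mult using a by (intro mult_mono) auto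
  then have "\<bar>((a - 1) * (a - 2)) * (u powr (a - 3) * cos_tail a (s * u))\<bar> \<le> S * u / 48" by (intro C[OF 3]) simp
  moreover have "\<bar>(a - 1) * (u powr (a - 2) * (s * cos_kernel a (s * u)))\<bar> \<le> S * u / 24" using a by (intro C[OF 5]) auto
  ultimately show "\<bar>J'' u\<bar> \<le> 2 * s powr (4 - a) * u"
    unfolding J''_def S_def[symmetric] mult.assoc using 6 Su by linarith
qed

definition X where "X u = (exp (- (g * u powr a)) - 1 + g * u powr a) / u"
definition X' where "X' u = (1 - exp (- (g * u powr a))) * (a * g * u powr (a - 2)) - (exp (- (g * u powr a)) - 1 + g * u powr a) / u ^ 2"
definition X'' where "X'' u = exp (- (g * u powr a)) * (a * g * u powr (a - 1)) * (a * g * u powr (a - 2))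
   + (1 - exp (- (g * u powr a))) * (a * g * ((a - 2) * u powr (a - 3)))
   - ((1 - exp (- (g * u powr a))) * (a * g * u powr (a - 1)) / u ^ 2 - 2 * (exp (- (g * u powr a)) - 1 + g * u powr a) / u ^ 3)"

lemma
  assumes u: "0 < u"
  shows X_deriv: "(X has_real_derivative X' u) (at u)"
    and X'_deriv: "(X' has_real_derivative X'' u) (at u)"
proof -
  have x: "((\<lambda>u. g * u powr a) has_real_derivative a * g * u powr (a - 1)) (at u)"
    using DERIV_cmult[OF powr_shift[OF refl u], of g a] by (simp add: mult_ac)
  have e: "((\<lambda>u. exp (- (g * u powr a))) has_real_derivative - (exp (- (g * u powr a)) * (a * g * u powr (a - 1)))) (at u)"
    by (rule DERIV_cong[OF DERIV_fun_exp[OF DERIV_minus[OF x]]]) simp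
  have e2: "((\<lambda>u. exp (- (g * u powr a)) - 1 + g * u powr a) has_real_derivative (1 - exp (- (g * u powr a))) * (a * g * u powr (a - 1))) (at u)"
    by (rule DERIV_cong[OF DERIV_add[OF DERIV_diff[OF e DERIV_const] x]]) (simp add: algebra_simps)
  have e1: "((\<lambda>u. 1 - exp (- (g * u powr a))) has_real_derivative exp (- (g * u powr a)) * (a * g * u powr (a - 1))) (at u)"
    by (rule DERIV_cong[OF DERIV_diff[OF DERIV_const e]]) simp
  have p2: "((\<lambda>u. a * g * u powr (a - 2)) has_real_derivative a * g * ((a - 2) * u powr (a - 3))) (at u)"
    using u by (intro DERIV_cmult powr_shift) auto
  have up: "u powr (a - 1) / u = u powr (a - 2)" using u by (simp add: powr_diff power2_eq_square powr_numeral)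
  show "(X has_real_derivative X' u) (at u)"
    unfolding X_def[abs_def] X'_def up[symmetric]
    by (rule DERIV_cong[OF DERIV_divide[OF e2 DERIV_ident]]) (use u in \<open>simp_all add: field_simps power2_eq_square\<close>)
  have q: "((\<lambda>u. (exp (- (g * u powr a)) - 1 + g * u powr a) / u ^ 2) has_real_derivative
      (1 - exp (- (g * u powr a))) * (a * g * u powr (a - 1)) / u ^ 2 - 2 * (exp (- (g * u powr a)) - 1 + g * u powr a) / u ^ 3) (at u)"
    by (rule DERIV_cong[OF DERIV_divide[OF e2 DERIV_pow[of 2]]])
       (use u in \<open>simp_all add: field_simps power2_eq_square power3_eq_cube\<close>)
  show "(X' has_real_derivative X'' u) (at u)"
    unfolding X'_def[abs_def] X''_def
    by (rule DERIV_cong[OF DERIV_diff[OF DERIV_mult[OF e1 p2] q]]) simp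
qed

text \<open>With x = g \<open>u powr a\<close>, the exponential remainder is at most x squared over
  2 and its derivative in x at most x, so every term carries g squared. The second derivative is
  singular at 0 when a < 3/2, but remains integrable as \<open>a > 1\<close>.\<close>

lemma
  assumes u: "0 < u"
  shows X_bound: "\<bar>X u\<bar> \<le> g\<^sup>2 * u powr (2 * a - 1)"
    and X'_bound: "\<bar>X' u\<bar> \<le> 3 * g\<^sup>2 * u powr (2 * a - 2)"
    and X''_bound: "\<bar>X'' u\<bar> \<le> 9 * g\<^sup>2 * u powr (2 * a - 3)"
proof -
  define x where "x = g * u powr a"
  define e1 e2 where "e1 = 1 - exp (- x)" and "e2 = exp (- x) - 1 + x"
  have x0: "0 \<le> x" using g by (simp add: x_def)
  note eb = exp_remainder_bounds[OF x0, folded e1_def e2_def]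
  have p1: "e1 * (g * u powr (a - c)) \<le> g\<^sup>2 * u powr (2 * a - c)" "0 \<le> e1 * (g * u powr (a - c))" for c
  proof -
    have "e1 * (g * u powr (a - c)) \<le> x * (g * u powr (a - c))" using eb g by (intro mult_right_mono) auto
    also have "\<dots> = g\<^sup>2 * (u powr a * u powr (a - c))" by (simp add: x_def power2_eq_square mult_ac)
    also have "u powr a * u powr (a - c) = u powr (2 * a - c)" by (simp add: powr_add[symmetric])
    finally show "e1 * (g * u powr (a - c)) \<le> g\<^sup>2 * u powr (2 * a - c)" .
    show "0 \<le> e1 * (g * u powr (a - c))" using eb g by simp
  qed
  have p2: "e2 / u ^ n \<le> g\<^sup>2 * u powr (2 * a - n) / 2" "0 \<le> e2 / u ^ n" for n :: nat
  proof -
    have "e2 / u ^ n \<le> (x\<^sup>2 / 2) / u ^ n" using eb u by (intro divide_right_mono) auto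
    also have "x\<^sup>2 = g\<^sup>2 * u powr (2 * a)" by (simp add: x_def power2_eq_square powr_add[symmetric] mult_ac)
    also have "g\<^sup>2 * u powr (2 * a) / 2 / u ^ n = g\<^sup>2 * (u powr (2 * a) / u powr n) / 2" using u by (simp add: powr_realpow)
    also have "u powr (2 * a) / u powr n = u powr (2 * a - n)" by (simp add: powr_diff)
    finally show "e2 / u ^ n \<le> g\<^sup>2 * u powr (2 * a - n) / 2" .
    show "0 \<le> e2 / u ^ n" using eb u by simp
  qed
  have Y: "X u = e2 / u ^ 1" "X' u = a * (e1 * (g * u powr (a - 2))) - e2 / u ^ 2"
    by (simp_all add: X_def X'_def x_def e1_def e2_def mult_ac)
  have uu: "u powr (a - 1) / u ^ 2 = u powr (a - 3)"
  proof -
    have "u powr (a - 1) / u ^ 2 = u powr (a - 1) / u powr 2" using u by (simp add: powr_numeral)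
    then show ?thesis by (simp add: powr_diff[symmetric])
  qed
  have "X'' u = a * a * (exp (- x) * (g * u powr (a - 1) * (g * u powr (a - 2))))
      + a * (a - 2) * (e1 * (g * u powr (a - 3))) - (a * (e1 * (g * (u powr (a - 1) / u ^ 2))) - 2 * (e2 / u ^ 3))"
    by (simp add: X''_def x_def e1_def e2_def mult_ac)
  then have Y'': "X'' u = a * a * (exp (- x) * (g * u powr (a - 1) * (g * u powr (a - 2))))
      + a * (a - 2) * (e1 * (g * u powr (a - 3))) - (a * (e1 * (g * u powr (a - 3))) - 2 * (e2 / u ^ 3))"
    unfolding uu .
  show "\<bar>X u\<bar> \<le> g\<^sup>2 * u powr (2 * a - 1)"
  proof -
    have "0 \<le> g\<^sup>2 * u powr (2 * a - 1)" by simp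
    then show ?thesis using p2[of 1, unfolded of_nat_1] unfolding Y(1) by linarith
  qed
  have a1: "a * (e1 * (g * u powr (a - c))) \<le> 2 * (g\<^sup>2 * u powr (2 * a - c))" "0 \<le> a * (e1 * (g * u powr (a - c)))" for c
    using p1[of c] a by (auto intro!: mult_mono)
  have nn: "0 \<le> g\<^sup>2 * u powr q" for q by simp
  show "\<bar>X' u\<bar> \<le> 3 * g\<^sup>2 * u powr (2 * a - 2)"
    using a1[of 2] p2[of 2] nn[of "2 * a - 2"] unfolding Y(2) mult.assoc by simp
  have b1: "0 \<le> a * a * (exp (- x) * (g * u powr (a - 1) * (g * u powr (a - 2))))" using a g by simp
  have b2: "a * a * (exp (- x) * (g * u powr (a - 1) * (g * u powr (a - 2)))) \<le> 4 * (g\<^sup>2 * u powr (2 * a - 3))"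
  proof -
    have "u powr (a - 1) * u powr (a - 2) = u powr (2 * a - 3)" by (simp add: powr_add[symmetric])
    then have e: "g * u powr (a - 1) * (g * u powr (a - 2)) = g\<^sup>2 * u powr (2 * a - 3)"
      by (simp add: power2_eq_square mult_ac)
    have "a * a \<le> 2 * 2" using a by (intro mult_mono) auto
    moreover have "exp (- x) * (g\<^sup>2 * u powr (2 * a - 3)) \<le> 1 * (g\<^sup>2 * u powr (2 * a - 3))"
      using x0 by (intro mult_right_mono) auto
    ultimately have "a * a * (exp (- x) * (g\<^sup>2 * u powr (2 * a - 3))) \<le> (2 * 2) * (1 * (g\<^sup>2 * u powr (2 * a - 3)))"
      using a by (rule_tac mult_mono) auto
    then show ?thesis unfolding e by simp
  qed
  have b3: "\<bar>a * (a - 2) * (e1 * (g * u powr (a - 3)))\<bar> \<le> 2 * (g\<^sup>2 * u powr (2 * a - 3))"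
  proof -
    have "\<bar>a * (a - 2)\<bar> \<le> 2 * 1" unfolding abs_mult using a by (intro mult_mono) auto
    then have "\<bar>a * (a - 2)\<bar> * (e1 * (g * u powr (a - 3))) \<le> 2 * (g\<^sup>2 * u powr (2 * a - 3))"
      using p1[of 3] by (rule_tac mult_mono) auto
    then show ?thesis using p1(2)[of 3] by (simp only: abs_mult[of "a * (a - 2)"] abs_of_nonneg)
  qed
  show "\<bar>X'' u\<bar> \<le> 9 * g\<^sup>2 * u powr (2 * a - 3)"
    using b1 b2 b3 a1[of 3] p2[of 3] nn[of "2 * a - 3"] unfolding Y'' mult.assoc[of 9] by simp
qed

end

lemma power5_le: fixes u :: real assumes u: "0 < u" shows "(1 + u) ^ 5 \<le> 32 * (1 + u ^ 5)"
proof (cases "u \<le> 1")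
  case True
  then have "(1 + u) ^ 5 \<le> 2 ^ 5" using u by (intro power_mono) auto
  then have "(1 + u) ^ 5 \<le> 32" by simp
  also have "32 \<le> 32 * (1 + u ^ 5)" using u by simp
  finally show ?thesis .
next
  case False
  then have "(1 + u) ^ 5 \<le> (2 * u) ^ 5" using u by (intro power_mono) auto
  then show ?thesis by (simp add: power_mult_distrib)
qed

context stable_step
begin

section \<open>The damped kernel\<close>

definition c1 where "c1 = a / (2 * (2 - a))"
definition G where "G u = c1 * s\<^sup>2 * u - a * s powr a * J u - X u"
definition G' where "G' u = c1 * s\<^sup>2 - a * s powr a * J' u - X' u"
definition G'' where "G'' u = - (a * s powr a * J'' u) - X'' u"
text \<open>13 = 9 + 4 is the sum of the constants in the bounds of \<open>X''\<close> and of
  \<open>a * s powr a * J''\<close>; the constants for G and its first derivative are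
  smaller.\<close>

definition M where "M = c1 + 13 * B"
text \<open>Chosen so that \<open>E u\<close> is the characteristic function of \<open>\<nu>\<close>
  at \<open>(1 - g) * u\<close>, the contribution of the starting point of the step.\<close>

definition b where "b = (1 - g) powr a / a"
definition E where "E u = exp (- (b * u powr a))"
definition E' where "E' u = - (b * a * u powr (a - 1)) * E u"
definition E'' where "E'' u = (b * a * u powr (a - 1)) * (b * a * u powr (a - 1)) * E u - b * a * ((a - 1) * u powr (a - 2)) * E u"

lemma c1_pos: "0 < c1" using a by (simp add: c1_def)
lemma M_pos: "0 < M" using c1_pos B_pos by (simp add: M_def)

text \<open>The lower bound comes from g \<le> 1/2 and a < 2: \<open>(1 - g) powr a\<close> is at
  least 1/4. It makes the decay of E uniform in the step size.\<close>

lemma ba: "0 \<le> b * a" "b * a \<le> 1" "1 / 8 \<le> b"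
proof -
  have "(1 - g) powr a \<le> 1" using g a by (intro powr_le1) auto
  then show "0 \<le> b * a" "b * a \<le> 1" using a by (auto simp: b_def)
  have "(1 / 2) powr 2 \<le> (1 / 2 :: real) powr a" using a by (intro powr_mono') auto
  also have "\<dots> \<le> (1 - g) powr a" using g a by (intro powr_mono2) auto
  finally have "1 / 4 \<le> (1 - g) powr a" by (simp add: powr_numeral power2_eq_square)
  moreover have "(1 - g) powr a / 2 \<le> b" unfolding b_def using a by (intro divide_left_mono) auto
  ultimately show "1 / 8 \<le> b" by simp
qed

lemma E_pos: "0 < E u" by (simp add: E_def)

lemma
  assumes u: "0 < u"
  shows E_deriv: "(E has_real_derivative E' u) (at u)"
    and E'_deriv: "(E' has_real_derivative E'' u) (at u)"
    and G_deriv: "(G has_real_derivative G' u) (at u)"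
    and G'_deriv: "(G' has_real_derivative G'' u) (at u)"
proof -
  have x: "((\<lambda>u. b * u powr a) has_real_derivative b * a * u powr (a - 1)) (at u)"
    using DERIV_cmult[OF powr_shift[OF refl u], of b a] by (simp add: mult_ac)
  show E: "(E has_real_derivative E' u) (at u)"
    unfolding E_def[abs_def] E'_def by (rule DERIV_cong[OF DERIV_fun_exp[OF DERIV_minus[OF x]]]) simp
  have p2: "((\<lambda>u. - (b * a * u powr (a - 1))) has_real_derivative - (b * a * ((a - 1) * u powr (a - 2)))) (at u)"
    using u by (intro DERIV_minus DERIV_cmult powr_shift) auto
  show "(E' has_real_derivative E'' u) (at u)"
    unfolding E'_def[abs_def] by (rule DERIV_cong[OF DERIV_mult[OF p2 E]]) (simp add: E''_def E'_def algebra_simps)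
  show "(G has_real_derivative G' u) (at u)"
    unfolding G_def[abs_def] G'_def
    by (rule DERIV_cong[OF DERIV_diff[OF DERIV_diff[OF DERIV_cmult[OF DERIV_ident] DERIV_cmult[OF J_deriv[OF u]]] X_deriv[OF u]]]) simp
  show "(G' has_real_derivative G'' u) (at u)"
    unfolding G'_def[abs_def] G''_def
    by (rule DERIV_cong[OF DERIV_diff[OF DERIV_diff[OF DERIV_const DERIV_cmult[OF J'_deriv[OF u]]] X'_deriv[OF u]]]) simp
qed

text \<open>\<open>s powr a * s powr (4 - a)\<close> is the fourth power of s; one factor s squared
  is traded for B.\<close>

lemma sJ: "a * s powr a * y \<le> 2 * B * s\<^sup>2 * z" "0 \<le> a * s powr a * y" if "0 \<le> y" "y \<le> s powr (4 - a) * z" "0 \<le> z"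
proof -
  have "a * s powr a * y \<le> a * s powr a * (s powr (4 - a) * z)" using that a by (intro mult_left_mono) auto
  also have "\<dots> = a * (s powr a * s powr (4 - a)) * z" by simp
  also have "s powr a * s powr (4 - a) = s powr 4" by (simp add: powr_add[symmetric])
  also have "s powr 4 = s\<^sup>2 * s\<^sup>2" using s by (simp add: powr_numeral flip: power_add)
  also have "a * (s\<^sup>2 * s\<^sup>2) * z \<le> 2 * (B * s\<^sup>2) * z"
    using a s2 that by (intro mult_mono mult_right_mono) auto
  finally show "a * s powr a * y \<le> 2 * B * s\<^sup>2 * z" by simp
  show "0 \<le> a * s powr a * y" using a that by simp
qed

lemma abs_sJ: "\<bar>a * s powr a * y\<bar> \<le> 2 * B * s\<^sup>2 * z" if "\<bar>y\<bar> \<le> s powr (4 - a) * z"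
proof -
  have "0 \<le> s powr (4 - a) * z" using that by linarith
  then have "0 \<le> z" using s by (simp add: zero_le_mult_iff)
  then show ?thesis using sJ(1)[of "\<bar>y\<bar>" z] that a by (simp add: abs_mult)
qed

lemma g2_le: "c * g\<^sup>2 * y \<le> c * B * s\<^sup>2 * y" if "0 \<le> y" "0 \<le> c"
  using mult_right_mono[OF mult_left_mono[OF g2 that(2)] that(1)] by (simp add: mult.assoc)

lemma
  assumes u: "0 < u"
  shows G_bound: "\<bar>G u\<bar> \<le> M * s\<^sup>2 * (u * (1 + u)\<^sup>2)"
    and G'_bound: "\<bar>G' u\<bar> \<le> M * s\<^sup>2 * (1 + u)\<^sup>2"
    and G''_bound: "\<bar>G'' u\<bar> \<le> M * s\<^sup>2 * (u powr (2 * a - 3) + u)"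
proof -
  have B0: "0 \<le> B * s\<^sup>2" "0 \<le> c1 * s\<^sup>2" using B_pos c1_pos by auto
  have pa: "u powr (2 * a - 2) \<le> (1 + u)\<^sup>2" using a u by (intro powr_le_power_one_plus) auto
  have pb: "u powr (2 * a - 1) \<le> u * (1 + u)\<^sup>2"
  proof -
    have "u powr (2 * a - 1) = u powr 1 * u powr (2 * a - 2)" unfolding powr_add[symmetric] by simp
    also have "\<dots> \<le> u * (1 + u)\<^sup>2" using u pa by simp
    finally show ?thesis .
  qed
  have sq: "1 \<le> (1 + u)\<^sup>2" "u\<^sup>2 \<le> (1 + u)\<^sup>2" using u by (auto simp: power2_eq_square algebra_simps)
  have u3: "u ^ 3 \<le> u * (1 + u)\<^sup>2" using mult_left_mono[OF sq(2), of u] u by (simp add: power3_eq_cube power2_eq_square mult.assoc)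
  have u1: "u \<le> u * (1 + u)\<^sup>2" using mult_left_mono[OF sq(1), of u] u by simp
  have m: "c1 * s\<^sup>2 * x \<le> c1 * s\<^sup>2 * z" "B * s\<^sup>2 * x \<le> B * s\<^sup>2 * z" if "x \<le> z" for x z
    using mult_left_mono[OF that B0(1)] mult_left_mono[OF that B0(2)] by auto
  have M: "M * s\<^sup>2 * z = c1 * s\<^sup>2 * z + 13 * (B * s\<^sup>2 * z)" for z by (simp add: M_def algebra_simps)
  have z0: "0 \<le> B * s\<^sup>2 * (u * (1 + u)\<^sup>2)" "0 \<le> B * s\<^sup>2 * (1 + u)\<^sup>2" "0 \<le> B * s\<^sup>2 * u" "0 \<le> B * s\<^sup>2 * u powr (2 * a - 3)"
      "0 \<le> c1 * s\<^sup>2 * u" "0 \<le> c1 * s\<^sup>2 * u powr (2 * a - 3)"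
    using B0 u by (auto intro!: mult_nonneg_nonneg)
  have "\<bar>X u\<bar> \<le> B * s\<^sup>2 * (u * (1 + u)\<^sup>2)"
    using X_bound[OF u] g2_le[of "u powr (2 * a - 1)" 1] m(2)[OF pb] by simp
  moreover have "\<bar>a * s powr a * J u\<bar> \<le> 2 * (B * s\<^sup>2 * (u * (1 + u)\<^sup>2))"
    using abs_sJ[OF J_bound[OF u]] m(2)[OF u3] by simp
  moreover have "\<bar>c1 * s\<^sup>2 * u\<bar> \<le> c1 * s\<^sup>2 * (u * (1 + u)\<^sup>2)" using z0 m(1)[OF u1] by simp
  ultimately show "\<bar>G u\<bar> \<le> M * s\<^sup>2 * (u * (1 + u)\<^sup>2)" unfolding G_def M using z0 by linarith
  have "\<bar>X' u\<bar> \<le> 3 * (B * s\<^sup>2 * (1 + u)\<^sup>2)"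
    using X'_bound[OF u] g2_le[of "u powr (2 * a - 2)" 3] m(2)[OF pa] by simp
  moreover have "\<bar>a * s powr a * J' u\<bar> \<le> 2 * (B * s\<^sup>2 * (1 + u)\<^sup>2)"
    using abs_sJ[OF J'_bound[OF u]] m(2)[OF sq(2)] by simp
  moreover have "\<bar>c1 * s\<^sup>2\<bar> \<le> c1 * s\<^sup>2 * (1 + u)\<^sup>2" using B0 m(1)[OF sq(1)] by simp
  ultimately show "\<bar>G' u\<bar> \<le> M * s\<^sup>2 * (1 + u)\<^sup>2" unfolding G'_def M using z0 by linarith
  have "\<bar>X'' u\<bar> \<le> 9 * (B * s\<^sup>2 * u powr (2 * a - 3))"
    using X''_bound[OF u] g2_le[of "u powr (2 * a - 3)" 9] by simp
  moreover have "\<bar>a * s powr a * J'' u\<bar> \<le> 4 * (B * s\<^sup>2 * u)"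
    using abs_sJ[of "J'' u" "2 * u"] J''_bound[OF u] by (simp add: mult_ac)
  ultimately show "\<bar>G'' u\<bar> \<le> M * s\<^sup>2 * (u powr (2 * a - 3) + u)"
    unfolding G''_def M distrib_left using z0 by linarith
qed

text \<open>\<open>u * K u\<close> will be the difference between the characteristic functions of a
  Pareto step and of a stable step, both started from \<open>\<nu>\<close>; E is their common
  factor.\<close>

definition K where "K u = E u * G u"
definition K' where "K' u = E' u * G u + E u * G' u"
definition K'' where "K'' u = E'' u * G u + 2 * (E' u * G' u) + E u * G'' u"

lemma
  assumes u: "0 < u"
  shows K_deriv: "(K has_real_derivative K' u) (at u)"
    and K'_deriv: "(K' has_real_derivative K'' u) (at u)"
proof -
  show "(K has_real_derivative K' u) (at u)"
    unfolding K_def[abs_def] K'_def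
    by (rule DERIV_cong[OF DERIV_mult[OF E_deriv[OF u] G_deriv[OF u]]]) (simp add: mult.commute)
  show "(K' has_real_derivative K'' u) (at u)"
    unfolding K'_def[abs_def] K''_def
    by (rule DERIV_cong[OF DERIV_add[OF DERIV_mult[OF E'_deriv[OF u] G_deriv[OF u]] DERIV_mult[OF E_deriv[OF u] G'_deriv[OF u]]]])
       (simp add: algebra_simps)
qed

lemma
  assumes u: "0 < u"
  shows E'_bound: "\<bar>E' u\<bar> \<le> u powr (a - 1) * E u"
    and E''_bound: "\<bar>E'' u\<bar> \<le> (u powr (2 * a - 2) + u powr (a - 2)) * E u"
proof -
  have p: "b * a * u powr q \<le> u powr q" "0 \<le> b * a * u powr q" for q
    using mult_right_mono[OF ba(2), of "u powr q"] ba(1) by auto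
  show "\<bar>E' u\<bar> \<le> u powr (a - 1) * E u"
  proof -
    have "E' u = - (b * a * u powr (a - 1) * E u)" by (simp add: E'_def)
    moreover have "0 \<le> b * a * u powr (a - 1) * E u" "b * a * u powr (a - 1) * E u \<le> u powr (a - 1) * E u"
      using p[of "a - 1"] E_pos[of u] by (auto intro: mult_right_mono)
    ultimately show ?thesis by linarith
  qed
  have "(b * a * u powr (a - 1)) * (b * a * u powr (a - 1)) \<le> u powr (a - 1) * u powr (a - 1)"
    using p[of "a - 1"] by (intro mult_mono) auto
  also have "\<dots> = u powr (2 * a - 2)" by (simp add: powr_add[symmetric])
  finally have 1: "(b * a * u powr (a - 1)) * (b * a * u powr (a - 1)) * E u \<le> u powr (2 * a - 2) * E u"
    using E_pos[of u] by (intro mult_right_mono) auto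
  have "b * a * ((a - 1) * u powr (a - 2)) = (a - 1) * (b * a * u powr (a - 2))" by simp
  also have "\<dots> \<le> 1 * u powr (a - 2)" using a p[of "a - 2"] by (intro mult_mono) auto
  finally have 2: "b * a * ((a - 1) * u powr (a - 2)) * E u \<le> u powr (a - 2) * E u"
    using E_pos[of u] by (intro mult_right_mono) auto
  have 3: "0 \<le> (b * a * u powr (a - 1)) * (b * a * u powr (a - 1)) * E u" "0 \<le> b * a * ((a - 1) * u powr (a - 2)) * E u"
    using p a ba(1) E_pos[of u] by (auto intro!: mult_nonneg_nonneg)
  show "\<bar>E'' u\<bar> \<le> (u powr (2 * a - 2) + u powr (a - 2)) * E u"
    unfolding E''_def distrib_right using 1 2 3 by linarith
qed

lemma
  assumes u: "0 < u"
  shows K_bound: "\<bar>K u\<bar> \<le> M * s\<^sup>2 * (E u * (u * (1 + u)\<^sup>2))"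
    and K'_bound: "\<bar>K' u\<bar> \<le> 2 * M * s\<^sup>2 * (E u * (1 + u) ^ 4)"
    and K''_bound: "\<bar>K'' u\<bar> \<le> M * s\<^sup>2 * (E u * (5 * (1 + u) ^ 5 + u powr (2 * a - 3)))"
proof -
  define m where "m = M * s\<^sup>2"
  have m: "0 \<le> m" using M_pos by (simp add: m_def)
  note Gb = G_bound[OF u, folded m_def] G'_bound[OF u, folded m_def] G''_bound[OF u, folded m_def]
  have E0: "0 \<le> E u" using E_pos[of u] by simp
  have prod: "\<bar>x * y\<bar> \<le> m * (E u * (p * q))" if "\<bar>x\<bar> \<le> p * E u" "\<bar>y\<bar> \<le> m * q" for x y p q
  proof -
    have "\<bar>x * y\<bar> \<le> (p * E u) * (m * q)"
      unfolding abs_mult using that by (intro mult_mono order_trans[OF abs_ge_zero that(1)]) auto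
    then show ?thesis by (simp add: mult_ac)
  qed
  have mE: "m * (E u * x) \<le> m * (E u * y)" if "x \<le> y" for x y
    using that m E0 by (intro mult_left_mono) auto
  have E1: "\<bar>E u\<bar> \<le> 1 * E u" using E0 by simp
  have pw: "(1 + u) ^ i \<le> (1 + u) ^ j" if "i \<le> j" for i j using u that by (rule power_one_plus_mono)
  have K1: "\<bar>E u * G u\<bar> \<le> m * (E u * (1 * (u * (1 + u)\<^sup>2)))" by (rule prod[OF E1 Gb(1)])
  then show "\<bar>K u\<bar> \<le> M * s\<^sup>2 * (E u * (u * (1 + u)\<^sup>2))" by (simp add: K_def m_def)
  have q1: "u powr (a - 1) * (u * (1 + u)\<^sup>2) \<le> (1 + u) ^ 4"
  proof -
    have "u powr (a - 1) * u = u powr a" using u powr_add[of u "a - 1" 1] by simp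
    moreover have "u powr a \<le> (1 + u) ^ 2" using a u by (intro powr_le_power_one_plus) auto
    ultimately have "(u powr (a - 1) * u) * (1 + u)\<^sup>2 \<le> (1 + u)\<^sup>2 * (1 + u)\<^sup>2" by (intro mult_mono) auto
    then show ?thesis by (simp add: mult.assoc flip: power_add)
  qed
  have "\<bar>E' u * G u\<bar> \<le> m * (E u * (1 + u) ^ 4)"
    using prod[OF E'_bound[OF u] Gb(1)] mE[OF q1] by linarith
  moreover have "\<bar>E u * G' u\<bar> \<le> m * (E u * (1 + u) ^ 4)"
    using prod[OF E1 Gb(2)] mE[OF pw[of 2 4]] by simp
  ultimately show "\<bar>K' u\<bar> \<le> 2 * M * s\<^sup>2 * (E u * (1 + u) ^ 4)"
    unfolding K'_def mult.assoc[of 2] m_def[symmetric] by simp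
  \<comment> \<open>The singular power \<open>u powr (a - 2)\<close> from \<open>E''\<close> is
    neutralized by the factor u in the bound for G.\<close>
  have r1: "(u powr (2 * a - 2) + u powr (a - 2)) * (u * (1 + u)\<^sup>2) \<le> 2 * (1 + u) ^ 5"
  proof -
    have "(u powr (2 * a - 2) + u powr (a - 2)) * u = u powr (2 * a - 1) + u powr (a - 1)"
      using u powr_add[of u "2 * a - 2" 1] powr_add[of u "a - 2" 1] by (simp add: distrib_right)
    also have "\<dots> \<le> (1 + u) ^ 3 + (1 + u) ^ 1"
      using a u by (intro add_mono powr_le_power_one_plus) auto
    also have "\<dots> \<le> 2 * (1 + u) ^ 3" using pw[of 1 3] by simp
    finally have "((u powr (2 * a - 2) + u powr (a - 2)) * u) * (1 + u)\<^sup>2 \<le> 2 * (1 + u) ^ 3 * (1 + u)\<^sup>2"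
      by (intro mult_right_mono) auto
    then show ?thesis by (simp add: mult.assoc flip: power_add)
  qed
  have r2: "u powr (a - 1) * (1 + u)\<^sup>2 \<le> (1 + u) ^ 5"
  proof -
    have "u powr (a - 1) * (1 + u)\<^sup>2 \<le> (1 + u) ^ 1 * (1 + u)\<^sup>2"
      using a u by (intro mult_right_mono powr_le_power_one_plus) auto
    also have "\<dots> = (1 + u) ^ 3" by (simp add: power2_eq_square power3_eq_cube)
    also have "\<dots> \<le> (1 + u) ^ 5" by (rule pw) simp
    finally show ?thesis .
  qed
  have r3: "u powr (2 * a - 3) + u \<le> u powr (2 * a - 3) + (1 + u) ^ 5" using pw[of 1 5] by simp
  have "\<bar>E'' u * G u\<bar> \<le> m * (E u * (2 * (1 + u) ^ 5))"
    using prod[OF E''_bound[OF u] Gb(1)] mE[OF r1] by linarith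
  moreover have "\<bar>E' u * G' u\<bar> \<le> m * (E u * (1 + u) ^ 5)"
    using prod[OF E'_bound[OF u] Gb(2)] mE[OF r2] by linarith
  moreover have "\<bar>E u * G'' u\<bar> \<le> m * (E u * (u powr (2 * a - 3) + (1 + u) ^ 5))"
    using prod[OF E1 Gb(3)] mE[OF r3] by simp
  moreover have "m * (E u * (5 * (1 + u) ^ 5 + u powr (2 * a - 3))) = m * (E u * (2 * (1 + u) ^ 5))
     + 2 * (m * (E u * (1 + u) ^ 5)) + m * (E u * (u powr (2 * a - 3) + (1 + u) ^ 5))" by (simp add: algebra_simps)
  ultimately show "\<bar>K'' u\<bar> \<le> M * s\<^sup>2 * (E u * (5 * (1 + u) ^ 5 + u powr (2 * a - 3)))"
    unfolding K''_def m_def[symmetric] by linarith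
qed

section \<open>An integrable majorant uniform in the step size\<close>

text \<open>The exponents are written as p - 1 with p = 2 a - 2, 1 and 6, to match the Gamma
  integral; p > 0 in the first case because \<open>a > 1\<close>.\<close>

definition W where "W u = (u powr (2 * a - 2 - 1) + u powr (1 - 1) + u powr (6 - 1)) * exp (- (1 / 8 * u))"

text \<open>For every u > 0 one has u - 1 \<le> \<open>u powr a\<close>, and \<open>b\<close> is at
  least 1/8; the factor 2 dominates \<open>exp (1 / 8)\<close>.\<close>

lemma E_le: assumes u: "0 < u" shows "E u \<le> 2 * exp (- (1 / 8 * u))"
proof -
  have "u - 1 \<le> u powr a"
  proof (cases "u \<le> 1")
    case False
    then have "u powr 1 \<le> u powr a" using a by (intro powr_mono) auto
    then show ?thesis using u by simp
  qed (use powr_ge_zero[of u a] in linarith)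
  moreover have "1 / 8 * u powr a \<le> b * u powr a" using ba(3) by (intro mult_right_mono) auto
  ultimately have "- (b * u powr a) \<le> 1 / 8 - 1 / 8 * u" by linarith
  then have "E u \<le> exp (1 / 8 - 1 / 8 * u)" by (simp add: E_def)
  also have "\<dots> = exp (1 / 8) * exp (- (1 / 8 * u))" unfolding exp_add[symmetric] by simp
  also have "\<dots> \<le> 2 * exp (- (1 / 8 * u))"
    using exp_bound[of "1 / 8"] by (intro mult_right_mono) (auto simp: power2_eq_square)
  finally show ?thesis .
qed

lemma W_eq: "0 < u \<Longrightarrow> W u = (u powr (2 * a - 3) + 1 + u ^ 5) * exp (- (1 / 8 * u))"
  by (simp add: W_def powr_numeral)

text \<open>The constant is 320 = 2 * 5 * 32: 2 from the bound for E, 5 from the bound for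
  \<open>K''\<close>, and 32 from replacing the fifth power of 1 + u by 1 plus that of u.\<close>

lemma
  assumes u: "0 < u"
  shows K_W: "\<bar>K u\<bar> \<le> 320 * M * s\<^sup>2 * W u" and K''_W: "\<bar>K'' u\<bar> \<le> 320 * M * s\<^sup>2 * W u"
proof -
  define m where "m = M * s\<^sup>2"
  have m: "0 \<le> m" using M_pos by (simp add: m_def)
  have pos: "0 \<le> u ^ 5" "0 \<le> u powr (2 * a - 3)" using u by auto
  have *: "m * (E u * x) \<le> 320 * m * W u" if "x \<le> 160 * (u powr (2 * a - 3) + 1 + u ^ 5)" "0 \<le> x" for x
  proof -
    have "E u * x \<le> (2 * exp (- (1 / 8 * u))) * (160 * (u powr (2 * a - 3) + 1 + u ^ 5))"
      using that E_le[OF u] by (intro mult_mono) auto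
    then have "m * (E u * x) \<le> m * ((2 * exp (- (1 / 8 * u))) * (160 * (u powr (2 * a - 3) + 1 + u ^ 5)))"
      using m by (rule mult_left_mono)
    then show ?thesis unfolding W_eq[OF u] by (simp add: algebra_simps)
  qed
  have aux1: "x \<le> 160 * (p + 1 + t)" and aux2: "5 * x + p \<le> 160 * (p + 1 + t)"
    if "x \<le> 32 * (1 + t)" "0 \<le> t" "0 \<le> p" for x t p :: real
  proof -
    have "32 * (1 + t) = 32 + 32 * t" "160 * (p + 1 + t) = 160 * p + 160 + 160 * t" by (simp_all add: algebra_simps)
    with that show "x \<le> 160 * (p + 1 + t)" "5 * x + p \<le> 160 * (p + 1 + t)" by simp_all
  qed
  have "u * (1 + u)\<^sup>2 \<le> (1 + u) ^ 1 * (1 + u)\<^sup>2" using u by (intro mult_right_mono) auto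
  also have "\<dots> = (1 + u) ^ 3" by (simp add: power2_eq_square power3_eq_cube)
  also have "\<dots> \<le> (1 + u) ^ 5" using u by (intro power_one_plus_mono) auto
  also have "(1 + u) ^ 5 \<le> 32 * (1 + u ^ 5)" by (rule power5_le[OF u])
  finally have "u * (1 + u)\<^sup>2 \<le> 32 * (1 + u ^ 5)" .
  then have "u * (1 + u)\<^sup>2 \<le> 160 * (u powr (2 * a - 3) + 1 + u ^ 5)"
    by (rule aux1[OF _ pos])
  then show "\<bar>K u\<bar> \<le> 320 * M * s\<^sup>2 * W u"
    using K_bound[OF u] *[of "u * (1 + u)\<^sup>2"] u by (simp add: m_def mult.assoc)
  have "5 * (1 + u) ^ 5 + u powr (2 * a - 3) \<le> 160 * (u powr (2 * a - 3) + 1 + u ^ 5)"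
    by (rule aux2[OF power5_le[OF u] pos])
  then show "\<bar>K'' u\<bar> \<le> 320 * M * s\<^sup>2 * W u"
    using K''_bound[OF u] *[of "5 * (1 + u) ^ 5 + u powr (2 * a - 3)"] u by (simp add: m_def mult.assoc add_nonneg_nonneg)
qed

lemma W_integrable: "set_integrable lborel {0..} W"
proof -
  have p: "integrable lborel (\<lambda>u. indicator {0..} u * u powr (p - 1) * exp (- (1 / 8 * u)))" if "0 < p" for p :: real
    using nn_integral_powr_exp[OF that, of "1 / 8"] that
    by (intro integrableI_nn_integral_finite[where x="Gamma p * (1 / 8) powr (- p)"]) (auto simp: indicator_def intro!: mult_nonneg_nonneg)
  have "integrable lborel (\<lambda>u. indicator {0..} u * u powr (2 * a - 2 - 1) * exp (- (1 / 8 * u))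
     + indicator {0..} u * u powr (1 - 1) * exp (- (1 / 8 * u)) + indicator {0..} u * u powr (6 - 1) * exp (- (1 / 8 * u)))"
    using a by (intro Bochner_Integration.integrable_add p) auto
  also have "(\<lambda>u. indicator {0..} u * u powr (2 * a - 2 - 1) * exp (- (1 / 8 * u))
     + indicator {0..} u * u powr (1 - 1) * exp (- (1 / 8 * u)) + indicator {0..} u * u powr (6 - 1) * exp (- (1 / 8 * u)))
    = (\<lambda>u. indicator {0..} u *\<^sub>R W u)" by (simp add: W_def algebra_simps fun_eq_iff)
  finally show ?thesis unfolding set_integrable_def .
qed

end

lemma power4_exp_tendsto: "((\<lambda>u::real. (1 + u) ^ 4 * (2 * exp (- (1 / 8 * u)))) \<longlongrightarrow> 0) at_top"
proof -
  have f: "filterlim (\<lambda>u::real. (1 + u) / 8) at_top at_top"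
  proof -
    have "filterlim (\<lambda>u::real. 1 / 8 * u) at_top at_top"
      by (rule filterlim_tendsto_pos_mult_at_top[OF tendsto_const _ filterlim_ident]) simp
    from filterlim_tendsto_add_at_top[OF tendsto_const this, of "1 / 8"] show ?thesis
      by (simp add: add_divide_distrib)
  qed
  have "((\<lambda>u::real. 2 * 8 ^ 4 * exp (1 / 8) * (((1 + u) / 8) ^ 4 / exp ((1 + u) / 8))) \<longlongrightarrow> 2 * 8 ^ 4 * exp (1 / 8) * 0) at_top"
    by (intro tendsto_intros filterlim_compose[OF tendsto_power_div_exp_0 f])
  moreover have "2 * 8 ^ 4 * exp (1 / 8) * (((1 + u) / 8) ^ 4 / exp ((1 + u) / 8)) = (1 + u) ^ 4 * (2 * exp (- (1 / 8 * u)))" for u :: real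
  proof -
    have "exp ((1 + u) / 8) = exp (1 / 8) * exp (1 / 8 * u)" unfolding exp_add[symmetric] by (simp add: add_divide_distrib)
    then show ?thesis by (simp add: power_divide exp_minus field_simps)
  qed
  ultimately show ?thesis by simp
qed

lemma isCont_powr_pos: "0 < u \<Longrightarrow> isCont (\<lambda>u. u powr p) u" for u p :: real
  by (rule DERIV_isCont[OF has_real_derivative_powr])

context stable_step
begin

lemma set_integrable_Ioi_W: "set_integrable lborel {0<..} W"
  using W_integrable by (rule set_integrable_subset) auto

lemma set_integrable_of_W_bound:
  fixes f f' :: "real \<Rightarrow> real"
  assumes "\<And>u. 0 < u \<Longrightarrow> isCont f u" "\<And>u. 0 < u \<Longrightarrow> \<bar>f u\<bar> \<le> c * W u"
  shows "set_integrable lborel {0<..} f" "(LBINT u:{0<..}. \<bar>f u\<bar>) \<le> c * (LBINT u:{0<..}. W u)"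
proof -
  have meas: "(\<lambda>u. indicator {0<..} u *\<^sub>R f u) \<in> borel_measurable borel"
    by (rule borel_measurable_continuous_on_indicator)
       (auto intro!: continuous_at_imp_continuous_on assms(1))
  have cW: "set_integrable lborel {0<..} (\<lambda>u. c * W u)" using set_integrable_Ioi_W by simp
  show i: "set_integrable lborel {0<..} f"
    unfolding set_integrable_def
  proof (rule Bochner_Integration.integrable_bound[OF cW[unfolded set_integrable_def]])
    show "AE u in lborel. norm (indicator {0<..} u *\<^sub>R f u) \<le> norm (indicator {0<..} u *\<^sub>R (c * W u))"
      using assms(2) by (intro AE_I2) (auto simp: indicator_def intro: order_trans abs_ge_self)
  qed (use meas in simp)
  have "(LBINT u:{0<..}. \<bar>f u\<bar>) \<le> (LBINT u:{0<..}. c * W u)"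
    using assms(2) by (intro set_integral_mono set_integrable_abs i cW) auto
  then show "(LBINT u:{0<..}. \<bar>f u\<bar>) \<le> c * (LBINT u:{0<..}. W u)" by simp
qed

lemma kd_isCont: "0 < w \<Longrightarrow> isCont kd w"
  unfolding kd_def[abs_def]
  by (intro isCont_diff isCont_mult isCont_add isCont_divide isCont_power isCont_sin isCont_cos
      isCont_powr_pos continuous_const continuous_ident) auto

lemma isCont_K'': assumes u: "0 < u" shows "isCont K'' u"
proof -
  have su: "0 < s * u" using s u by simp
  have m: "isCont (\<lambda>u. s * u) u" by (intro isCont_mult continuous_const continuous_ident)
  have t: "isCont (\<lambda>u. cos_tail a (s * u)) u"
    by (rule isCont_o2[OF m DERIV_isCont[OF cos_tail_has_derivative[OF su a(2)]]])
  have k: "isCont (\<lambda>u. cos_kernel a (s * u)) u"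
    by (rule isCont_o2[OF m DERIV_isCont[OF cos_kernel_has_derivative[OF su]]])
  have d: "isCont (\<lambda>u. kd (s * u)) u"
    by (rule isCont_o2[OF m kd_isCont[OF su]])
  note p = isCont_powr_pos[OF u]
  have e: "isCont (\<lambda>u. exp (- (g * u powr a))) u"
    by (intro isCont_exp' isCont_minus isCont_mult continuous_const p)
  have J: "isCont J'' u" unfolding J''_def[abs_def]
    by (intro isCont_add isCont_mult continuous_const t k d p)
  have X: "isCont X'' u" unfolding X''_def[abs_def]
    by (intro isCont_add isCont_diff isCont_mult isCont_divide isCont_power continuous_const continuous_ident e p) (use u in auto)
  have E: "isCont E u" using E_deriv[OF u] by (rule DERIV_isCont)
  have E'': "isCont E'' u" unfolding E''_def[abs_def]
    by (intro isCont_diff isCont_mult continuous_const p E)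
  show ?thesis
    unfolding K''_def[abs_def] G''_def[abs_def]
    by (intro isCont_add isCont_diff isCont_minus isCont_mult continuous_const J X E E''
        DERIV_isCont[OF E'_deriv[OF u]] DERIV_isCont[OF G_deriv[OF u]] DERIV_isCont[OF G'_deriv[OF u]])
qed

text \<open>The L1 bound is s squared times a constant independent of g. As s squared is
  proportional to \<open>g powr (2 / a)\<close> in the scheme, this is where the rate of one step
  arises.\<close>

lemma sine_kernel_K: "sine_kernel K K' K'' (320 * M * s\<^sup>2 * (LBINT u:{0<..}. W u))"
proof
  have E1: "E u \<le> 1" if "0 < u" for u
    using ba(3) by (simp add: E_def)
  show "set_integrable lborel {0<..} K" "(LBINT u:{0<..}. \<bar>K u\<bar>) \<le> 320 * M * s\<^sup>2 * (LBINT u:{0<..}. W u)"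
    by (rule set_integrable_of_W_bound[OF DERIV_isCont[OF K_deriv] K_W]; assumption)+
  show "set_integrable lborel {0<..} K''" "(LBINT u:{0<..}. \<bar>K'' u\<bar>) \<le> 320 * M * s\<^sup>2 * (LBINT u:{0<..}. W u)"
    by (rule set_integrable_of_W_bound[OF isCont_K'' K''_W]; assumption)+
  have ev0: "eventually (\<lambda>u::real. 0 < u) (at_right 0)" by (simp add: eventually_at_right_less)
  have m: "0 \<le> M * s\<^sup>2" using M_pos by simp
  show "(K \<longlongrightarrow> 0) (at_right 0)"
  proof (rule Lim_null_comparison)
    have "((\<lambda>u. M * s\<^sup>2 * (1 * (u * (1 + u)\<^sup>2))) \<longlongrightarrow> M * s\<^sup>2 * (1 * (0 * (1 + 0)\<^sup>2))) (at_right 0)"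
      by (intro tendsto_intros)
    then show "((\<lambda>u. M * s\<^sup>2 * (1 * (u * (1 + u)\<^sup>2))) \<longlongrightarrow> 0) (at_right 0)" by simp
    show "\<forall>\<^sub>F u in at_right 0. norm (K u) \<le> M * s\<^sup>2 * (1 * (u * (1 + u)\<^sup>2))"
      using ev0
    proof eventually_elim
      case (elim u)
      have "M * s\<^sup>2 * (E u * (u * (1 + u)\<^sup>2)) \<le> M * s\<^sup>2 * (1 * (u * (1 + u)\<^sup>2))"
        using E1[OF elim] elim m by (intro mult_left_mono mult_right_mono) auto
      then show ?case using K_bound[OF elim] by simp
    qed
  qed
  show "((\<lambda>u. u * K' u) \<longlongrightarrow> 0) (at_right 0)"
  proof (rule Lim_null_comparison)
    have "((\<lambda>u. u * (2 * M * s\<^sup>2 * (1 * (1 + u) ^ 4))) \<longlongrightarrow> 0 * (2 * M * s\<^sup>2 * (1 * (1 + 0) ^ 4))) (at_right 0)"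
      by (intro tendsto_intros)
    then show "((\<lambda>u. u * (2 * M * s\<^sup>2 * (1 * (1 + u) ^ 4))) \<longlongrightarrow> 0) (at_right 0)" by simp
    show "\<forall>\<^sub>F u in at_right 0. norm (u * K' u) \<le> u * (2 * M * s\<^sup>2 * (1 * (1 + u) ^ 4))"
      using ev0
    proof eventually_elim
      case (elim u)
      have "2 * M * s\<^sup>2 * (E u * (1 + u) ^ 4) \<le> 2 * M * s\<^sup>2 * (1 * (1 + u) ^ 4)"
        using E1[OF elim] elim m by (intro mult_left_mono mult_right_mono) auto
      then have "\<bar>K' u\<bar> \<le> 2 * M * s\<^sup>2 * (1 * (1 + u) ^ 4)" using K'_bound[OF elim] by linarith
      then have "u * \<bar>K' u\<bar> \<le> u * (2 * M * s\<^sup>2 * (1 * (1 + u) ^ 4))" using elim by (intro mult_left_mono) auto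
      then show ?case using elim by (simp add: abs_mult)
    qed
  qed
  have evt: "eventually (\<lambda>u::real. 0 < u) at_top" by (rule eventually_gt_at_top)
  have L: "((\<lambda>u. 2 * M * s\<^sup>2 * ((1 + u) ^ 4 * (2 * exp (- (1 / 8 * u))))) \<longlongrightarrow> 0) at_top"
    using tendsto_mult_right_zero[OF power4_exp_tendsto] .
  have Eu: "E u * (1 + u) ^ 4 \<le> (1 + u) ^ 4 * (2 * exp (- (1 / 8 * u)))" if "0 < u" for u
    using mult_left_mono[OF E_le[OF that], of "(1 + u) ^ 4"] that by (simp add: mult.commute)
  show "(K' \<longlongrightarrow> 0) at_top"
  proof (rule Lim_null_comparison[OF _ L])
    show "\<forall>\<^sub>F u in at_top. norm (K' u) \<le> 2 * M * s\<^sup>2 * ((1 + u) ^ 4 * (2 * exp (- (1 / 8 * u))))"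
      using evt
    proof eventually_elim
      case (elim u)
      have "2 * M * s\<^sup>2 * (E u * (1 + u) ^ 4) \<le> 2 * M * s\<^sup>2 * ((1 + u) ^ 4 * (2 * exp (- (1 / 8 * u))))"
        using m by (intro mult_left_mono Eu elim) auto
      then show ?case unfolding real_norm_def by (rule order_trans[OF K'_bound[OF elim]])
    qed
  qed
  show "(K \<longlongrightarrow> 0) at_top"
  proof (rule Lim_null_comparison[OF _ L])
    show "\<forall>\<^sub>F u in at_top. norm (K u) \<le> 2 * M * s\<^sup>2 * ((1 + u) ^ 4 * (2 * exp (- (1 / 8 * u))))"
      using evt
    proof eventually_elim
      case (elim u)
      have "u * (1 + u)\<^sup>2 \<le> (1 + u)\<^sup>2 * (1 + u)\<^sup>2"
        using elim by (intro mult_right_mono) (auto simp: power2_eq_square algebra_simps)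
      also have "\<dots> = (1 + u) ^ 4" by (simp flip: power_add)
      finally have "E u * (u * (1 + u)\<^sup>2) \<le> (1 + u) ^ 4 * (2 * exp (- (1 / 8 * u)))"
        using mult_left_mono[of "u * (1 + u)\<^sup>2" "(1 + u) ^ 4" "E u"] E_pos[of u] Eu[OF elim] by linarith
      then have "M * s\<^sup>2 * (E u * (u * (1 + u)\<^sup>2)) \<le> M * s\<^sup>2 * ((1 + u) ^ 4 * (2 * exp (- (1 / 8 * u))))"
        using m by (rule mult_left_mono)
      moreover have "0 \<le> M * s\<^sup>2 * ((1 + u) ^ 4 * (2 * exp (- (1 / 8 * u))))"
        using elim by (intro mult_nonneg_nonneg[OF m] mult_nonneg_nonneg) auto
      ultimately show ?case unfolding real_norm_def mult.assoc[of 2] using K_bound[OF elim] by linarith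
    qed
  qed
qed (use K_deriv K'_deriv isCont_K'' in auto)

end

section \<open>The comparison law and the one-step estimate\<close>

text \<open>Both bounds are instances of Young's inequality: the lower one with weights 1/a and 1 -
  1/a, the upper one for the exponent a - 1 in (0, 1), multiplied by the remaining factor 1 -
  g.\<close>

lemma powr_one_minus_bounds:
  fixes a g :: real
  assumes a: "1 < a" "a < 2" and g: "0 \<le> g" "g < 1"
  shows "1 - a * g \<le> (1 - g) powr a" "(1 - g) powr a \<le> 1 - a * g + g\<^sup>2"
proof -
  have "((1 - g) powr a) powr (1 / a) * 1 powr (1 - 1 / a) \<le> 1 / a * (1 - g) powr a + (1 - 1 / a) * 1"
    using a g by (intro Youngs_inequality_0) auto
  then have "1 - g \<le> 1 / a * (1 - g) powr a + (1 - 1 / a)" using a g by (simp add: powr_powr)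
  then have "a * (1 - g) \<le> a * (1 / a * (1 - g) powr a + (1 - 1 / a))" using a by (intro mult_left_mono) auto
  also have "\<dots> = (1 - g) powr a + a - 1" using a by (simp add: distrib_left right_diff_distrib)
  finally show "1 - a * g \<le> (1 - g) powr a" by (simp add: algebra_simps)
  have "(1 - g) powr (a - 1) * 1 powr (2 - a) \<le> (a - 1) * (1 - g) + (2 - a) * 1"
    using a g by (intro Youngs_inequality_0) auto
  then have "(1 - g) powr (a - 1) \<le> 1 - (a - 1) * g" by (simp add: algebra_simps)
  then have "(1 - g) * (1 - g) powr (a - 1) \<le> (1 - g) * (1 - (a - 1) * g)"
    using g by (intro mult_left_mono) auto
  moreover have "(1 - g) * (1 - g) powr (a - 1) = (1 - g) powr a"
    using g powr_add[of "1 - g" 1 "a - 1"] by simp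
  moreover have "(1 - g) * (1 - (a - 1) * g) = 1 - a * g + (a - 1) * g\<^sup>2"
    by (simp add: algebra_simps power2_eq_square)
  moreover have "(a - 1) * g\<^sup>2 \<le> 1 * g\<^sup>2" using a by (intro mult_right_mono) auto
  ultimately show "(1 - g) powr a \<le> 1 - a * g + g\<^sup>2" by simp
qed

lemma
  assumes nu: "real_distribution \<nu>"
  shows real_distribution_distr_scale: "real_distribution (distr \<nu> borel (\<lambda>x. c * x))"
    and char_distr_scale: "char (distr \<nu> borel (\<lambda>x. c * x)) u = char \<nu> (c * u)"
proof -
  interpret real_distribution \<nu> by (rule nu)
  have m: "(\<lambda>x. c * x) \<in> borel_measurable \<nu>" by measurable
  show "real_distribution (distr \<nu> borel (\<lambda>x. c * x))" using m by (rule real_distribution_distr)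
  show "char (distr \<nu> borel (\<lambda>x. c * x)) u = char \<nu> (c * u)"
    unfolding char_def using m by (subst integral_distr) (auto simp: mult_ac)
qed

lemma
  fixes h :: "real \<Rightarrow> real"
  assumes nu: "real_distribution \<nu>" and h: "h \<in> borel_measurable borel"
  shows integrable_distr_scale_iff: "integrable (distr \<nu> borel (\<lambda>x. c * x)) h \<longleftrightarrow> integrable \<nu> (\<lambda>x. h (c * x))"
    and integral_distr_scale: "(\<integral>x. h x \<partial>distr \<nu> borel (\<lambda>x. c * x)) = (\<integral>x. h (c * x) \<partial>\<nu>)"
proof -
  interpret real_distribution \<nu> by (rule nu)
  have m: "(\<lambda>x. c * x) \<in> borel_measurable \<nu>" by measurable
  show "integrable (distr \<nu> borel (\<lambda>x. c * x)) h \<longleftrightarrow> integrable \<nu> (\<lambda>x. h (c * x))"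
    using m h by (rule integrable_distr_eq)
  show "(\<integral>x. h x \<partial>distr \<nu> borel (\<lambda>x. c * x)) = (\<integral>x. h (c * x) \<partial>\<nu>)"
    using m h by (rule integral_distr)
qed

text \<open>The comparison law \<open>\<kappa> V\<close>, with \<open>V\<close> distributed as \<open>\<nu>\<close>, is the law of one step driven by stable noise.\<close>

lemma lipschitz_one_step_le:
  fixes a :: real
  assumes a: "1 < a" "a < 2" and nu: "real_distribution \<nu>"
    and char_nu: "\<And>u. char \<nu> u = of_real (exp (- (1 / a) * \<bar>u\<bar> powr a))"
  obtains C where "0 < C" "\<And>g h. 0 < g \<Longrightarrow> g \<le> 1 / 2 \<Longrightarrow> 1-lipschitz_on UNIV h \<Longrightarrow>
     \<bar>(\<integral>x. h x \<partial>lin_law (1 - g) (g powr (1 / a) / pareto_scale a) \<nu> (pareto_law a)) - (\<integral>x. h x \<partial>\<nu>)\<bar> \<le> C * g powr (2 / a)"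
proof -
  interpret N: real_distribution \<nu> by (rule nu)
  have pl: "real_distribution (pareto_law a)" using a by (intro real_distribution_pareto_law) simp
  have int_nu: "integrable \<nu> (\<lambda>x. x)" using nu a char_nu by (rule integrable_real_distribution_ident)
  define m where "m = (\<integral>x. \<bar>x\<bar> \<partial>\<nu>)"
  define \<beta> where "\<beta> = pareto_scale a"
  have sc: "0 < stable_const a" using a by (intro stable_const_pos) auto
  have beta: "0 < \<beta>" "\<beta> powr a = a / (2 * stable_const a)"
    using sc a by (auto simp: \<beta>_def pareto_scale_def powr_powr)
  \<comment> \<open>The first summand yields g squared \<le> \<open>g powr (2 / a)\<close> = \<beta>
    squared times s squared, the second yields s squared \<le> 1 over \<beta> squared; these are the
    two conditions on B.\<close>
  define B where "B = \<beta>\<^sup>2 + 1 / \<beta>\<^sup>2"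
  define Wi where "Wi = (LBINT u:{0<..}. (u powr (2 * a - 2 - 1) + u powr (1 - 1) + u powr (6 - 1)) * exp (- (1 / 8 * u)))"
  \<comment> \<open>The first term is the sine transform bound, m pays for the rescaling by
    \<open>\<kappa>\<close>, and 1 ensures positivity.\<close>
  define C where "C = 2 * (320 * (a / (2 * (2 - a)) + 13 * B) * Wi) / \<beta>\<^sup>2 + m + 1"
  have m0: "0 \<le> m" by (simp add: m_def)
  have B0: "0 < B" using beta by (simp add: B_def add_pos_pos)
  have Wi0: "0 \<le> Wi" unfolding Wi_def set_lebesgue_integral_def by (rule integral_nonneg_AE) (auto intro!: mult_nonneg_nonneg add_nonneg_nonneg)
  have C0: "0 < C" unfolding C_def using m0 B0 Wi0 a by (intro add_nonneg_pos add_nonneg_nonneg divide_nonneg_nonneg mult_nonneg_nonneg) auto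
  show ?thesis
  proof (rule that[OF C0])
    fix g :: real and h :: "real \<Rightarrow> real"
    assume g: "0 < g" "g \<le> 1 / 2" and h: "1-lipschitz_on UNIV h"
    define s where "s = g powr (1 / a) / \<beta>"
    have s: "0 < s" using g beta by (simp add: s_def)
    have s2: "s\<^sup>2 = g powr (2 / a) / \<beta>\<^sup>2"
      using g by (simp add: s_def power_divide powr_power)
    have gle: "g\<^sup>2 \<le> g powr (2 / a)" "g powr (2 / a) \<le> 1"
    proof -
      have "2 / a \<le> 2" using a by (simp add: divide_le_eq)
      then have "g powr 2 \<le> g powr (2 / a)" using g by (intro powr_mono') auto
      then show "g\<^sup>2 \<le> g powr (2 / a)" using g by (simp add: powr_numeral)
      show "g powr (2 / a) \<le> 1" using g a by (intro powr_le1) auto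
    qed
    have sa: "a / (2 * stable_const a) * s powr a = g"
      using g beta a by (simp add: s_def powr_divide powr_powr beta(2)[symmetric])
    interpret S: stable_step a g s B
    proof
      have "B * s\<^sup>2 = \<beta>\<^sup>2 * s\<^sup>2 + 1 / \<beta>\<^sup>2 * s\<^sup>2" by (simp only: B_def distrib_right)
      moreover have "\<beta>\<^sup>2 * s\<^sup>2 = g powr (2 / a)" using beta by (simp add: s2)
      ultimately have "B * s\<^sup>2 = g powr (2 / a) + 1 / \<beta>\<^sup>2 * s\<^sup>2" by simp
      then show "g\<^sup>2 \<le> B * s\<^sup>2" using gle by (simp add: add_increasing2)
      have "s\<^sup>2 \<le> 1 / \<beta>\<^sup>2" unfolding s2 using gle by (intro divide_right_mono) auto
      then show "s\<^sup>2 \<le> B" by (simp add: B_def add_increasing)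
    qed (use a g s in auto)
    \<comment> \<open>Scaling by \<open>\<kappa>\<close> multiplies the exponent of
      \<open>\<nu>\<close> by \<open>\<kappa> powr a\<close>; this value produces the damping factor
      of the starting point times \<open>exp (- (g * u powr a))\<close>.\<close>
    define \<kappa> where "\<kappa> = ((1 - g) powr a + a * g) powr (1 / a)"
    define \<mu> where "\<mu> = distr \<nu> borel (\<lambda>x. \<kappa> * x)"
    have ka: "1 \<le> (1 - g) powr a + a * g" "(1 - g) powr a + a * g \<le> 1 + g\<^sup>2"
      using powr_one_minus_bounds[OF a, of g] g by auto
    have kap: "\<kappa> powr a = (1 - g) powr a + a * g" "1 \<le> \<kappa>"
    proof -
      show "\<kappa> powr a = (1 - g) powr a + a * g" using ka a by (simp add: \<kappa>_def powr_powr)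
      show "1 \<le> \<kappa>" using ka a by (simp add: \<kappa>_def ge_one_powr_ge_zero)
    qed
    \<comment> \<open>As \<kappa> \<ge> 1, this gives \<kappa> - 1 \<le> g squared: replacing
      \<open>\<nu>\<close> by the comparison law moves mass by a second-order amount, which
      \<open>g powr (2 / a)\<close> dominates.\<close>
    have "\<kappa> powr 1 \<le> \<kappa> powr a" using kap a by (intro powr_mono) auto
    then have kle: "\<kappa> - 1 \<le> g\<^sup>2" using kap ka by simp
    have mu: "real_distribution \<mu>" unfolding \<mu>_def using nu by (rule real_distribution_distr_scale)
    have int_mu: "integrable \<mu> (\<lambda>x. x)" unfolding \<mu>_def
      by (subst integrable_distr_scale_iff[OF nu]) (simp, intro integrable_mult_right int_nu)
    define T where "T = lin_law (1 - g) s \<nu> (pareto_law a)"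
    have T: "real_distribution T" unfolding T_def by (rule real_distribution_lin_law[OF nu pl])
    have int_T: "integrable T (\<lambda>x. x)"
      unfolding T_def using a by (intro integrable_lin_law nu pl int_nu integrable_pareto_law) auto
    interpret SL: sine_kernel_laws S.K S.K' S.K'' "320 * S.M * s\<^sup>2 * (LBINT u:{0<..}. S.W u)" T \<mu>
    proof (intro sine_kernel_laws.intro S.sine_kernel_K sine_kernel_laws_axioms.intro T mu)
      fix u :: real assume u: "0 < u"
      have cT: "char T u = of_real (S.E u * pareto_symbol a (s * u))"
      proof -
        have "(1 / a) * \<bar>(1 - g) * u\<bar> powr a = S.b * u powr a"
          using g u by (simp add: abs_mult powr_mult S.b_def)
        then have "char \<nu> ((1 - g) * u) = of_real (S.E u)" by (simp add: char_nu S.E_def)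
        moreover have "char (pareto_law a) (s * u) = of_real (pareto_symbol a (s * u))"
          using a s u by (intro char_pareto_law) auto
        ultimately show ?thesis unfolding T_def by (simp add: char_lin_law[OF nu pl])
      qed
      have cM: "char \<mu> u = of_real (S.E u * exp (- (g * u powr a)))"
      proof -
        have "(1 / a) * \<bar>\<kappa> * u\<bar> powr a = ((1 - g) powr a + a * g) * u powr a / a"
          using u kap by (simp add: abs_mult powr_mult)
        also have "\<dots> = S.b * u powr a + g * u powr a" using a by (simp add: S.b_def field_simps)
        finally have "- (1 / a) * \<bar>\<kappa> * u\<bar> powr a = - (S.b * u powr a) + - (g * u powr a)" by simp
        then have "exp (- (1 / a) * \<bar>\<kappa> * u\<bar> powr a) = S.E u * exp (- (g * u powr a))"
          unfolding S.E_def exp_add[symmetric] by simp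
        then show ?thesis unfolding \<mu>_def by (subst char_distr_scale[OF nu]) (simp only: char_nu)
      qed
      have sym: "pareto_symbol a (s * u) = 1 - g * u powr a + S.c1 * s\<^sup>2 * u\<^sup>2 - a * s powr a * u powr a * cos_tail a (s * u)"
      proof -
        \<comment> \<open>The role of the scale \<beta>: the order-a term of the Pareto symbol
          becomes exactly that of the stable increment, so it cancels in the difference.\<close>
        have "a / (2 * stable_const a) * (s * u) powr a = g * u powr a"
          using s u by (simp add: powr_mult flip: sa)
        then show ?thesis unfolding pareto_symbol_def S.c1_def using s u by (simp add: powr_mult power_mult_distrib mult_ac)
      qed
      have "u * S.G u = pareto_symbol a (s * u) - exp (- (g * u powr a))"
      proof -
        have "u * u powr (a - 1) = u powr a" using u powr_add[of u 1 "a - 1"] by simp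
        then have "u * S.J u = u powr a * cos_tail a (s * u)" by (simp add: S.J_def mult.assoc[symmetric])
        moreover have "u * S.X u = exp (- (g * u powr a)) - 1 + g * u powr a" using u by (simp add: S.X_def)
        moreover have "u * S.G u = S.c1 * s\<^sup>2 * u\<^sup>2 - a * s powr a * (u * S.J u) - u * S.X u"
          by (simp add: S.G_def algebra_simps power2_eq_square)
        ultimately show ?thesis unfolding sym by simp
      qed
      moreover have "u * S.K u = S.E u * (u * S.G u)" by (simp add: S.K_def)
      ultimately have "u * S.K u = S.E u * pareto_symbol a (s * u) - S.E u * exp (- (g * u powr a))"
        by (simp only: right_diff_distrib)
      then show "char T u - char \<mu> u = of_real (u * S.K u)" unfolding cT cM by simp
    qed
    have 1: "\<bar>(\<integral>x. h x \<partial>T) - (\<integral>x. h x \<partial>\<mu>)\<bar> \<le> 2 * (320 * S.M * s\<^sup>2 * Wi)"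
      using SL.lipschitz_integral_diff_le[OF int_T int_mu h] unfolding Wi_def S.W_def .
    have [measurable]: "h \<in> borel_measurable borel"
      using lipschitz_on_continuous_on[OF h] by (intro borel_measurable_continuous_onI)
    have 2: "\<bar>(\<integral>x. h x \<partial>\<mu>) - (\<integral>x. h x \<partial>\<nu>)\<bar> \<le> g\<^sup>2 * m"
    proof -
      have ih: "integrable \<nu> h" using nu int_nu h by (rule lipschitz_integrable)
      have ihk: "integrable \<nu> (\<lambda>x. h (\<kappa> * x))"
        using lipschitz_integrable[OF mu int_mu h] unfolding \<mu>_def
        by (subst (asm) integrable_distr_scale_iff[OF nu]) simp_all
      have "(\<integral>x. h x \<partial>\<mu>) - (\<integral>x. h x \<partial>\<nu>) = (\<integral>x. h (\<kappa> * x) - h x \<partial>\<nu>)"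
        using ih ihk unfolding \<mu>_def by (subst integral_distr_scale[OF nu]) simp_all
      also have "\<bar>\<dots>\<bar> \<le> (\<integral>x. \<bar>h (\<kappa> * x) - h x\<bar> \<partial>\<nu>)" by (rule integral_abs_bound)
      also have "\<dots> \<le> (\<integral>x. g\<^sup>2 * \<bar>x\<bar> \<partial>\<nu>)"
      proof (rule integral_mono)
        fix x
        have "\<bar>h (\<kappa> * x) - h x\<bar> \<le> \<bar>\<kappa> * x - x\<bar>"
          using lipschitz_onD[OF h, of "\<kappa> * x" x] by (simp add: dist_real_def)
        also have "\<kappa> * x - x = (\<kappa> - 1) * x" by (simp add: algebra_simps)
        also have "\<bar>(\<kappa> - 1) * x\<bar> \<le> g\<^sup>2 * \<bar>x\<bar>" using kap kle by (simp add: abs_mult mult_right_mono)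
        finally show "\<bar>h (\<kappa> * x) - h x\<bar> \<le> g\<^sup>2 * \<bar>x\<bar>" .
      qed (use ih ihk int_nu in auto)
      also have "\<dots> = g\<^sup>2 * m" by (simp add: m_def)
      finally show ?thesis .
    qed
    have 3: "g\<^sup>2 * m \<le> m * g powr (2 / a)" using gle m0 by (simp add: mult.commute mult_left_mono)
    have 4: "2 * (320 * S.M * s\<^sup>2 * Wi) = 2 * (320 * (a / (2 * (2 - a)) + 13 * B) * Wi) / \<beta>\<^sup>2 * g powr (2 / a)"
      unfolding S.M_def S.c1_def s2 by simp
    have "\<bar>(\<integral>x. h x \<partial>T) - (\<integral>x. h x \<partial>\<nu>)\<bar> \<le> C * g powr (2 / a)"
      using 1 2 3 powr_ge_zero[of g "2 / a"] unfolding 4 C_def distrib_right by linarith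
    then show "\<bar>(\<integral>x. h x \<partial>lin_law (1 - g) (g powr (1 / a) / pareto_scale a) \<nu> (pareto_law a)) - (\<integral>x. h x \<partial>\<nu>)\<bar> \<le> C * g powr (2 / a)"
      by (simp add: T_def s_def \<beta>_def)
  qed
qed

section \<open>Rates for the whole scheme\<close>

text \<open>From 1 - cos y \<le> \<bar>y\<bar>. It supplies a linear lower bound for a law about
  which only the first moment is known, and with it the base of the induction.\<close>

lemma Re_char_ge:
  assumes mu: "real_distribution \<mu>" and int: "integrable \<mu> (\<lambda>x. x)" and v: "0 \<le> v"
  shows "1 - v * (\<integral>x. \<bar>x\<bar> \<partial>\<mu>) \<le> Re (char \<mu> v)"
proof -
  interpret real_distribution \<mu> by (rule mu)
  have c: "1 - cos y \<le> \<bar>y\<bar>" for y :: real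
  proof -
    have "1 - cos y = 2 * (sin (y / 2))\<^sup>2" using cos_double_sin[of "y / 2"] by simp
    also have "\<dots> = 2 * (\<bar>sin (y / 2)\<bar> * \<bar>sin (y / 2)\<bar>)" by (simp add: power2_eq_square)
    also have "\<dots> \<le> 2 * (\<bar>y / 2\<bar> * 1)" using abs_sin_x_le_abs_x[of "y / 2"] by (intro mult_left_mono mult_mono) auto
    finally show ?thesis by simp
  qed
  have i: "integrable \<mu> (\<lambda>x. cos (v * x))" by (rule integrable_const_bound[of _ 1]) auto
  have "Re (char \<mu> v) = (\<integral>x. cos (v * x) \<partial>\<mu>)"
    unfolding char_def by (subst integral_Re[symmetric]) (auto intro!: integrable_const_bound[of _ 1] simp: Re_exp)
  moreover have "(\<integral>x. 1 - v * \<bar>x\<bar> \<partial>\<mu>) \<le> (\<integral>x. cos (v * x) \<partial>\<mu>)"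
  proof (rule integral_mono)
    fix x show "1 - v * \<bar>x\<bar> \<le> cos (v * x)" using c[of "v * x"] v by (simp add: abs_mult)
  qed (use int i in auto)
  moreover have "(\<integral>x. 1 - v * \<bar>x\<bar> \<partial>\<mu>) = 1 - v * (\<integral>x. \<bar>x\<bar> \<partial>\<mu>)"
    using int prob_space by (simp del: space_eq_univ)
  ultimately show ?thesis by simp
qed

text \<open>The quadratic coefficient is at least 1/2 because \<open>a > 1\<close>, and for w \<le>
  1 the remainder takes away at most 1/24 of w squared; 1/4 is a convenient lower value.\<close>

lemma pareto_symbol_ge:
  assumes a: "1 < a" "a < 2" and w: "0 < w" "w \<le> 1"
  shows "1 - a / (2 * stable_const a) * w powr a + w\<^sup>2 / 4 \<le> pareto_symbol a w"
proof -
  have "1 / 2 \<le> a / (2 * (2 - a))" using a by (simp add: field_simps)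
  then have 1: "1 / 2 * w\<^sup>2 \<le> a / (2 * (2 - a)) * w\<^sup>2" by (intro mult_right_mono) auto
  have "a * w powr a * cos_tail a w \<le> 2 * w powr a * (w powr (4 - a) / 48)"
    using cos_tail_bounds[of w a] a w by (intro mult_mono) auto
  also have "\<dots> = (w powr a * w powr (4 - a)) / 24" by simp
  also have "w powr a * w powr (4 - a) = w powr 4" by (simp add: powr_add[symmetric])
  also have "\<dots> \<le> w powr 2" using w by (intro powr_mono') auto
  also have "\<dots> = w\<^sup>2" using w by (simp add: powr_numeral)
  finally have 2: "a * w powr a * cos_tail a w \<le> w\<^sup>2 / 24" by simp
  have "0 \<le> w\<^sup>2" by simp
  then show ?thesis unfolding pareto_symbol_def using 1 2 by linarith
qed

text \<open>The new characteristic function is the old one at v = (1 - g) u times the symbol R,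
  where 1 - g \<le> R \<le> 1. The quadratic term loses two factors 1 - g through v and one through
  R, while the linear term is multiplied by at most 1 - g. The quadratic part of R gives the gain,
  and second-order errors are moved into the linear term because \<open>u powr a\<close> \<le> u on
  (0, 1].\<close>

lemma char_lower_step:
  fixes a g q D :: real
  assumes a: "1 < a" "a < 2" and g: "0 < g" "g \<le> 1 / 2" and s1: "g powr (1 / a) / pareto_scale a \<le> 1"
    and mu: "real_distribution \<mu>" and q: "0 \<le> q" and D: "0 \<le> D"
    and IH: "\<And>v. 0 < v \<Longrightarrow> v \<le> 1 \<Longrightarrow> q * v\<^sup>2 - D * v \<le> Re (char \<mu> v) - exp (- (1 / a) * v powr a)"
    and u: "0 < u" "u \<le> 1"
  shows "((1 - g) ^ 3 * q + exp (- 1) / (4 * (pareto_scale a)\<^sup>2) * g powr (2 / a)) * u\<^sup>2 - ((1 - g) * D + 2 * g\<^sup>2) * u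
    \<le> Re (char (lin_law (1 - g) (g powr (1 / a) / pareto_scale a) \<mu> (pareto_law a)) u) - exp (- (1 / a) * u powr a)"
proof -
  have pl: "real_distribution (pareto_law a)" using a by (intro real_distribution_pareto_law) simp
  define \<beta> where "\<beta> = pareto_scale a"
  have sc: "0 < stable_const a" using a by (intro stable_const_pos) auto
  have beta: "0 < \<beta>" "\<beta> powr a = a / (2 * stable_const a)"
    using sc a by (auto simp: \<beta>_def pareto_scale_def powr_powr)
  define s where "s = g powr (1 / a) / \<beta>"
  have s: "0 < s" "s \<le> 1" using g beta s1 by (auto simp: s_def \<beta>_def)
  have s2: "s\<^sup>2 = g powr (2 / a) / \<beta>\<^sup>2" using g by (simp add: s_def power_divide powr_power)
  have sa: "a / (2 * stable_const a) * s powr a = g"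
    using g beta a by (simp add: s_def powr_divide powr_powr beta(2)[symmetric])
  define w where "w = s * u"
  have w: "0 < w" "w \<le> 1" using s u by (auto simp: w_def mult_le_one)
  define x where "x = u powr a"
  have x: "0 < x" "x \<le> u" "x \<le> 1"
  proof -
    show "0 < x" using u by (simp add: x_def)
    have "u powr a \<le> u powr 1" using u a by (intro powr_mono') auto
    then show "x \<le> u" using u by (simp add: x_def)
    then show "x \<le> 1" using u by simp
  qed
  define R where "R = pareto_symbol a w"
  have R1: "R \<le> 1" unfolding R_def using a w by (intro pareto_symbol_le_1) auto
  have "a / (2 * stable_const a) * w powr a = g * x"
    using s u by (simp add: w_def x_def powr_mult flip: sa)
  then have Rge: "1 - g * x + w\<^sup>2 / 4 \<le> R"
    using pareto_symbol_ge[OF a w] by (simp add: R_def)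
  have gx: "g * x \<le> g" using g x by (simp add: mult_left_le)
  have Rg: "1 - g \<le> R" using Rge gx zero_le_power2[of w] by linarith
  define v where "v = (1 - g) * u"
  have v: "0 < v" "v \<le> 1" using g u by (auto simp: v_def mult_le_one)
  define \<phi> where "\<phi> = exp (- (1 / a) * v powr a)"
  have va: "v powr a = (1 - g) powr a * x" using g u by (simp add: v_def x_def powr_mult)
  have phi: "exp (- 1) \<le> \<phi>" "\<phi> \<le> 1"
  proof -
    have "(1 / a) * v powr a \<le> 1 * 1" using a v by (intro mult_mono powr_le1) auto
    then show "exp (- 1) \<le> \<phi>" by (simp add: \<phi>_def)
    show "\<phi> \<le> 1" using a by (simp add: \<phi>_def)
  qed
  \<comment> \<open>The exact increment of the exponent between (1 - g) u and u; it differs from g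
    by at most g squared, so the stable factor agrees with \<open>1 - g * x\<close> up to second
    order.\<close>
  define \<delta> where "\<delta> = (1 - (1 - g) powr a) / a"
  have pb: "1 - a * g \<le> (1 - g) powr a" "(1 - g) powr a \<le> 1 - a * g + g\<^sup>2"
    using powr_one_minus_bounds[OF a, of g] g by auto
  have \<delta>: "\<delta> \<le> g" "g - g\<^sup>2 \<le> \<delta>"
  proof -
    show "\<delta> \<le> g" using pb a by (simp add: \<delta>_def divide_le_eq mult.commute)
    have "g\<^sup>2 * 1 \<le> g\<^sup>2 * a" using a by (intro mult_left_mono) auto
    then show "g - g\<^sup>2 \<le> \<delta>" using pb a by (simp add: \<delta>_def le_divide_eq algebra_simps)
  qed
  have \<delta>0: "0 \<le> \<delta>"
  proof -
    have "g * g \<le> g * 1" using g by (intro mult_left_mono) auto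
    then show ?thesis using \<delta> by (simp add: power2_eq_square)
  qed
  have uphi: "exp (- (1 / a) * u powr a) = \<phi> * exp (- (\<delta> * x))"
    unfolding \<phi>_def exp_add[symmetric] va x_def[symmetric] \<delta>_def using a by (simp add: field_simps)
  have e: "exp (- (\<delta> * x)) \<le> 1 - g * x + 2 * g\<^sup>2 * x"
  proof -
    have "exp (- (\<delta> * x)) - 1 + \<delta> * x \<le> (\<delta> * x)\<^sup>2 / 2" using \<delta>0 x by (intro exp_remainder_bounds) auto
    also have "(\<delta> * x)\<^sup>2 \<le> g\<^sup>2 * x"
    proof -
      have "(\<delta> * x)\<^sup>2 = \<delta>\<^sup>2 * (x * x)" by (simp add: power2_eq_square)
      also have "\<dots> \<le> g\<^sup>2 * (1 * x)" using \<delta> \<delta>0 x by (intro mult_mono power_mono) auto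
      finally show ?thesis by simp
    qed
    finally have "exp (- (\<delta> * x)) \<le> 1 - \<delta> * x + g\<^sup>2 * x / 2" by simp
    moreover have "(g - g\<^sup>2) * x \<le> \<delta> * x" using \<delta> x by (intro mult_right_mono) auto
    moreover have "0 \<le> g\<^sup>2 * x" using x by simp
    ultimately show ?thesis by (simp add: algebra_simps)
  qed
  have "\<phi> * (w\<^sup>2 / 4 - 2 * g\<^sup>2 * x) \<le> \<phi> * (R - exp (- (\<delta> * x)))"
    using Rge e phi(1) exp_gt_zero[of "- 1 :: real"] by (intro mult_left_mono) linarith+
  moreover have "exp (- 1) * (w\<^sup>2 / 4) - 2 * g\<^sup>2 * u \<le> \<phi> * (w\<^sup>2 / 4 - 2 * g\<^sup>2 * x)"
  proof -
    have "exp (- 1) * (w\<^sup>2 / 4) \<le> \<phi> * (w\<^sup>2 / 4)" using phi by (intro mult_right_mono) auto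
    moreover have "\<phi> * (2 * g\<^sup>2 * x) \<le> 1 * (2 * g\<^sup>2 * u)" using phi x by (intro mult_mono) auto
    ultimately show ?thesis by (simp add: right_diff_distrib)
  qed
  ultimately have main: "exp (- 1) * (w\<^sup>2 / 4) - 2 * g\<^sup>2 * u \<le> R * \<phi> - exp (- (1 / a) * u powr a)"
    unfolding uphi by (simp add: algebra_simps)
  have w2: "exp (- 1) * (w\<^sup>2 / 4) = exp (- 1) / (4 * \<beta>\<^sup>2) * g powr (2 / a) * u\<^sup>2"
    by (simp add: w_def power_mult_distrib s2)
  have "char (lin_law (1 - g) s \<mu> (pareto_law a)) u = char \<mu> v * of_real R"
    using a w unfolding char_lin_law[OF mu pl] v_def R_def w_def by (simp add: char_pareto_law)
  then have Re: "Re (char (lin_law (1 - g) s \<mu> (pareto_law a)) u) = Re (char \<mu> v) * R" by simp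
  have "(\<phi> + (q * v\<^sup>2 - D * v)) * R \<le> Re (char \<mu> v) * R"
    using IH[OF v] Rg g by (intro mult_right_mono) (auto simp: \<phi>_def)
  moreover have "(1 - g) * (q * v\<^sup>2) \<le> R * (q * v\<^sup>2)" using Rg q by (intro mult_right_mono) auto
  moreover have "R * (D * v) \<le> 1 * (D * v)" using R1 D v by (intro mult_right_mono) auto
  moreover have "(\<phi> + (q * v\<^sup>2 - D * v)) * R = R * \<phi> + R * (q * v\<^sup>2) - R * (D * v)" by (simp add: algebra_simps)
  ultimately have "R * \<phi> + (1 - g) * (q * v\<^sup>2) - D * v \<le> Re (char \<mu> v) * R" by linarith
  moreover have "(1 - g) * (q * v\<^sup>2) = (1 - g) ^ 3 * q * u\<^sup>2" by (simp add: v_def power_mult_distrib power2_eq_square power3_eq_cube)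
  moreover have "D * v = (1 - g) * D * u" by (simp add: v_def)
  ultimately show ?thesis
    using main unfolding s_def[symmetric] \<beta>_def[symmetric] Re w2 distrib_right by linarith
qed

section \<open>Recursion, contraction and induction along the scheme\<close>

text \<open>A discrete Gronwall argument. Once the perturbation is at most d/8, the value d/4 is a
  fixed point of the dominating recursion; the excess over it contracts by 1 - h/2 \<le>
  \<open>exp (- h / 2)\<close> and dies out since the steps sum to infinity.\<close>

lemma recursion_tendsto_0:
  fixes x g \<epsilon> :: "nat \<Rightarrow> real"
  assumes x0: "\<And>n. n \<ge> m \<Longrightarrow> 0 \<le> x n" and g: "\<And>n. n \<ge> m \<Longrightarrow> 0 \<le> g (Suc n)" "\<And>n. n \<ge> m \<Longrightarrow> g (Suc n) \<le> 1"
    and rec: "\<And>n. n \<ge> m \<Longrightarrow> x (Suc n) \<le> (1 - g (Suc n) / 2) * x n + g (Suc n) * \<epsilon> (Suc n)"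
    and eps: "\<epsilon> \<longlonglongrightarrow> 0" and div: "filterlim (\<lambda>n. \<Sum>i=1..n. g i) at_top sequentially"
  shows "x \<longlonglongrightarrow> 0"
proof (rule LIMSEQ_I)
  fix d :: real assume d: "0 < d"
  obtain n1 where n1: "n1 \<ge> m" "\<And>n. n \<ge> n1 \<Longrightarrow> \<epsilon> n \<le> d / 8"
  proof -
    have "eventually (\<lambda>n. \<epsilon> n < d / 8) sequentially" using eps d by (intro order_tendstoD(2)) auto
    then obtain k where "\<And>n. n \<ge> k \<Longrightarrow> \<epsilon> n < d / 8" by (auto simp: eventually_sequentially)
    then show ?thesis by (intro that[of "max k m"]) (auto intro: less_imp_le)
  qed
  define A where "A = \<bar>x n1\<bar> * exp ((\<Sum>i=1..n1. g i) / 2)"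
  have bound: "x n - d / 4 \<le> A * exp (- (\<Sum>i=1..n. g i) / 2)" if "n \<ge> n1" for n
    using that
  proof (induction n rule: dec_induct)
    case base
    have "A * exp (- (\<Sum>i=1..n1. g i) / 2) = \<bar>x n1\<bar>" by (simp add: A_def mult.assoc flip: exp_add)
    then show ?case using d by simp
  next
    case (step n)
    define h where "h = g (Suc n)"
    have h: "0 \<le> h" "h \<le> 1" using g step n1 by (auto simp: h_def)
    have "x (Suc n) \<le> (1 - h / 2) * x n + h * (d / 8)"
      using rec[of n] n1 step mult_left_mono[OF n1(2)[of "Suc n"] h(1)] by (simp add: h_def)
    then have "x (Suc n) - d / 4 \<le> (1 - h / 2) * (x n - d / 4)" by (simp add: algebra_simps)
    also have "\<dots> \<le> (1 - h / 2) * (A * exp (- (\<Sum>i=1..n. g i) / 2))"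
      using h step.IH by (intro mult_left_mono) auto
    also have "\<dots> \<le> exp (- h / 2) * (A * exp (- (\<Sum>i=1..n. g i) / 2))"
      using exp_ge_add_one_self[of "- h / 2"] by (intro mult_right_mono) (auto simp: A_def)
    also have "\<dots> = A * exp (- (\<Sum>i=1..Suc n. g i) / 2)"
    proof -
      define S where "S = (\<Sum>i=1..n. g i)"
      have "(\<Sum>i=1..Suc n. g i) = S + h" by (simp add: S_def h_def)
      moreover have "exp (- h / 2) * exp (- S / 2) = exp (- (S + h) / 2)"
        unfolding exp_add[symmetric] by (simp add: add_divide_distrib)
      ultimately show ?thesis unfolding S_def[symmetric] by (simp add: mult.left_commute)
    qed
    finally show ?case .
  qed
  have "((\<lambda>y::real. A * exp (- y / 2)) \<longlongrightarrow> A * 0) at_top"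
  proof (intro tendsto_mult tendsto_const)
    have "filterlim (\<lambda>y::real. (1 / 2) * y) at_top at_top"
      by (rule filterlim_tendsto_pos_mult_at_top[OF tendsto_const _ filterlim_ident]) simp
    then have "filterlim (\<lambda>y::real. - y / 2) at_bot at_top"
      by (simp add: filterlim_uminus_at_top)
    then show "((\<lambda>y::real. exp (- y / 2)) \<longlongrightarrow> 0) at_top" by (rule filterlim_compose[OF exp_at_bot])
  qed
  from filterlim_compose[OF this div] have "(\<lambda>n. A * exp (- (\<Sum>i=1..n. g i) / 2)) \<longlonglongrightarrow> 0" by simp
  then have "eventually (\<lambda>n. A * exp (- (\<Sum>i=1..n. g i) / 2) < d / 4) sequentially"
    using d by (intro order_tendstoD(2)) auto
  then obtain n2 where n2: "\<And>n. n \<ge> n2 \<Longrightarrow> A * exp (- (\<Sum>i=1..n. g i) / 2) < d / 4"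
    by (auto simp: eventually_sequentially)
  show "\<exists>no. \<forall>n\<ge>no. norm (x n - 0) < d"
  proof (intro exI[of _ "max n1 n2"] allI impI)
    fix n assume "max n1 n2 \<le> n"
    then show "norm (x n - 0) < d" using bound[of n] n2[of n] x0[of n] n1(1) d by simp
  qed
qed

text \<open>The same noise is used on both sides: averaging h over the noise gives a function with
  Lipschitz constant r, and dividing by r makes it an admissible test function for the starting
  laws.\<close>

lemma lin_law_contraction:
  fixes h :: "real \<Rightarrow> real"
  assumes mu: "real_distribution \<mu>" "integrable \<mu> (\<lambda>x. x)" and nu: "real_distribution \<nu>" "integrable \<nu> (\<lambda>x. x)"
    and pl: "real_distribution \<eta>" "integrable \<eta> (\<lambda>x. x)" and r: "0 < r"
    and d: "\<And>h. 1-lipschitz_on UNIV h \<Longrightarrow> \<bar>(\<integral>x. h x \<partial>\<mu>) - (\<integral>x. h x \<partial>\<nu>)\<bar> \<le> d"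
    and h: "1-lipschitz_on UNIV h"
  shows "\<bar>(\<integral>x. h x \<partial>lin_law r s \<mu> \<eta>) - (\<integral>x. h x \<partial>lin_law r s \<nu> \<eta>)\<bar> \<le> r * d"
proof -
  interpret P: real_distribution \<eta> by (rule pl)
  define H where "H y = (\<integral>z. h (r * y + s * z) \<partial>\<eta>)" for y
  have hl: "\<bar>h x - h y\<bar> \<le> \<bar>x - y\<bar>" for x y
    using lipschitz_onD[OF h, of x y] by (simp add: dist_real_def)
  have [measurable]: "h \<in> borel_measurable borel"
    using lipschitz_on_continuous_on[OF h] by (intro borel_measurable_continuous_onI)
  have ih: "integrable \<eta> (\<lambda>z. h (r * y + s * z))" for y
  proof (rule lipschitz_integrable[OF pl, where C="\<bar>s\<bar>"])
    show "\<bar>s\<bar>-lipschitz_on UNIV (\<lambda>z. h (r * y + s * z))"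
    proof (rule lipschitz_onI)
      fix z z'
      have "\<bar>h (r * y + s * z) - h (r * y + s * z')\<bar> \<le> \<bar>s * (z - z')\<bar>"
        using hl[of "r * y + s * z" "r * y + s * z'"] by (simp add: right_diff_distrib)
      then show "dist (h (r * y + s * z)) (h (r * y + s * z')) \<le> \<bar>s\<bar> * dist z z'" by (simp add: dist_real_def abs_mult)
    qed simp
  qed
  have HL: "1-lipschitz_on UNIV (\<lambda>y. H y / r)"
  proof (rule lipschitz_onI)
    fix y y'
    have "H y - H y' = (\<integral>z. h (r * y + s * z) - h (r * y' + s * z) \<partial>\<eta>)"
      unfolding H_def using ih by simp
    also have "\<bar>\<dots>\<bar> \<le> (\<integral>z. \<bar>h (r * y + s * z) - h (r * y' + s * z)\<bar> \<partial>\<eta>)" by (rule integral_abs_bound)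
    also have "\<dots> \<le> (\<integral>z. r * \<bar>y - y'\<bar> \<partial>\<eta>)"
    proof (rule integral_mono)
      fix z
      have "\<bar>h (r * y + s * z) - h (r * y' + s * z)\<bar> \<le> \<bar>r * (y - y')\<bar>"
        using hl[of "r * y + s * z" "r * y' + s * z"] by (simp add: right_diff_distrib)
      then show "\<bar>h (r * y + s * z) - h (r * y' + s * z)\<bar> \<le> r * \<bar>y - y'\<bar>" using r by (simp add: abs_mult)
    qed (use ih in auto)
    finally have "\<bar>H y - H y'\<bar> \<le> r * \<bar>y - y'\<bar>" using P.prob_space by simp
    then show "dist (H y / r) (H y' / r) \<le> 1 * dist y y'"
      using r by (simp add: dist_real_def diff_divide_distrib[symmetric] abs_divide divide_le_eq mult.commute)
  qed simp
  have eq: "(\<integral>x. h x \<partial>lin_law r s \<mu> \<eta>) = r * (\<integral>y. H y / r \<partial>\<mu>)" if m: "real_distribution \<mu>" "integrable \<mu> (\<lambda>x. x)" for \<mu>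
  proof -
    have "integrable (lin_law r s \<mu> \<eta>) h"
      by (rule lipschitz_integrable[OF real_distribution_lin_law[OF m(1) pl(1)] integrable_lin_law[OF m(1) pl(1) m(2) pl(2)] h])
    then have "(\<integral>x. h x \<partial>lin_law r s \<mu> \<eta>) = (\<integral>y. H y \<partial>\<mu>)"
      unfolding H_def by (intro integral_lin_law m pl) auto
    then show ?thesis using r by simp
  qed
  have "\<bar>r * (\<integral>y. H y / r \<partial>\<mu>) - r * (\<integral>y. H y / r \<partial>\<nu>)\<bar> = r * \<bar>(\<integral>y. H y / r \<partial>\<mu>) - (\<integral>y. H y / r \<partial>\<nu>)\<bar>"
    using r by (simp only: right_diff_distrib[symmetric] abs_mult abs_of_pos)
  also have "\<dots> \<le> r * d" using r by (intro mult_left_mono d HL) auto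
  finally show ?thesis unfolding eq[OF mu] eq[OF nu] .
qed

text \<open>Both integrals are compared with \<open>h 0\<close>. This crude bound starts the
  induction at an index where nothing better is known.\<close>

lemma lipschitz_integral_diff_le_moments:
  fixes h :: "real \<Rightarrow> real"
  assumes mu: "real_distribution \<mu>" "integrable \<mu> (\<lambda>x. x)" and nu: "real_distribution \<nu>" "integrable \<nu> (\<lambda>x. x)"
    and h: "1-lipschitz_on UNIV h"
  shows "\<bar>(\<integral>x. h x \<partial>\<mu>) - (\<integral>x. h x \<partial>\<nu>)\<bar> \<le> (\<integral>x. \<bar>x\<bar> \<partial>\<mu>) + (\<integral>x. \<bar>x\<bar> \<partial>\<nu>)"
proof -
  have *: "\<bar>(\<integral>x. h x \<partial>\<mu>) - h 0\<bar> \<le> (\<integral>x. \<bar>x\<bar> \<partial>\<mu>)" if m: "real_distribution \<mu>" "integrable \<mu> (\<lambda>x. x)" for \<mu>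
  proof -
    interpret real_distribution \<mu> by (rule m)
    have ih: "integrable \<mu> h" by (rule lipschitz_integrable[OF m h])
    have "(\<integral>x. h x \<partial>\<mu>) - h 0 = (\<integral>x. h x - h 0 \<partial>\<mu>)" using ih prob_space by (simp del: space_eq_univ)
    also have "\<bar>\<dots>\<bar> \<le> (\<integral>x. \<bar>h x - h 0\<bar> \<partial>\<mu>)" by (rule integral_abs_bound)
    also have "\<dots> \<le> (\<integral>x. \<bar>x\<bar> \<partial>\<mu>)"
      using ih m lipschitz_onD[OF h, of _ 0] by (intro integral_mono) (auto simp: dist_real_def)
    finally show ?thesis .
  qed
  show ?thesis using *[OF mu] *[OF nu] by linarith
qed

lemma euler_scheme_rates:
  fixes a \<theta> :: real and \<gamma> :: "nat \<Rightarrow> real" and \<mu> :: "nat \<Rightarrow> real measure"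
  assumes a: "1 < a" "a < 2" and \<theta>: "\<theta> = 2 / a - 1"
    and nu: "real_distribution \<nu>" and char_nu: "\<And>u. char \<nu> u = of_real (exp (- (1 / a) * \<bar>u\<bar> powr a))"
    and mu: "\<And>n. real_distribution (\<mu> n)" and int: "\<And>n. integrable (\<mu> n) (\<lambda>x. x)"
    and step: "\<And>n. \<mu> (Suc n) = lin_law (1 - \<gamma> (Suc n)) (\<gamma> (Suc n) powr (1 / a) / pareto_scale a) (\<mu> n) (pareto_law a)"
    and pos: "\<And>n. 1 \<le> n \<Longrightarrow> 0 < \<gamma> n" and dec: "\<And>n. 1 \<le> n \<Longrightarrow> \<gamma> (Suc n) \<le> \<gamma> n" and lim: "\<gamma> \<longlonglongrightarrow> 0"
    and div: "filterlim (\<lambda>n. \<Sum>i=1..n. \<gamma> i) at_top sequentially"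
    and ratio: "eventually (\<lambda>k. \<gamma> k powr \<theta> \<le> \<gamma> (Suc k) powr \<theta> * (1 + \<gamma> (Suc k) / 2)) sequentially"
  obtains c C where "0 < c"
    "eventually (\<lambda>n. \<forall>h. 1-lipschitz_on UNIV h \<longrightarrow> \<bar>(\<integral>x. h x \<partial>\<mu> n) - (\<integral>x. h x \<partial>\<nu>)\<bar> \<le> C * \<gamma> n powr \<theta>) sequentially"
    "eventually (\<lambda>n. c * \<gamma> n powr \<theta> \<le> Re (char (\<mu> n) 1) - Re (char \<nu> 1)) sequentially"
proof -
  have int_nu: "integrable \<nu> (\<lambda>x. x)" using nu a char_nu by (rule integrable_real_distribution_ident)
  have pl: "real_distribution (pareto_law a)" "integrable (pareto_law a) (\<lambda>x. x)"
    using a by (auto intro: real_distribution_pareto_law integrable_pareto_law)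
  have beta: "0 < pareto_scale a"
    using stable_const_pos[of a] a by (simp add: pareto_scale_def)
  have th: "0 < \<theta>" "\<theta> < 1" "2 / a = 1 + \<theta>" using a by (auto simp: \<theta> field_simps)
  obtain C1 where C1: "0 < C1" "\<And>g h. 0 < g \<Longrightarrow> g \<le> 1 / 2 \<Longrightarrow> 1-lipschitz_on UNIV h \<Longrightarrow>
     \<bar>(\<integral>x. h x \<partial>lin_law (1 - g) (g powr (1 / a) / pareto_scale a) \<nu> (pareto_law a)) - (\<integral>x. h x \<partial>\<nu>)\<bar> \<le> C1 * g powr (2 / a)"
    using lipschitz_one_step_le[OF a nu char_nu] by blast
  \<comment> \<open>The second threshold makes the factor of the Pareto noise at most 1, so that the
    lower bound for the symbol applies at all frequencies in (0, 1].\<close>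
  have "eventually (\<lambda>n. \<gamma> n < min (1 / 2) (pareto_scale a powr a)) sequentially"
    using lim beta by (intro order_tendstoD(2)) auto
  with ratio have "eventually (\<lambda>n. n \<ge> 1 \<and> \<gamma> n < min (1 / 2) (pareto_scale a powr a) \<and>
      \<gamma> n powr \<theta> \<le> \<gamma> (Suc n) powr \<theta> * (1 + \<gamma> (Suc n) / 2)) sequentially"
    using eventually_ge_at_top[of 1] by eventually_elim auto
  then obtain n0 where n0: "\<And>n. n \<ge> n0 \<Longrightarrow> n \<ge> 1 \<and> \<gamma> n < min (1 / 2) (pareto_scale a powr a) \<and>
      \<gamma> n powr \<theta> \<le> \<gamma> (Suc n) powr \<theta> * (1 + \<gamma> (Suc n) / 2)"
    by (auto simp: eventually_sequentially)
  have g: "0 < \<gamma> n" "\<gamma> n \<le> 1 / 2" "\<gamma> n powr (1 / a) / pareto_scale a \<le> 1" "\<gamma> (Suc n) \<le> \<gamma> n"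
      "\<gamma> n powr \<theta> \<le> \<gamma> (Suc n) powr \<theta> * (1 + \<gamma> (Suc n) / 2)" if "n \<ge> n0" for n
  proof -
    note n = n0[OF that]
    show "0 < \<gamma> n" using n pos by simp
    show "\<gamma> n \<le> 1 / 2" using n by simp
    have "\<gamma> n powr (1 / a) \<le> (pareto_scale a powr a) powr (1 / a)"
      using n a \<open>0 < \<gamma> n\<close> by (intro powr_mono2) auto
    also have "\<dots> = pareto_scale a" using a beta by (simp add: powr_powr)
    finally show "\<gamma> n powr (1 / a) / pareto_scale a \<le> 1" using beta by (simp add: divide_le_eq)
    show "\<gamma> (Suc n) \<le> \<gamma> n" using n dec by simp
    show "\<gamma> n powr \<theta> \<le> \<gamma> (Suc n) powr \<theta> * (1 + \<gamma> (Suc n) / 2)" using n by simp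
  qed
  have gS: "\<gamma> (Suc n) powr (2 / a) = \<gamma> (Suc n) * \<gamma> (Suc n) powr \<theta>" if "n \<ge> n0" for n
    using g(1)[of "Suc n"] that by (simp add: th(3) powr_add)
  define D0 where "D0 = (\<integral>x. \<bar>x\<bar> \<partial>\<mu> n0)"
  have D0: "0 \<le> D0" by (simp add: D0_def)
  \<comment> \<open>The part \<open>2 * C1\<close> lets the contraction by 1 - G/2 absorb the
    one-step error \<open>C1 * (G * t)\<close>; the quotient is what the base case at
    \<open>n0\<close> demands.\<close>
  define C where "C = 2 * C1 + (D0 + (\<integral>x. \<bar>x\<bar> \<partial>\<nu>)) / \<gamma> n0 powr \<theta>"
  have upper: "\<bar>(\<integral>x. h x \<partial>\<mu> n) - (\<integral>x. h x \<partial>\<nu>)\<bar> \<le> C * \<gamma> n powr \<theta>" if "n \<ge> n0" "1-lipschitz_on UNIV h" for n h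
    using that
  proof (induction n arbitrary: h rule: dec_induct)
    case base
    have p: "0 < \<gamma> n0 powr \<theta>" using g(1)[of n0] by simp
    have "(2 * C1 + y / p) * p = 2 * C1 * p + y" if "0 < p" for y p :: real
      using that by (simp add: distrib_right)
    from this[OF p] have "(D0 + (\<integral>x. \<bar>x\<bar> \<partial>\<nu>)) \<le> C * \<gamma> n0 powr \<theta>" unfolding C_def using C1(1) p by simp
    then show ?case
      using lipschitz_integral_diff_le_moments[OF mu int nu int_nu base] unfolding D0_def by (rule order_trans[rotated])
  next
    case (step n)
    define G where "G = \<gamma> (Suc n)"
    define t where "t = G powr \<theta>"
    have G: "0 < G" "G \<le> 1 / 2" using g[of "Suc n"] step by (auto simp: G_def)
    have t: "0 < t" using G by (simp add: t_def)
    have C0: "2 * C1 \<le> C" by (simp add: C_def D0_def)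
    have "\<bar>(\<integral>x. h x \<partial>\<mu> (Suc n)) - (\<integral>x. h x \<partial>lin_law (1 - G) (G powr (1 / a) / pareto_scale a) \<nu> (pareto_law a))\<bar>
        \<le> (1 - G) * (C * \<gamma> n powr \<theta>)"
      unfolding assms(8) G_def[symmetric] using G step
      by (intro lin_law_contraction mu int nu int_nu pl) auto
    moreover have "\<bar>(\<integral>x. h x \<partial>lin_law (1 - G) (G powr (1 / a) / pareto_scale a) \<nu> (pareto_law a)) - (\<integral>x. h x \<partial>\<nu>)\<bar> \<le> C1 * (G * t)"
      using C1(2)[OF G step.prems] gS[of n] step by (simp add: G_def t_def)
    \<comment> \<open>Passing from the old to the new rate costs the factor 1 + G/2, that is half of
      the contraction: (1 - G)(1 + G/2) \<le> 1 - G/2.\<close>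
    moreover have "(1 - G) * (C * \<gamma> n powr \<theta>) \<le> (1 - G / 2) * (C * t)"
    proof -
      have "(1 - G) * (C * \<gamma> n powr \<theta>) \<le> (1 - G) * (C * (t * (1 + G / 2)))"
        using g(5)[of n] step G C0 C1 by (intro mult_left_mono) (auto simp: G_def t_def)
      also have "\<dots> = ((1 - G) * (1 + G / 2)) * (C * t)" by simp
      also have "\<dots> \<le> (1 - G / 2) * (C * t)"
        using G t C0 C1 by (intro mult_right_mono) (auto simp: algebra_simps)
      finally show ?thesis .
    qed
    moreover have "2 * (C1 * (G * t)) \<le> C * (G * t)" using C0 G t mult_right_mono[of "2 * C1" C "G * t"] by simp
    moreover have "(1 - G / 2) * (C * t) = C * t - C * (G * t) / 2" by (simp add: algebra_simps)
    ultimately show ?case unfolding G_def[symmetric] t_def[symmetric] by linarith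
  qed
  define c where "c = exp (- 1) / (4 * (pareto_scale a)\<^sup>2)"
  have c: "0 < c" using beta by (simp add: c_def)
  \<comment> \<open>The recursion starts at \<open>n0\<close>, hence the shift. Its initial value
    pays for the first moment at \<open>n0\<close> and, through \<open>c / 3\<close>, for the
    quadratic term, which is at most \<open>c / 3 * v\<close> on (0, 1].\<close>
  define D where "D n = rec_nat (D0 + c / 3) (\<lambda>k d. (1 - \<gamma> (Suc (n0 + k))) * d + 2 * (\<gamma> (Suc (n0 + k)))\<^sup>2) (n - n0)" for n
  have Dn0: "D n0 = D0 + c / 3" by (simp add: D_def)
  have DS: "D (Suc n) = (1 - \<gamma> (Suc n)) * D n + 2 * (\<gamma> (Suc n))\<^sup>2" if "n \<ge> n0" for n
    using that by (simp add: D_def Suc_diff_le)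
  have Dnn: "0 \<le> D n" if "n \<ge> n0" for n
    using that
  proof (induction n rule: dec_induct)
    case (step n)
    then show ?case using g(2)[of "Suc n"] by (simp add: DS)
  qed (use Dn0 D0 c in simp)
  have gle1: "\<gamma> n powr \<theta> \<le> 1" if "n \<ge> n0" for n using g[OF that] th by (intro powr_le1) auto
  have lower: "c / 3 * \<gamma> n powr \<theta> * v\<^sup>2 - D n * v \<le> Re (char (\<mu> n) v) - exp (- (1 / a) * v powr a)"
    if "n \<ge> n0" "0 < v" "v \<le> 1" for n v
    using that
  proof (induction n arbitrary: v rule: dec_induct)
    case base
    have "c / 3 * \<gamma> n0 powr \<theta> * v\<^sup>2 \<le> (c / 3 * 1) * v"
      using c base gle1[of n0] by (intro mult_mono) (auto simp: power2_eq_square mult_left_le)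
    moreover have "1 - v * D0 \<le> Re (char (\<mu> n0) v)" unfolding D0_def using base by (intro Re_char_ge mu int) auto
    moreover have "exp (- (1 / a) * v powr a) \<le> 1" using a by simp
    ultimately show ?case unfolding Dn0 distrib_right mult.commute[of v D0] mult_1_right by linarith
  next
    case (step n)
    define G where "G = \<gamma> (Suc n)"
    define t where "t = G powr \<theta>"
    have G: "0 < G" "G \<le> 1 / 2" "G powr (1 / a) / pareto_scale a \<le> 1" using g[of "Suc n"] step by (auto simp: G_def)
    have t: "0 < t" using G by (simp add: t_def)
    have tn: "t \<le> \<gamma> n powr \<theta>"
      unfolding t_def G_def using g[of n] g(1)[of "Suc n"] step th by (intro powr_mono2) auto
    have "((1 - G) ^ 3 * (c / 3 * \<gamma> n powr \<theta>) + c * G powr (2 / a)) * v\<^sup>2 - ((1 - G) * D n + 2 * G\<^sup>2) * v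
      \<le> Re (char (lin_law (1 - G) (G powr (1 / a) / pareto_scale a) (\<mu> n) (pareto_law a)) v) - exp (- (1 / a) * v powr a)"
      unfolding c_def using step.IH c G step.prems step.hyps
      by (intro char_lower_step a mu Dnn) (auto simp: c_def)
    \<comment> \<open>The reason for the factor 1/3: by Bernoulli the cube loses at most 3 G times
      \<open>c / 3 * t\<close>, which is exactly the gain
      \<open>c * G powr (2 / a) = c * G * t\<close>.\<close>
    moreover have "c / 3 * t \<le> (1 - G) ^ 3 * (c / 3 * \<gamma> n powr \<theta>) + c * G powr (2 / a)"
    proof -
      have "1 - 3 * G \<le> (1 - G) ^ 3" using Bernoulli_inequality[of "- G" 3] G by simp
      then have "(1 - 3 * G) * (c / 3 * t) \<le> (1 - G) ^ 3 * (c / 3 * t)" using c t by (intro mult_right_mono) auto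
      also have "\<dots> \<le> (1 - G) ^ 3 * (c / 3 * \<gamma> n powr \<theta>)" using c tn G by (intro mult_left_mono) auto
      finally show ?thesis using gS[of n] step by (simp add: G_def t_def algebra_simps)
    qed
    then have "c / 3 * t * v\<^sup>2 \<le> ((1 - G) ^ 3 * (c / 3 * \<gamma> n powr \<theta>) + c * G powr (2 / a)) * v\<^sup>2"
      by (intro mult_right_mono) auto
    ultimately show ?case
      using DS[of n] step.hyps unfolding assms(8) G_def[symmetric] t_def[symmetric] by simp
  qed
  define x where "x n = D n / \<gamma> n powr \<theta>" for n
  \<comment> \<open>Relative to the rate, the source \<open>2 * G\<^sup>2\<close> becomes G times
    \<open>2 * G powr (1 - \<theta>)\<close>, which is small because \<theta> < 1.\<close>
  have "x \<longlonglongrightarrow> 0"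
  proof (rule recursion_tendsto_0[where m=n0 and g=\<gamma> and \<epsilon>="\<lambda>n. 2 * \<gamma> n powr (1 - \<theta>)"])
    show "0 \<le> x n" if "n \<ge> n0" for n using Dnn[OF that] by (simp add: x_def)
    show "0 \<le> \<gamma> (Suc n)" "\<gamma> (Suc n) \<le> 1" if "n \<ge> n0" for n using g[of "Suc n"] that by auto
    show "x (Suc n) \<le> (1 - \<gamma> (Suc n) / 2) * x n + \<gamma> (Suc n) * (2 * \<gamma> (Suc n) powr (1 - \<theta>))" if "n \<ge> n0" for n
    proof -
      define G where "G = \<gamma> (Suc n)"
      define t where "t = G powr \<theta>"
      have G: "0 < G" "G \<le> 1 / 2" using g[of "Suc n"] that by (auto simp: G_def)
      have t: "0 < t" using G by (simp add: t_def)
      have gn: "0 < \<gamma> n powr \<theta>" using g(1)[OF that] by simp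
      have x0: "0 \<le> x n" using Dnn[OF that] by (simp add: x_def)
      have "D n = x n * \<gamma> n powr \<theta>" using gn by (simp add: x_def)
      also have "\<dots> \<le> x n * (t * (1 + G / 2))"
        using g(5)[OF that] x0 by (intro mult_left_mono) (auto simp: t_def G_def)
      finally have "(1 - G) * D n \<le> (1 - G) * (x n * (t * (1 + G / 2)))" using G by (intro mult_left_mono) auto
      also have "\<dots> = ((1 - G) * (1 + G / 2)) * (x n * t)" by simp
      also have "\<dots> \<le> (1 - G / 2) * (x n * t)" using G x0 t by (intro mult_right_mono) (auto simp: algebra_simps)
      finally have "D (Suc n) / t \<le> ((1 - G / 2) * (x n * t) + 2 * G\<^sup>2) / t"
        unfolding DS[OF that] G_def[symmetric] using t by (intro divide_right_mono) auto
      also have "\<dots> = (1 - G / 2) * x n + 2 * (G\<^sup>2 / t)" using t by (simp add: add_divide_distrib)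
      also have "G\<^sup>2 / t = G * G powr (1 - \<theta>)" using G by (simp add: t_def powr_diff power2_eq_square)
      finally show ?thesis by (simp add: x_def G_def t_def mult_ac)
    qed
    have "(\<lambda>n. \<gamma> n powr (1 - \<theta>)) \<longlonglongrightarrow> 0"
    proof (rule tendsto_zero_powrI[OF lim tendsto_const])
      show "eventually (\<lambda>n. 0 \<le> \<gamma> n) sequentially"
        using eventually_ge_at_top[of 1] by eventually_elim (use pos in \<open>auto intro: less_imp_le\<close>)
    qed (use th in simp)
    then show "(\<lambda>n. 2 * \<gamma> n powr (1 - \<theta>)) \<longlonglongrightarrow> 0" by (rule tendsto_mult_right_zero)
  qed (rule div)
  then have xs: "eventually (\<lambda>n. x n < c / 6) sequentially" using c by (intro order_tendstoD(2)) auto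
  have ev: "eventually (\<lambda>n. n \<ge> n0) sequentially" by (rule eventually_ge_at_top)
  show ?thesis
  proof (rule that)
    \<comment> \<open>At frequency 1 the quadratic term has coefficient \<open>c / 3\<close>, and
      the linear term eventually uses up at most half of it.\<close>
    show "0 < c / 6" using c by simp
    show "eventually (\<lambda>n. \<forall>h. 1-lipschitz_on UNIV h \<longrightarrow> \<bar>(\<integral>x. h x \<partial>\<mu> n) - (\<integral>x. h x \<partial>\<nu>)\<bar> \<le> C * \<gamma> n powr \<theta>) sequentially"
      using ev by eventually_elim (use upper in auto)
    show "eventually (\<lambda>n. c / 6 * \<gamma> n powr \<theta> \<le> Re (char (\<mu> n) 1) - Re (char \<nu> 1)) sequentially"
      using xs ev
    proof eventually_elim
      case (elim n)
      have gn: "0 < \<gamma> n powr \<theta>" using g(1)[OF elim(2)] by simp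
      have "D n \<le> c / 6 * \<gamma> n powr \<theta>" using elim(1) gn by (simp add: x_def divide_less_eq less_imp_le)
      then show ?case using lower[OF elim(2), of 1] by (simp add: char_nu)
    qed
  qed
qed

section \<open>From random variables to laws\<close>

text \<open>The index blocks {1..n} and {Suc n} are disjoint, so the corresponding random vectors
  are independent, and so are measurable functions of them.\<close>

lemma (in prob_space) indep_var_linear_combination:
  fixes Z :: "nat \<Rightarrow> 'a \<Rightarrow> real"
  assumes "indep_vars (\<lambda>_. borel) Z {1..}"
  shows "indep_var borel (\<lambda>\<omega>. A + (\<Sum>i=1..n. c i * Z i \<omega>)) borel (Z (Suc n))"
proof -
  have "indep_var (PiM {1..n} (\<lambda>_. borel)) (\<lambda>\<omega>. restrict (\<lambda>i. Z i \<omega>) {1..n})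
      (PiM {Suc n} (\<lambda>_. borel)) (\<lambda>\<omega>. restrict (\<lambda>i. Z i \<omega>) {Suc n})"
    by (rule indep_var_restrict[OF assms]) auto
  moreover have "(\<lambda>f. A + (\<Sum>i=1..n. c i * f i)) \<in> borel_measurable (PiM {1..n} (\<lambda>_. borel :: real measure))"
    by (intro borel_measurable_add borel_measurable_const borel_measurable_sum borel_measurable_times measurable_component_singleton) auto
  moreover have "(\<lambda>f. f (Suc n)) \<in> borel_measurable (PiM {Suc n} (\<lambda>_. borel :: real measure))"
    by (intro measurable_component_singleton) auto
  ultimately have "indep_var borel ((\<lambda>f. A + (\<Sum>i=1..n. c i * f i)) \<circ> (\<lambda>\<omega>. restrict (\<lambda>i. Z i \<omega>) {1..n}))
      borel ((\<lambda>f. f (Suc n)) \<circ> (\<lambda>\<omega>. restrict (\<lambda>i. Z i \<omega>) {Suc n}))"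
    by (rule indep_var_compose)
  then show ?thesis by (simp add: comp_def)
qed

lemma (in prob_space) distr_linear_combination:
  fixes U V :: "'a \<Rightarrow> real"
  assumes "indep_var borel U borel V"
  shows "distr M borel (\<lambda>\<omega>. a * U \<omega> + b * V \<omega>) = lin_law a b (distr M borel U) (distr M borel V)"
proof -
  have [measurable]: "U \<in> borel_measurable M" "V \<in> borel_measurable M"
    using assms by (auto simp: indep_var_distribution_eq)
  have "distr M borel U \<Otimes>\<^sub>M distr M borel V = distr M (borel \<Otimes>\<^sub>M borel) (\<lambda>\<omega>. (U \<omega>, V \<omega>))"
    using assms by (simp add: indep_var_distribution_eq)
  then show ?thesis
    unfolding lin_law_def by (simp add: distr_distr comp_def)
qed

theorem lemmaA1:
  fixes \<alpha> \<theta> \<rho> :: real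
    and M :: "'a measure" and Z :: "real \<Rightarrow> 'a \<Rightarrow> real"
    and X :: "real \<Rightarrow> real \<Rightarrow> 'a \<Rightarrow> real"
    and \<nu> :: "real measure"
    and \<gamma> :: "nat \<Rightarrow> real"
    and N :: "'b measure" and Z' :: "nat \<Rightarrow> 'b \<Rightarrow> real"
    and Y :: "real \<Rightarrow> real \<Rightarrow> 'b \<Rightarrow> real"
  assumes "1 < \<alpha>" "\<alpha> < 2"
    and "symmetric_stable_process \<alpha> M Z"
    and "\<And>x. OU_solution M Z x (X x)"
    and "invariant_measure (\<lambda>t x. distr M borel (X x t)) \<nu>"
    and "\<And>n. 1 \<le> n \<Longrightarrow> 0 < \<gamma> n"
    and "\<And>n. 1 \<le> n \<Longrightarrow> \<gamma> (Suc n) \<le> \<gamma> n"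
    and "\<gamma> \<longlonglongrightarrow> 0"
    and "filterlim (\<lambda>n. \<Sum>i=1..n. \<gamma> i) at_top sequentially"
    and "\<theta> = (2 - \<alpha>) / \<alpha>"
    and "\<rho> = 1 / 2 * exp (- 2)"
    and "limsup (\<lambda>k. ereal ((\<gamma> k powr \<theta> - \<gamma> (Suc k) powr \<theta>) / \<gamma> (Suc k) powr (1 + \<theta>)))
           < ereal (min \<rho> 1)"
    and "prob_space N"
    and "prob_space.indep_vars N (\<lambda>_. borel) Z' {1..}"
    and "\<And>n. 1 \<le> n \<Longrightarrow> distributed N lborel (Z' n) (\<lambda>z. ennreal (pareto_density \<alpha> z))"
    and "\<And>x \<omega>. \<omega> \<in> space N \<Longrightarrow> Y x (step_time \<gamma> 0) \<omega> = x"
    and "\<And>x n \<omega>. \<omega> \<in> space N \<Longrightarrow>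
           Y x (step_time \<gamma> (Suc n)) \<omega> =
             Y x (step_time \<gamma> n) \<omega> - \<gamma> (Suc n) * Y x (step_time \<gamma> n) \<omega>
             + \<gamma> (Suc n) powr (1 / \<alpha>) / pareto_scale \<alpha> * Z' (Suc n) \<omega>"
  shows "\<forall>x. 0 < liminf (\<lambda>n. W1 \<nu> (distr N borel (Y x (step_time \<gamma> n))) / ereal (\<gamma> n powr (2 / \<alpha> - 1))) \<and>
             liminf (\<lambda>n. W1 \<nu> (distr N borel (Y x (step_time \<gamma> n))) / ereal (\<gamma> n powr (2 / \<alpha> - 1)))
               \<le> limsup (\<lambda>n. W1 \<nu> (distr N borel (Y x (step_time \<gamma> n))) / ereal (\<gamma> n powr (2 / \<alpha> - 1))) \<and>
             limsup (\<lambda>n. W1 \<nu> (distr N borel (Y x (step_time \<gamma> n))) / ereal (\<gamma> n powr (2 / \<alpha> - 1))) < \<infinity>"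
proof
  fix x :: real
  interpret prob_space N by fact
  note a = assms(1,2)
  define \<mu> where "\<mu> n = distr N borel (Y x (step_time \<gamma> n))" for n
  have nu: "real_distribution \<nu>" and char_nu: "\<And>u. char \<nu> u = of_real (exp (- (1 / \<alpha>) * \<bar>u\<bar> powr \<alpha>))"
    using char_OU_invariant_measure[OF a(1) assms(3-5)] by auto
  have th: "\<theta> = 2 / \<alpha> - 1" using a unfolding assms(10) by (simp add: field_simps)
  have Zm: "Z' n \<in> borel_measurable N" "distr N borel (Z' n) = pareto_law \<alpha>" if "1 \<le> n" for n
  proof -
    have "distr N lborel (Z' n) = pareto_law \<alpha>"
      using assms(15)[OF that] by (simp add: distributed_def pareto_law_def)
    moreover have "distr N lborel (Z' n) = distr N borel (Z' n)" by (rule distr_cong) auto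
    ultimately show "distr N borel (Z' n) = pareto_law \<alpha>" by simp
    show "Z' n \<in> borel_measurable N" using assms(15)[OF that] by (simp add: distributed_def)
  qed
  \<comment> \<open>Y is given by its recursion only. The affine representation in the first n noise
    variables yields its measurability and its independence of the next noise variable.\<close>
  have repr: "\<exists>A c. \<forall>\<omega>\<in>space N. Y x (step_time \<gamma> n) \<omega> = A + (\<Sum>i=1..n. c i * Z' i \<omega>)" for n
  proof (induction n)
    case 0
    show ?case by (intro exI[of _ x]) (use assms(16) in auto)
  next
    case (Suc n)
    then obtain A c where Ac: "\<And>\<omega>. \<omega> \<in> space N \<Longrightarrow> Y x (step_time \<gamma> n) \<omega> = A + (\<Sum>i=1..n. c i * Z' i \<omega>)" by blast
    define g s where "g = \<gamma> (Suc n)" and "s = g powr (1 / \<alpha>) / pareto_scale \<alpha>"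
    show ?case
    proof (intro exI[of _ "(1 - g) * A"] exI[of _ "\<lambda>i. if i = Suc n then s else (1 - g) * c i"] ballI)
      fix \<omega> assume w: "\<omega> \<in> space N"
      have "(\<Sum>i=1..n. (if i = Suc n then s else (1 - g) * c i) * Z' i \<omega>) = (1 - g) * (\<Sum>i=1..n. c i * Z' i \<omega>)"
        unfolding sum_distrib_left by (intro sum.cong) auto
      then show "Y x (step_time \<gamma> (Suc n)) \<omega> = (1 - g) * A + (\<Sum>i=1..Suc n. (if i = Suc n then s else (1 - g) * c i) * Z' i \<omega>)"
        unfolding assms(17)[OF w] Ac[OF w] g_def[symmetric] s_def[symmetric] by (simp add: algebra_simps)
    qed
  qed
  have Ym: "Y x (step_time \<gamma> n) \<in> borel_measurable N" for n
  proof -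
    obtain A c where Ac: "\<And>\<omega>. \<omega> \<in> space N \<Longrightarrow> Y x (step_time \<gamma> n) \<omega> = A + (\<Sum>i=1..n. c i * Z' i \<omega>)" using repr by blast
    have "(\<lambda>\<omega>. A + (\<Sum>i=1..n. c i * Z' i \<omega>)) \<in> borel_measurable N"
      using Zm(1) by (intro borel_measurable_add borel_measurable_const borel_measurable_sum borel_measurable_times) auto
    then show ?thesis by (subst measurable_cong[OF Ac])
  qed
  have mu: "real_distribution (\<mu> n)" for n unfolding \<mu>_def by (intro real_distribution_distr Ym)
  have step: "\<mu> (Suc n) = lin_law (1 - \<gamma> (Suc n)) (\<gamma> (Suc n) powr (1 / \<alpha>) / pareto_scale \<alpha>) (\<mu> n) (pareto_law \<alpha>)" for n
  proof -
    define g s where "g = \<gamma> (Suc n)" and "s = g powr (1 / \<alpha>) / pareto_scale \<alpha>"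
    obtain A c where Ac: "\<And>\<omega>. \<omega> \<in> space N \<Longrightarrow> Y x (step_time \<gamma> n) \<omega> = A + (\<Sum>i=1..n. c i * Z' i \<omega>)" using repr by blast
    define U where "U \<omega> = A + (\<Sum>i=1..n. c i * Z' i \<omega>)" for \<omega>
    have "\<mu> (Suc n) = distr N borel (\<lambda>\<omega>. (1 - g) * U \<omega> + s * Z' (Suc n) \<omega>)"
      unfolding \<mu>_def
    proof (rule distr_cong)
      fix \<omega> assume w: "\<omega> \<in> space N"
      show "Y x (step_time \<gamma> (Suc n)) \<omega> = (1 - g) * U \<omega> + s * Z' (Suc n) \<omega>"
        unfolding assms(17)[OF w] Ac[OF w] g_def[symmetric] s_def[symmetric] U_def by (simp add: algebra_simps)
    qed auto
    also have "\<dots> = lin_law (1 - g) s (distr N borel U) (distr N borel (Z' (Suc n)))"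
      unfolding U_def[abs_def] by (intro distr_linear_combination indep_var_linear_combination assms(14))
    also have "distr N borel U = \<mu> n"
      unfolding \<mu>_def by (rule distr_cong) (auto simp: Ac U_def)
    finally show ?thesis by (simp add: Zm g_def s_def)
  qed
  have int: "integrable (\<mu> n) (\<lambda>x. x)" for n
  proof (induction n)
    case 0
    have "\<mu> 0 = distr N borel (\<lambda>_. x)"
      unfolding \<mu>_def by (rule distr_cong) (use assms(16) in auto)
    then show ?case by (simp only:) (subst integrable_distr_eq; simp)
  next
    case (Suc n)
    then show ?case
      unfolding step using a
      by (intro integrable_lin_law mu real_distribution_pareto_law integrable_pareto_law) auto
  qed
  \<comment> \<open>Since \<rho> is half of \<open>exp (- 2)\<close>, the limit superior lies below
    1/2; clearing the denominator \<open>\<gamma> powr (1 + \<theta>)\<close> gives the inequality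
    between consecutive rates used by the induction.\<close>
  have ratio: "eventually (\<lambda>k. \<gamma> k powr \<theta> \<le> \<gamma> (Suc k) powr \<theta> * (1 + \<gamma> (Suc k) / 2)) sequentially"
  proof -
    have "\<rho> \<le> 1 / 2" unfolding assms(11) by simp
    then have "min \<rho> 1 \<le> 1 / 2" by simp
    then have "limsup (\<lambda>k. ereal ((\<gamma> k powr \<theta> - \<gamma> (Suc k) powr \<theta>) / \<gamma> (Suc k) powr (1 + \<theta>))) < ereal (1 / 2)"
      using assms(12) by (meson ereal_less_eq(3) less_le_trans)
    then have "eventually (\<lambda>k. ereal ((\<gamma> k powr \<theta> - \<gamma> (Suc k) powr \<theta>) / \<gamma> (Suc k) powr (1 + \<theta>)) < ereal (1 / 2)) sequentially"
      by (rule Limsup_lessD)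
    then show ?thesis
    proof eventually_elim
      case (elim k)
      have G: "0 < \<gamma> (Suc k)" using assms(6) by simp
      have "\<gamma> k powr \<theta> - \<gamma> (Suc k) powr \<theta> < 1 / 2 * \<gamma> (Suc k) powr (1 + \<theta>)"
        using elim G by (simp add: divide_less_eq)
      also have "\<gamma> (Suc k) powr (1 + \<theta>) = \<gamma> (Suc k) * \<gamma> (Suc k) powr \<theta>" using G by (simp add: powr_add)
      finally show ?case by (simp add: algebra_simps)
    qed
  qed
  obtain c C where cC: "0 < c"
    "eventually (\<lambda>n. \<forall>h. 1-lipschitz_on UNIV h \<longrightarrow> \<bar>(\<integral>x. h x \<partial>\<mu> n) - (\<integral>x. h x \<partial>\<nu>)\<bar> \<le> C * \<gamma> n powr \<theta>) sequentially"
    "eventually (\<lambda>n. c * \<gamma> n powr \<theta> \<le> Re (char (\<mu> n) 1) - Re (char \<nu> 1)) sequentially"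
    using euler_scheme_rates[OF a th nu char_nu mu int step assms(6-9) ratio] by blast
  define r where "r n = \<gamma> n powr (2 / \<alpha> - 1)" for n
  have r: "0 < r n" if "1 \<le> n" for n using assms(6)[OF that] by (simp add: r_def)
  have ev1: "eventually (\<lambda>n. 1 \<le> n) sequentially" by (rule eventually_ge_at_top)
  have up: "eventually (\<lambda>n. W1 \<nu> (\<mu> n) / ereal (r n) \<le> ereal C) sequentially"
    using cC(2) ev1
  proof eventually_elim
    case (elim n)
    have "W1 \<nu> (\<mu> n) \<le> ereal (C * r n)"
      unfolding W1_def
    proof (rule SUP_least)
      fix h :: "real \<Rightarrow> real" assume "h \<in> {h. 1-lipschitz_on UNIV h}"
      then have "\<bar>(\<integral>x. h x \<partial>\<mu> n) - (\<integral>x. h x \<partial>\<nu>)\<bar> \<le> C * r n" using elim(1) by (auto simp: r_def th)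
      then show "ereal ((\<integral>x. h x \<partial>\<nu>) - (\<integral>x. h x \<partial>\<mu> n)) \<le> ereal (C * r n)" by simp
    qed
    then have "W1 \<nu> (\<mu> n) / ereal (r n) \<le> ereal (C * r n) / ereal (r n)"
      using r[OF elim(2)] by (intro ereal_divide_right_mono) auto
    then show ?case using r[OF elim(2)] by simp
  qed
  have low: "eventually (\<lambda>n. ereal c \<le> W1 \<nu> (\<mu> n) / ereal (r n)) sequentially"
    using cC(3) ev1
  proof eventually_elim
    case (elim n)
    have Re: "Re (char m 1) = (\<integral>x. cos x \<partial>m)" if "real_distribution m" for m
    proof -
      interpret m: real_distribution m by fact
      show ?thesis unfolding char_def
        by (subst integral_Re[symmetric]) (auto intro!: m.integrable_const_bound[of _ 1] simp: Re_exp)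
    qed
    have lip: "1-lipschitz_on UNIV (\<lambda>x::real. - cos x)"
    proof (rule lipschitz_onI)
      fix u v :: real
      have "\<bar>cos u - cos v\<bar> = 2 * (\<bar>sin ((u + v) / 2)\<bar> * \<bar>sin ((v - u) / 2)\<bar>)" by (simp add: cos_diff_cos abs_mult)
      also have "\<dots> \<le> 2 * (1 * \<bar>(v - u) / 2\<bar>)"
        by (intro mult_left_mono mult_mono abs_sin_x_le_abs_x) auto
      finally show "dist (- cos u) (- cos v) \<le> 1 * dist u v" by (simp add: dist_real_def abs_minus_commute)
    qed simp
    \<comment> \<open>The minus sign in the test function compensates for \<open>\<nu>\<close> being
      the first argument of \<open>W1\<close>: the cosine integral of the scheme exceeds that of
      \<open>\<nu>\<close>.\<close>
    have "ereal (c * r n) \<le> ereal ((\<integral>x. - cos x \<partial>\<nu>) - (\<integral>x. - cos x \<partial>\<mu> n))"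
      using elim(1) by (simp add: Re[OF nu] Re[OF mu] r_def th)
    also have "\<dots> \<le> W1 \<nu> (\<mu> n)"
      unfolding W1_def using lip by (intro SUP_upper) simp
    finally have "ereal (c * r n) / ereal (r n) \<le> W1 \<nu> (\<mu> n) / ereal (r n)"
      using r[OF elim(2)] by (intro ereal_divide_right_mono) auto
    then show ?case using r[OF elim(2)] by simp
  qed
  have l: "ereal c \<le> liminf (\<lambda>n. W1 \<nu> (\<mu> n) / ereal (r n))" using low by (rule Liminf_bounded)
  have u: "limsup (\<lambda>n. W1 \<nu> (\<mu> n) / ereal (r n)) \<le> ereal C" using up by (rule Limsup_bounded)
  have m: "liminf (\<lambda>n. W1 \<nu> (\<mu> n) / ereal (r n)) \<le> limsup (\<lambda>n. W1 \<nu> (\<mu> n) / ereal (r n))"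
    by (rule Liminf_le_Limsup) simp
  have "0 < liminf (\<lambda>n. W1 \<nu> (\<mu> n) / ereal (r n))"
    using l cC(1) by (meson ereal_less(2) less_le_trans)
  moreover have "limsup (\<lambda>n. W1 \<nu> (\<mu> n) / ereal (r n)) < \<infinity>" using u by (meson le_less_trans less_ereal.simps(4))
  ultimately show "0 < liminf (\<lambda>n. W1 \<nu> (distr N borel (Y x (step_time \<gamma> n))) / ereal (\<gamma> n powr (2 / \<alpha> - 1))) \<and>
             liminf (\<lambda>n. W1 \<nu> (distr N borel (Y x (step_time \<gamma> n))) / ereal (\<gamma> n powr (2 / \<alpha> - 1)))
               \<le> limsup (\<lambda>n. W1 \<nu> (distr N borel (Y x (step_time \<gamma> n))) / ereal (\<gamma> n powr (2 / \<alpha> - 1))) \<and>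
             limsup (\<lambda>n. W1 \<nu> (distr N borel (Y x (step_time \<gamma> n))) / ereal (\<gamma> n powr (2 / \<alpha> - 1))) < \<infinity>"
    using m unfolding \<mu>_def r_def by blast
qed

end
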